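(* Let $(X_i)_{i\in\mathbb{Z}}$ be a stationary and ergodic sequence of real random variables with $\mathbb{E}[X_0]=0$, $\mathbb{E}[X_0^4]<\infty$ and $$\sum_{j=1}^\infty\left\|\mathbb{E}\left[X_j-\mathbb{E}[X_0]\,\big|\,\sigma(\{X_i\}_{-\infty<i\le0})\right]\right\|<\infty,$$ where $\|\cdot\|$ denotes the $L^2$ norm. Let the block lengths $b=b(n)$ satisfy $b=o(n^\alpha)$ with $\alpha\in(0,2/5)$. Then, as $n\to\infty$, $$\sup_{x\in\mathbb{R}}\left|\mathbb{P}\left[\sqrt n\left(\frac1n\sum_{i=1}^nX_i\right)\le x\right]-\mathbb{P}^*\left[\sqrt n\left(\frac1n\sum_{i=1}^nX_i^*-\mathbb{E}^*\left[\frac1n\sum_{i=1}^nX_i^*\right]\right)\le x\right]\right|\to0$$ in probability.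
   Context: Moving blocks bootstrap: for sample size $n$ and block size $b=b(n)$, put $k=n/b$ (block size and number of blocks are treated as positive integers). Let $I_1,\dots,I_k$ be i.i.d. uniformly distributed on $\{1,\dots,n-b+1\}$, independent of $(X_i)_{i\in\mathbb{Z}}$. The bootstrap sample $\{X_i^*\}_{i\in\{1,\dots,n\}}$ consists of the blocks $(X_{I_d+1},X_{I_d+2},\dots,X_{I_d+b})$, $d=1,\dots,k$, so that $\frac1n\sum_{i=1}^nX_i^*=\frac1k\sum_{d=1}^k\frac1b\sum_{i=1}^bX_{I_d+i}$. $\mathbb{P}^*$ and $\mathbb{E}^*$ denote probability and expectation with respect to the randomness of $I_1,\dots,I_k$, conditionally on the sequence $(X_i)$.
   Formalization: Two assumptions are added, as the claim fails without either: b(n) → ∞ (fails for b=1, X_i=Z_i+Z_{i-1}) and positive long-run variance Var X_0 + 2Σ Cov(X_0,X_j) > 0 (fails for X_i=Z_i−Z_{i-1}, Z i.i.d. ±1). k=n/b is rounded down and the bootstrap mean is over kb values. *)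

theory Defs
  imports "HOL-Probability.Probability"
begin

text \<open>A two-sided real process is \<open>X :: int \<Rightarrow> 'a \<Rightarrow> real\<close>; its path at \<open>\<omega>\<close> is an element of the
  sequence space \<open>int \<Rightarrow> real\<close> with the product Borel sigma-algebra.\<close>

definition sample_path :: "(int \<Rightarrow> 'a \<Rightarrow> real) \<Rightarrow> 'a \<Rightarrow> int \<Rightarrow> real" where
  "sample_path X \<omega> = (\<lambda>i. X i \<omega>)"

abbreviation seq_space :: "(int \<Rightarrow> real) measure" where
  "seq_space \<equiv> PiM UNIV (\<lambda>_. borel)"

definition shift :: "(int \<Rightarrow> real) \<Rightarrow> int \<Rightarrow> real" where
  "shift x = (\<lambda>i. x (i + 1))"

definition stationary :: "'a measure \<Rightarrow> (int \<Rightarrow> 'a \<Rightarrow> real) \<Rightarrow> bool" where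
  "stationary M X \<longleftrightarrow>
     (\<forall>h::int. distr M seq_space (sample_path (\<lambda>i. X (i + h))) = distr M seq_space (sample_path X))"

definition ergodic :: "'a measure \<Rightarrow> (int \<Rightarrow> 'a \<Rightarrow> real) \<Rightarrow> bool" where
  "ergodic M X \<longleftrightarrow>
     (\<forall>A \<in> sets seq_space. shift -` A = A \<longrightarrow>
        measure M {\<omega> \<in> space M. sample_path X \<omega> \<in> A} \<in> {0, 1})"

definition past_sigma :: "'a measure \<Rightarrow> (int \<Rightarrow> 'a \<Rightarrow> real) \<Rightarrow> 'a measure" where
  "past_sigma M X = sigma (space M) {X i -` B \<inter> space M | i B. i \<le> 0 \<and> B \<in> sets borel}"

definition L2norm :: "'a measure \<Rightarrow> ('a \<Rightarrow> real) \<Rightarrow> real" where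
  "L2norm M f = sqrt (\<integral>\<omega>. (f \<omega>)\<^sup>2 \<partial>M)"

text \<open>\<open>\<sigma>\<^sup>2 = Var(X\<^sub>0) + 2 \<Sum>\<^sub>j\<^sub>\<ge>\<^sub>1 Cov(X\<^sub>0, X\<^sub>j)\<close>. For a square integrable stationary process the series
  converges absolutely as soon as the norms of \<open>E[X\<^sub>j - E[X\<^sub>0] | X\<^sub>i, i \<le> 0]\<close> are summable.\<close>

definition long_run_variance :: "'a measure \<Rightarrow> (int \<Rightarrow> 'a \<Rightarrow> real) \<Rightarrow> real" where
  "long_run_variance M X =
     (let m = (\<integral>\<omega>. X 0 \<omega> \<partial>M);
          c = (\<lambda>j::nat. \<integral>\<omega>. (X 0 \<omega> - m) * (X (int j) \<omega> - m) \<partial>M)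
      in c 0 + 2 * (\<Sum>j. c (Suc j)))"

text \<open>The event probabilities below only mean something for measurable sets (\<open>measure\<close> is \<open>0\<close>
  elsewhere), so measurability is part of the definition.\<close>

definition tendsto_in_prob :: "'a measure \<Rightarrow> (nat \<Rightarrow> 'a \<Rightarrow> real) \<Rightarrow> ('a \<Rightarrow> real) \<Rightarrow> bool" where
  "tendsto_in_prob M Y Z \<longleftrightarrow>
     (\<forall>n. Y n \<in> borel_measurable M) \<and> Z \<in> borel_measurable M \<and>
     (\<forall>\<epsilon>>0. (\<lambda>n. measure M {\<omega> \<in> space M. \<bar>Y n \<omega> - Z \<omega>\<bar> > \<epsilon>}) \<longlonglongrightarrow> 0)"

definition num_blocks :: "nat \<Rightarrow> nat \<Rightarrow> nat" where
  "num_blocks n b = n div b"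

text \<open>The joint law of the i.i.d. uniform block positions \<open>I\<^sub>1, \<dots>, I\<^sub>k\<close>. Since they are independent of
  the process, the conditional probability and expectation given the process, at a path \<open>x\<close>, are
  probability and expectation under this law with \<open>x\<close> held fixed. (The default value \<open>0\<close> outside
  \<open>{1..k}\<close> is irrelevant.)\<close>

definition block_law :: "nat \<Rightarrow> nat \<Rightarrow> (nat \<Rightarrow> nat) pmf" where
  "block_law n b = Pi_pmf {1..num_blocks n b} 0 (\<lambda>_. pmf_of_set {1..n - b + 1})"

text \<open>The concatenated blocks: position \<open>i = (d - 1) b + r\<close> with \<open>1 \<le> r \<le> b\<close> carries
  \<open>x (I\<^sub>d + r)\<close>.\<close>

definition boot_sample :: "nat \<Rightarrow> (int \<Rightarrow> real) \<Rightarrow> (nat \<Rightarrow> nat) \<Rightarrow> nat \<Rightarrow> real" where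
  "boot_sample b x I i = x (int (I ((i - 1) div b + 1) + ((i - 1) mod b + 1)))"

text \<open>The mean of the \<open>k b\<close> values in the \<open>k\<close> blocks. If \<open>b\<close> divides \<open>n\<close>, then \<open>k b = n\<close>.\<close>

definition boot_mean :: "nat \<Rightarrow> nat \<Rightarrow> (int \<Rightarrow> real) \<Rightarrow> (nat \<Rightarrow> nat) \<Rightarrow> real" where
  "boot_mean n b x I =
     (\<Sum>i = 1..num_blocks n b * b. boot_sample b x I i) / real (num_blocks n b * b)"

lemma sum_consecutive_blocks:
  fixes f :: "nat \<Rightarrow> real"
  shows "(\<Sum>i = 1..k * b. f i) = (\<Sum>d = 1..k. \<Sum>r = 1..b. f ((d - 1) * b + r))"
proof (induction k)
  case (Suc k)
  have "(\<Sum>i = 1..Suc k * b. f i) = (\<Sum>i = 1..k * b. f i) + (\<Sum>i = k * b + 1..k * b + b. f i)"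
    using sum.ub_add_nat[of 1 "k * b" f b] by (simp add: add.commute)
  also have "(\<Sum>i = k * b + 1..k * b + b. f i) = (\<Sum>r = 1..b. f (k * b + r))"
    using sum.shift_bounds_cl_nat_ivl[of f 1 "k * b" b] by (simp add: add.commute)
  finally show ?case using Suc by simp
qed simp

lemma boot_mean_eq_mean_of_block_means:
  "boot_mean n b x I =
     1 / real (num_blocks n b) *
       (\<Sum>d = 1..num_blocks n b. 1 / real b * (\<Sum>r = 1..b. x (int (I d + r))))"
proof -
  have "boot_sample b x I ((d - 1) * b + r) = x (int (I d + r))"
    if "d \<in> {1..num_blocks n b}" "r \<in> {1..b}" for d r
  proof -
    from that obtain d' r' where "d = Suc d'" "r = Suc r'" "r' < b"
      by (cases d; cases r) auto
    then show ?thesis by (simp add: boot_sample_def)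
  qed
  then show ?thesis
    unfolding boot_mean_def sum_consecutive_blocks
    by (simp add: sum_distrib_left sum_divide_distrib divide_simps)
qed

definition root_cdf :: "'a measure \<Rightarrow> (int \<Rightarrow> 'a \<Rightarrow> real) \<Rightarrow> nat \<Rightarrow> real \<Rightarrow> real" where
  "root_cdf M X n x =
     measure M {\<omega> \<in> space M. sqrt (real n) * (1 / real n * (\<Sum>i = 1..n. X (int i) \<omega>)) \<le> x}"

definition boot_root_cdf :: "nat \<Rightarrow> nat \<Rightarrow> (int \<Rightarrow> real) \<Rightarrow> real \<Rightarrow> real" where
  "boot_root_cdf n b xs x =
     measure_pmf.prob (block_law n b)
       {I. sqrt (real n) *
             (boot_mean n b xs I - measure_pmf.expectation (block_law n b) (boot_mean n b xs)) \<le> x}"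

end

theory Submission
  imports Defs
begin

text \<open>On the path space with the shift \<open>T\<close>, Gordin's decomposition writes \<open>X\<^sub>1 = d - z \<circ> T + z\<close> with a
  stationary martingale difference \<open>d\<close> and \<open>z\<close> in \<open>L\<^sup>2\<close>, so partial sums are martingales up to a bounded
  \<open>L\<^sup>2\<close> error, and \<open>E[d\<^sup>2]\<close> is the long run variance \<open>s\<^sup>2\<close>. Truncating \<open>d\<close> reduces every limit statement to
  bounded martingale differences, where McLeish's product argument and the mean ergodic theorem give
  asymptotic normality.

  Given the path, the centred and scaled bootstrap mean is a normalized sum of \<open>k\<close> i.i.d. variables
      uniform on the block sums.
  By characteristic functions its distribution function is uniformly close to the normal one as soon as a
  single statistic of the path is small: the error of the mean of the squared block sums as an estimator of
  \<open>s\<^sup>2\<close>, plus the square of their mean, plus a Lindeberg term. The expectation of this statistic tends to \<open>0\<close>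
  whenever \<open>b \<rightarrow> \<infinity>\<close> and \<open>b = o(n)\<close>, and Markov's inequality concludes.\<close>

section \<open>Uniform convergence of distribution functions and arrays of i.i.d. variables\<close>

text \<open>The coboundary part \<open>z\<close> is merely square integrable, so the decomposition
  gives no higher moment bounds for block sums. Everything therefore goes through
  \<open>martingale_approx\<close>: for each \<epsilon> the sums lie within
  \<open>\<epsilon> * n\<close> in mean square of a martingale with bounded differences. Each part
  of the path statistic tolerates such an error, and the bounded martingale has fourth moments of
  order \<open>n^2\<close>, which yield Lindeberg's condition.

  Truncation destroys the martingale property, so it is followed by recentring with a conditional
  expectation.

  The blocks overlap, so their sums are neither independent nor orthogonal. Sorting the square of a
  block sum by its last index leaves a diagonal, governed by the ergodic theorem, and products of a
  past sum with a new increment, governed by orthogonality along the orbit.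

  The bootstrap limit theorem is deterministic: it holds along any sequence of paths whose statistic
  tends to \<open>0\<close>, and a contradiction turns this into one threshold valid for all paths
  at once. No almost sure convergence of the statistic is needed.\<close>

lemma uniform_limit_cdf:
  fixes \<mu> :: "nat \<Rightarrow> real measure"
  assumes "\<And>n. real_distribution (\<mu> n)" and "real_distribution \<nu>"
    and conv: "weak_conv_m \<mu> \<nu>" and cont: "\<And>x. isCont (cdf \<nu>) x"
  shows "uniform_limit UNIV (\<lambda>n. cdf (\<mu> n)) (cdf \<nu>) sequentially"
proof (rule uniform_limitI)
  interpret \<mu>: real_distribution "\<mu> n" for n by fact
  interpret \<nu>: real_distribution \<nu> by fact
  fix e :: real assume "e > 0"
  \<comment> \<open>Polya's argument: monotonicity and a continuous limit reduce uniform convergence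
    to the quantiles of \<nu> at the levels \<open>i / m\<close>. Passing to a grid point costs up
    to two steps of size \<open>1 / m\<close>, and convergence at the grid costs a third, hence
    \<open>3 / m\<close>.\<close>
  obtain m0 where "3 / e < real m0" using reals_Archimedean2 by blast
  define m where "m = Suc m0"
  have m: "m > 0" "3 / m < e"
  proof -
    have "3 / e < real m" using \<open>3 / e < real m0\<close> by (simp add: m_def)
    then show "3 / m < e" using \<open>e > 0\<close> by (simp add: field_simps m_def)
  qed (simp add: m_def)
  have "\<exists>x. cdf \<nu> x = i / m" if "i \<in> {1..<m}" for i
  proof -
    have "0 < i / m" "i / m < 1" using that by (auto simp: field_simps)
    from order_tendstoD(2)[OF \<nu>.cdf_lim_at_bot this(1)] obtain a where a: "cdf \<nu> a < i / m"
      by (auto simp: eventually_at_bot_linorder)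
    from order_tendstoD(1)[OF \<nu>.cdf_lim_at_top_prob \<open>i / m < 1\<close>] obtain c where c: "cdf \<nu> c > i / m"
      by (auto simp: eventually_at_top_linorder)
    have "a \<le> c" using a c \<nu>.cdf_nondecreasing[of c a] by linarith
    with a c cont show ?thesis using IVT[of "cdf \<nu>" a "i / m" c] by fastforce
  qed
  then obtain q where q: "\<And>i. i \<in> {1..<m} \<Longrightarrow> cdf \<nu> (q i) = i / m" by metis
  have "\<forall>\<^sub>F n in sequentially. \<forall>i\<in>{1..<m}. dist (cdf (\<mu> n) (q i)) (cdf \<nu> (q i)) < 1 / m"
  proof (intro eventually_ball_finite ballI)
    fix i
    have "(\<lambda>n. cdf (\<mu> n) (q i)) \<longlonglongrightarrow> cdf \<nu> (q i)"
      using conv cont by (simp add: weak_conv_m_def weak_conv_def)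
    then show "\<forall>\<^sub>F n in sequentially. dist (cdf (\<mu> n) (q i)) (cdf \<nu> (q i)) < 1 / m"
      using m(1) by (intro tendstoD) auto
  qed simp
  then show "\<forall>\<^sub>F n in sequentially. \<forall>x\<in>UNIV. dist (cdf (\<mu> n) x) (cdf \<nu> x) < e"
  proof (eventually_elim, intro ballI)
    fix n x assume H: "\<forall>i\<in>{1..<m}. dist (cdf (\<mu> n) (q i)) (cdf \<nu> (q i)) < 1 / m"
    have Hq: "\<bar>cdf (\<mu> n) (q j) - j / m\<bar> < 1 / m" if "j \<in> {1..<m}" for j
      using H that q by (auto simp: dist_real_def)
    define i where "i = nat \<lfloor>m * cdf \<nu> x\<rfloor>"
    have nn: "0 \<le> m * cdf \<nu> x" using \<nu>.cdf_nonneg[of x] by simp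
    have i: "i \<le> m * cdf \<nu> x" "m * cdf \<nu> x < i + 1" 
      using nn unfolding i_def by linarith+
    then have i': "i / m \<le> cdf \<nu> x" "cdf \<nu> x < (i + 1) / m" using m(1) by (auto simp: field_simps)
    have "real i \<le> m" using i(1) \<nu>.cdf_bounded_prob[of x] m(1)
      by (smt (verit) mult_left_le of_nat_0_le_iff)
    then have im: "i \<le> m" by simp
    have up: "cdf (\<mu> n) x \<le> cdf \<nu> x + 2 / m"
    proof (cases "i + 1 < m")
      case True
      have "cdf \<nu> x < cdf \<nu> (q (i + 1))" using q[of "i + 1"] True i' by simp
      then have "x \<le> q (i + 1)" using \<nu>.cdf_nondecreasing[of "q (i + 1)" x] by linarith
      from \<mu>.cdf_nondecreasing[OF this, of n] Hq[of "i + 1"] True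
      have "cdf (\<mu> n) x \<le> (i + 1) / m + 1 / m" by auto
      then show ?thesis using i'(1) by (simp add: add_divide_distrib)
    next
      case False
      then have "1 \<le> (i + 1) / m" using m(1) by simp
      moreover have "(i + 1) / m = i / m + 1 / m" by (simp add: add_divide_distrib)
      moreover have "1 / m \<le> 2 / m" by (simp add: divide_right_mono)
      ultimately show ?thesis using i'(1) \<mu>.cdf_bounded_prob[of n x] by linarith
    qed
    have lo: "cdf \<nu> x < cdf (\<mu> n) x + 3 / m"
    proof (cases "i \<ge> 2")
      case True
      \<comment> \<open>Only a strict inequality between values of a cdf orders the points, and
        \<open>i / m \<le> cdf \<nu> x\<close> may be an equality. Going one quantile lower makes it
        strict and also covers \<open>i = m\<close>.\<close>
      then have mem: "i - 1 \<in> {1..<m}" using im by auto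
      have "cdf \<nu> (q (i - 1)) < i / m" using q[OF mem] m(1) True by (simp add: divide_strict_right_mono)
      then have "q (i - 1) \<le> x" using \<nu>.cdf_nondecreasing[of x "q (i - 1)"] i' by linarith
      from \<mu>.cdf_nondecreasing[OF this, of n] Hq[OF mem]
      have "cdf (\<mu> n) x > real (i - 1) / m - 1 / m" by linarith
      moreover have "real (i - 1) / m - 1 / m = (i + 1) / m - 3 / m" using True
        by (simp add: diff_divide_distrib add_divide_distrib of_nat_diff)
      ultimately show ?thesis using i'(2) by linarith
    next
      case False
      then have "(i + 1) / m \<le> 2 / m" using m(1) by (simp add: divide_right_mono)
      moreover have "2 / m < 3 / m" using m(1) by (simp add: field_simps)
      ultimately show ?thesis using i'(2) \<mu>.cdf_nonneg[of n x] by linarith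
    qed
    have "2 / m < 3 / m" using m(1) by (simp add: field_simps)
    with up lo m(2) show "dist (cdf (\<mu> n) x) (cdf \<nu> x) < e"
      by (auto simp: dist_real_def)
  qed
qed

lemma isCont_cdf_std_normal: "isCont (cdf std_normal_distribution) x"
proof -
  interpret real_distribution std_normal_distribution by (rule real_dist_normal_dist)
  have "emeasure std_normal_distribution {x} = 0"
    by (subst emeasure_density) (auto simp: nn_integral_null_set intro!: nn_integral_null_set)
  then show ?thesis by (simp add: isCont_cdf measure_def)
qed

lemma exp_minus_second_order:
  fixes y :: real assumes "0 \<le> y" shows "\<bar>1 - y - exp (- y)\<bar> \<le> y\<^sup>2"
proof -
  have 1: "1 - y \<le> exp (- y)" using exp_ge_add_one_self[of "-y"] by simp
  have "exp (- y) \<le> 1 - y + y\<^sup>2"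
  proof (cases "y \<le> 1")
    case True
    \<comment> \<open>The product equals \<open>1 + y ^ 3\<close>.\<close>
    have "1 \<le> (1 + y) * (1 - y + y\<^sup>2)"
      using assms by (simp add: algebra_simps power2_eq_square)
    also have "\<dots> \<le> exp y * (1 - y + y\<^sup>2)"
      using exp_ge_add_one_self[of y] True by (intro mult_right_mono) auto
    finally show ?thesis by (simp add: exp_minus field_simps)
  next
    case False
    then have "y \<le> y\<^sup>2" using mult_left_mono[of 1 y y] by (simp add: power2_eq_square)
    moreover have "exp (-y) \<le> 1" using assms by simp
    ultimately show ?thesis by linarith
  qed
  with 1 show ?thesis by linarith
qed

text \<open>Lindeberg's theorem for rows of identically distributed variables, with one law
  \<open>\<mu> m\<close> per row. Both \<open>char\<close> and \<open>exp (- y)\<close> lie in the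
  unit disc, so their \<open>k\<close>-th powers differ by at most \<open>k\<close> times the
  difference of the bases; the second-order expansion of \<open>char\<close> has an error governed
  by the integrand of \<open>lind\<close>.\<close>

lemma iid_array_char_limit:
  fixes \<mu> :: "nat \<Rightarrow> real measure" and k :: "nat \<Rightarrow> nat"
  assumes "\<And>m. real_distribution (\<mu> m)"
    and int2: "\<And>m. integrable (\<mu> m) (\<lambda>x. x\<^sup>2)"
    and mean: "\<And>m. (\<integral>x. x \<partial>\<mu> m) = 0"
    and k: "filterlim k at_top sequentially"
    and var: "(\<lambda>m. k m * (\<integral>x. x\<^sup>2 \<partial>\<mu> m)) \<longlonglongrightarrow> 1"
    and lind: "(\<lambda>m. k m * (\<integral>x. min (6 * x\<^sup>2) (\<bar>t\<bar> * \<bar>x\<bar> ^ 3) \<partial>\<mu> m)) \<longlonglongrightarrow> 0"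
  shows "(\<lambda>m. char (\<mu> m) t ^ k m) \<longlonglongrightarrow> char std_normal_distribution t"
proof -
  interpret \<mu>: real_distribution "\<mu> m" for m by fact
  define V where "V m = (\<integral>x. x\<^sup>2 \<partial>\<mu> m)" for m
  define y where "y m = t\<^sup>2 * V m / 2" for m
  have V0: "V m \<ge> 0" for m unfolding V_def by (intro integral_nonneg_AE) simp
  then have y0: "y m \<ge> 0" for m by (simp add: y_def)
  have int1: "integrable (\<mu> m) (\<lambda>x. x)" for m
    by (rule \<mu>.square_integrable_imp_integrable[OF _ int2]) simp
  have main: "cmod (char (\<mu> m) t ^ k m - complex_of_real (exp (- (k m * y m))))
     \<le> t\<^sup>2 / 6 * (k m * (\<integral>x. min (6 * x\<^sup>2) (\<bar>t\<bar> * \<bar>x\<bar> ^ 3) \<partial>\<mu> m)) + (k m * y m)\<^sup>2 * inverse (k m)" for m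
  proof -
    have "cmod (char (\<mu> m) t ^ k m - complex_of_real (exp (- y m)) ^ k m)
       \<le> k m * cmod (char (\<mu> m) t - complex_of_real (exp (- y m)))"
      by (intro norm_power_diff) (use y0[of m] in \<open>auto intro: \<mu>.cmod_char_le_1\<close>)
    also have "cmod (char (\<mu> m) t - complex_of_real (exp (- y m))) \<le>
       cmod (char (\<mu> m) t - (1 - t\<^sup>2 * V m / 2)) + cmod ((1 - t\<^sup>2 * V m / 2) - complex_of_real (exp (- y m)))"
      by (rule order_trans[OF _ norm_triangle_ineq]) simp
    also have "cmod (char (\<mu> m) t - (1 - t\<^sup>2 * V m / 2))
       \<le> t\<^sup>2 / 6 * (\<integral>x. min (6 * x\<^sup>2) (\<bar>t\<bar> * \<bar>x\<bar> ^ 3) \<partial>\<mu> m)"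
      using \<mu>.char_approx3[OF int1 mean int2, of m "V m" t] by (simp add: V_def mean)
    also have "cmod ((1 - t\<^sup>2 * V m / 2) - complex_of_real (exp (- y m))) = \<bar>1 - y m - exp (- y m)\<bar>"
      unfolding y_def by (metis (no_types, lifting) norm_of_real of_real_1 of_real_diff of_real_divide
          of_real_mult of_real_numeral of_real_power)
    also have "\<dots> \<le> (y m)\<^sup>2" by (rule exp_minus_second_order[OF y0])
    finally have "cmod (char (\<mu> m) t ^ k m - complex_of_real (exp (- y m)) ^ k m)
       \<le> k m * (t\<^sup>2 / 6 * (\<integral>x. min (6 * x\<^sup>2) (\<bar>t\<bar> * \<bar>x\<bar> ^ 3) \<partial>\<mu> m) + (y m)\<^sup>2)"
      by (simp add: mult_left_mono)
    \<comment> \<open>The form \<open>(k * y)^2 / k\<close> is chosen because \<open>k * y\<close>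
      has a finite limit while \<open>1 / k\<close> tends to \<open>0\<close>.\<close>
    also have "\<dots> = t\<^sup>2 / 6 * (k m * (\<integral>x. min (6 * x\<^sup>2) (\<bar>t\<bar> * \<bar>x\<bar> ^ 3) \<partial>\<mu> m)) + (k m * y m)\<^sup>2 * inverse (k m)"
      by (cases "k m = 0") (auto simp: field_simps power2_eq_square)
    also have "complex_of_real (exp (- y m)) ^ k m = complex_of_real (exp (- (k m * y m)))"
      by (simp flip: of_real_power exp_of_nat_mult)
    finally show ?thesis .
  qed
  have ky: "(\<lambda>m. k m * y m) \<longlonglongrightarrow> t\<^sup>2 / 2"
    using tendsto_mult_left[OF var, of "t\<^sup>2 / 2"] by (simp add: y_def V_def mult_ac)
  have ik: "(\<lambda>m. inverse (real (k m))) \<longlonglongrightarrow> 0"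
    using filterlim_compose[OF filterlim_real_sequentially k] by (rule tendsto_inverse_0_at_top)
  have "(\<lambda>m. t\<^sup>2 / 6 * (k m * (\<integral>x. min (6 * x\<^sup>2) (\<bar>t\<bar> * \<bar>x\<bar> ^ 3) \<partial>\<mu> m)) + (k m * y m)\<^sup>2 * inverse (k m))
      \<longlonglongrightarrow> t\<^sup>2 / 6 * 0 + (t\<^sup>2 / 2)\<^sup>2 * 0"
    by (intro tendsto_intros lind ky ik)
  then have "(\<lambda>m. char (\<mu> m) t ^ k m - complex_of_real (exp (- (k m * y m)))) \<longlonglongrightarrow> 0"
    by (intro Lim_null_comparison[OF always_eventually[OF allI[OF main]]]) simp
  moreover have "(\<lambda>m. complex_of_real (exp (- (k m * y m)))) \<longlonglongrightarrow> complex_of_real (exp (- (t\<^sup>2 / 2)))"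
    by (intro tendsto_intros ky)
  ultimately have "(\<lambda>m. char (\<mu> m) t ^ k m - complex_of_real (exp (- (k m * y m))) + complex_of_real
      (exp (- (k m * y m)))) \<longlonglongrightarrow> 0 + complex_of_real (exp (- (t\<^sup>2 / 2)))"
    by (rule tendsto_add)
  then show ?thesis by (simp add: char_std_normal_distribution)
qed

section \<open>The bootstrap distribution along a fixed path\<close>

text \<open>Smallness of the mean of \<open>tail_weight c\<close> is Lindeberg's condition in a form that, unlike truncation,
  survives centring (\<open>tail_weight_add\<close>). For \<open>c = 0\<close> it vanishes, as \<open>x / 0 = 0\<close>.\<close>

definition tail_weight :: "real \<Rightarrow> real \<Rightarrow> real" where
  "tail_weight c u = u\<^sup>2 * min 1 (\<bar>u\<bar> / c)"

definition block_sum :: "nat \<Rightarrow> (int \<Rightarrow> real) \<Rightarrow> nat \<Rightarrow> real" where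
  "block_sum b x j = (\<Sum>r = 1..b. x (int (j + r))) / sqrt (real b)"

text \<open>Expectation of \<open>h\<close> at one random block position, see
  \<open>integral_pos_law\<close>. Subtraction is truncated, so the denominator is positive even for
  \<open>b > n\<close>.\<close>

definition block_avg :: "nat \<Rightarrow> nat \<Rightarrow> (nat \<Rightarrow> real) \<Rightarrow> real" where
  "block_avg n b h = (\<Sum>j = 1..n - b + 1. h j) / real (n - b + 1)"

text \<open>The summands control the variance, the centring and Lindeberg's condition for the law of
  one block. The threshold \<open>sqrt (num_blocks n b)\<close> is the size of the fluctuations of a
  sum of that many normalized block sums.\<close>

definition boot_defect :: "real \<Rightarrow> nat \<Rightarrow> nat \<Rightarrow> (int \<Rightarrow> real) \<Rightarrow> real" where
  "boot_defect s n b x =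
     \<bar>block_avg n b (\<lambda>j. (block_sum b x j)\<^sup>2) - s\<^sup>2\<bar> + (block_avg n b (block_sum b x))\<^sup>2 +
     block_avg n b (\<lambda>j. tail_weight (sqrt (num_blocks n b)) (block_sum b x j))"

lemma tail_weight_nonneg: "c \<ge> 0 \<Longrightarrow> 0 \<le> tail_weight c u"
  by (simp add: tail_weight_def)

lemma tail_weight_le_square: "tail_weight c u \<le> u\<^sup>2"
  by (simp add: tail_weight_def mult_left_le)

lemma tail_weight_mono:
  assumes "c \<ge> 0" "\<bar>u\<bar> \<le> \<bar>v\<bar>" shows "tail_weight c u \<le> tail_weight c v"
  unfolding tail_weight_def
proof (intro mult_mono min.mono)
  show "u\<^sup>2 \<le> v\<^sup>2" using assms(2) by (simp add: abs_le_square_iff)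
qed (use assms in \<open>auto intro: divide_right_mono\<close>)

text \<open>A factor \<open>4\<close> comes from the square and a factor \<open>2\<close> from the
  truncated linear term.\<close>

lemma tail_weight_double:
  assumes "c \<ge> 0" shows "tail_weight c (2 * u) \<le> 8 * tail_weight c u"
proof -
  have "min 1 (\<bar>2 * u\<bar> / c) \<le> 2 * min 1 (\<bar>u\<bar> / c)"
    using assms by (auto simp: min_def abs_mult)
  from mult_left_mono[OF this, of "4 * u\<^sup>2"] show ?thesis
    by (simp add: tail_weight_def power_mult_distrib)
qed

text \<open>\<open>\<bar>u + v\<bar>\<close> is at most twice the larger of
  \<open>\<bar>u\<bar>\<close> and \<open>\<bar>v\<bar>\<close>, so monotonicity and doubling are
  applied to that one alone.\<close>

lemma tail_weight_add:
  assumes "c \<ge> 0" shows "tail_weight c (u + v) \<le> 8 * (tail_weight c u + tail_weight c v)"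
proof -
  have *: "tail_weight c (u + v) \<le> 8 * (tail_weight c u + tail_weight c v)" if "\<bar>v\<bar> \<le> \<bar>u\<bar>" for u v
  proof -
    have "tail_weight c (u + v) \<le> tail_weight c (2 * u)"
      using that assms by (intro tail_weight_mono) auto
    also have "\<dots> \<le> 8 * tail_weight c u" by (rule tail_weight_double[OF assms])
    finally show ?thesis using tail_weight_nonneg[OF assms, of v] by simp
  qed
  show ?thesis using *[of v u] *[of u v] by (cases "\<bar>v\<bar> \<le> \<bar>u\<bar>") (auto simp: add.commute)
qed

lemma block_avg_mono:
  "(\<And>j. h j \<le> h' j) \<Longrightarrow> block_avg n b h \<le> block_avg n b h'"
  unfolding block_avg_def by (intro divide_right_mono sum_mono) auto

lemma block_avg_nonneg: "(\<And>j. 0 \<le> h j) \<Longrightarrow> 0 \<le> block_avg n b h"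
  unfolding block_avg_def by (intro divide_nonneg_nonneg sum_nonneg) auto

lemma block_avg_add: "block_avg n b (\<lambda>j. h j + h' j) = block_avg n b h + block_avg n b h'"
  by (simp add: block_avg_def sum.distrib add_divide_distrib)

lemma block_avg_diff: "block_avg n b (\<lambda>j. h j - h' j) = block_avg n b h - block_avg n b h'"
  by (simp add: block_avg_def sum_subtractf diff_divide_distrib)

lemma block_avg_cmult: "block_avg n b (\<lambda>j. c * h j) = c * block_avg n b h"
  unfolding block_avg_def sum_distrib_left[symmetric] by (rule times_divide_eq_right[symmetric])

lemma block_avg_const [simp]: "block_avg n b (\<lambda>j. c) = c"
proof -
  have "real (n - b + 1) > 0" by simp
  then show ?thesis unfolding block_avg_def by (simp del: of_nat_add of_nat_Suc)
qed

lemma boot_defect_nonneg: "0 \<le> boot_defect s n b x"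
  unfolding boot_defect_def
  by (intro add_nonneg_nonneg block_avg_nonneg tail_weight_nonneg) auto

section \<open>The law of one block position and the bootstrap mean as a sum of independent
  terms\<close>

abbreviation pos_law :: "nat \<Rightarrow> nat \<Rightarrow> nat pmf" where
  "pos_law n b \<equiv> pmf_of_set {1..n - b + 1}"

lemma integral_pos_law: "(\<integral>j. h j \<partial>measure_pmf (pos_law n b)) = block_avg n b h"
  by (subst integral_pmf_of_set) (auto simp: block_avg_def)

lemma finite_set_block_law [simp]: "finite (set_pmf (block_law n b))"
  unfolding block_law_def by (subst set_Pi_pmf) (auto intro!: finite_PiE_dflt)

lemma expectation_block_law_component:
  assumes "d \<in> {1..num_blocks n b}"
  shows "(\<integral>I. h (I d) \<partial>measure_pmf (block_law n b)) = block_avg n b h"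
proof -
  have "map_pmf (\<lambda>I. I d) (block_law n b) = pos_law n b"
    using assms unfolding block_law_def by (subst Pi_pmf_component) auto
  then show ?thesis by (metis integral_map_pmf integral_pos_law)
qed

text \<open>Coordinates under \<open>Pi_pmf\<close> are independent with common law
  \<open>pos_law\<close>. This puts the bootstrap mean into the shape that
  \<open>iid_array_char_limit\<close> treats.\<close>

lemma char_sum_block_law:
  fixes w :: "nat \<Rightarrow> real"
  shows "char (distr (measure_pmf (block_law n b)) borel (\<lambda>I. \<Sum>d = 1..num_blocks n b. w (I d))) t =
    char (distr (measure_pmf (pos_law n b)) borel w) t ^ num_blocks n b"
proof -
  have ind: "prob_space.indep_vars (measure_pmf (block_law n b)) (\<lambda>_. borel) (\<lambda>d I. w (I d))
      {1..num_blocks n b}"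
    unfolding block_law_def
    by (rule prob_space.indep_vars_compose2[OF measure_pmf.prob_space_axioms indep_vars_Pi_pmf]) auto
  have "char (distr (measure_pmf (block_law n b)) borel (\<lambda>I. w (I d))) t = char (distr (measure_pmf
      (pos_law n b)) borel w) t"
    if "d \<in> {1..num_blocks n b}" for d
  proof -
    have "map_pmf (\<lambda>I. I d) (block_law n b) = pos_law n b"
      using that unfolding block_law_def by (subst Pi_pmf_component) auto
    then have "distr (measure_pmf (pos_law n b)) borel w
        = distr (distr (measure_pmf (block_law n b)) (count_space UNIV) (\<lambda>I. I d)) borel w"
      by (metis map_pmf_rep_eq)
    also have "\<dots> = distr (measure_pmf (block_law n b)) borel (\<lambda>I. w (I d))"
      by (subst distr_distr) (auto simp: comp_def)
    finally show ?thesis by simp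
  qed
  then show ?thesis
    by (subst prob_space.char_distr_sum[OF measure_pmf.prob_space_axioms ind]) simp
qed

text \<open>The scale \<open>sqrt n / (k * sqrt b)\<close> is \<open>1 / sqrt k\<close> when
  \<open>k * b = n\<close>. In general \<open>b\<close> need not divide \<open>n\<close>, and
  \<open>num_blocks_asymp\<close> shows that the ratio of the two scales tends to
  \<open>1\<close>.\<close>

lemma boot_root_eq_sum:
  assumes "b > 0" and k: "num_blocks n b > 0"
  shows "sqrt n * (boot_mean n b x I - measure_pmf.expectation (block_law n b) (boot_mean n b x)) =
    (\<Sum>d = 1..num_blocks n b. sqrt n / (num_blocks n b * sqrt b) *
        (block_sum b x (I d) - block_avg n b (block_sum b x)))"
proof -
  let ?k = "num_blocks n b" let ?U = "block_avg n b (block_sum b x)"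
  have m: "boot_mean n b x I = (\<Sum>d = 1..?k. block_sum b x (I d)) / (?k * sqrt b)" for I
    unfolding boot_mean_eq_mean_of_block_means block_sum_def sum_distrib_left sum_divide_distrib
    using assms by (intro sum.cong) (auto simp: field_simps)
  have "measure_pmf.expectation (block_law n b) (boot_mean n b x)
     = (\<Sum>d = 1..?k. measure_pmf.expectation (block_law n b) (\<lambda>I. block_sum b x (I d))) / (?k * sqrt b)"
    unfolding m by (subst integral_divide_zero, subst Bochner_Integration.integral_sum)
       (auto intro: integrable_measure_pmf_finite)
  also have "\<dots> = (\<Sum>d = 1..?k. ?U) / (?k * sqrt b)"
    by (intro arg_cong2[where f = "(/)"] sum.cong expectation_block_law_component) auto
  finally show ?thesis unfolding m
    by (simp add: sum_subtractf right_diff_distrib diff_divide_distrib sum_distrib_left sum_divide_distrib)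
qed

lemma boot_root_cdf_eq_cdf:
  fixes s :: real
  assumes "b > 0" "num_blocks n b > 0" "s > 0"
  shows "boot_root_cdf n b x y =
    cdf (distr (measure_pmf (block_law n b)) borel (\<lambda>I. \<Sum>d = 1..num_blocks n b.
      sqrt n / (num_blocks n b * sqrt b) / s * (block_sum b x (I d) - block_avg n b (block_sum b x)))) (y / s)"
proof -
  let ?c = "sqrt n / (num_blocks n b * sqrt b)"
  define g where "g I = (\<Sum>d = 1..num_blocks n b. ?c / s * (block_sum b x (I d) - block_avg n b
      (block_sum b x)))" for I
  have "(\<Sum>d = 1..num_blocks n b. ?c * (block_sum b x (I d) - block_avg n b (block_sum b x))) = s * g I" for I
    unfolding g_def sum_distrib_left using \<open>s > 0\<close> by (intro sum.cong) auto
  moreover have "s * g I \<le> y \<longleftrightarrow> g I \<le> y / s" for I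
    using \<open>s > 0\<close> by (simp add: field_simps)
  moreover have "cdf (distr (measure_pmf (block_law n b)) borel g) (y / s) = measure_pmf.prob (block_law
      n b) {I. g I \<le> y / s}"
    unfolding cdf_def2 by (subst measure_distr) (auto simp: vimage_def)
  ultimately show ?thesis
    unfolding boot_root_cdf_def boot_root_eq_sum[OF assms(1,2)] g_def[abs_def] by simp
qed

text \<open>Both limits rest on \<open>n - b < k * b \<le> n\<close> for
  \<open>k = num_blocks n b\<close>.\<close>

lemma num_blocks_asymp:
  fixes b n :: "nat \<Rightarrow> nat"
  assumes "\<And>m. b m > 0" and "filterlim n at_top sequentially"
    and small: "(\<lambda>m. b m / n m) \<longlonglongrightarrow> 0"
  shows "filterlim (\<lambda>m. num_blocks (n m) (b m)) at_top sequentially"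
    and "(\<lambda>m. n m / (real (num_blocks (n m) (b m)) * b m)) \<longlonglongrightarrow> 1"
proof -
  have n0: "\<forall>\<^sub>F m in sequentially. n m > 0" by (rule eventually_compose_filterlim[OF
      eventually_gt_at_top assms(2)])
  have inv: "filterlim (\<lambda>m. inverse (b m / n m)) at_top sequentially"
    using small n0 assms(1) by (intro filterlim_inverse_at_top) (auto elim: eventually_mono)
  have k1: "real (num_blocks (n m) (b m)) > inverse (b m / n m) - 1" for m
  proof -
    have "n m < (num_blocks (n m) (b m) + 1) * b m"
      unfolding num_blocks_def using dividend_less_div_times[OF assms(1)[of m], of "n m"] by (simp add:
          algebra_simps)
    then have "real (n m) < real ((num_blocks (n m) (b m) + 1) * b m)" by (rule of_nat_less_iff[THEN iffD2])
    then show ?thesis using assms(1)[of m] by (simp add: field_simps)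
  qed
  have "filterlim (\<lambda>m. -1 + inverse (b m / n m)) at_top sequentially"
    by (rule filterlim_tendsto_add_at_top[OF tendsto_const inv])
  then have "filterlim (\<lambda>m. real (num_blocks (n m) (b m))) at_top sequentially"
    by (rule filterlim_at_top_mono) (use k1 in \<open>auto intro!: always_eventually less_imp_le\<close>)
  then show k: "filterlim (\<lambda>m. num_blocks (n m) (b m)) at_top sequentially"
    by (simp add: filterlim_sequentially_iff_filterlim_real)
  have k0: "\<forall>\<^sub>F m in sequentially. num_blocks (n m) (b m) > 0" by (rule eventually_compose_filterlim[OF
      eventually_gt_at_top k])
  have "(\<lambda>m. real (num_blocks (n m) (b m)) * b m / n m) \<longlonglongrightarrow> 1"
  proof (rule tendsto_sandwich)
    show "\<forall>\<^sub>F m in sequentially. 1 - b m / n m \<le> real (num_blocks (n m) (b m)) * b m / n m"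
      using n0
    proof eventually_elim
      case (elim m)
      have "real (n m) - b m \<le> real (num_blocks (n m) (b m)) * b m"
        using k1[of m] assms(1)[of m] by (simp add: field_simps)
      then have "(real (n m) - b m) / n m \<le> real (num_blocks (n m) (b m)) * b m / n m"
        by (rule divide_right_mono) simp
      then show ?case using elim by (simp add: diff_divide_distrib)
    qed
    show "\<forall>\<^sub>F m in sequentially. real (num_blocks (n m) (b m)) * b m / n m \<le> 1"
      using n0
    proof eventually_elim
      case (elim m)
      have "num_blocks (n m) (b m) * b m \<le> n m" by (simp add: num_blocks_def)
      then have "real (num_blocks (n m) (b m) * b m) \<le> n m" by (rule of_nat_mono)
      with elim show ?case by simp
    qed
    show "(\<lambda>m. 1 - b m / n m) \<longlonglongrightarrow> 1" using tendsto_diff[OF tendsto_const small, of 1] by simp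
  qed simp
  from tendsto_inverse[OF this] show "(\<lambda>m. n m / (real (num_blocks (n m) (b m)) * b m)) \<longlonglongrightarrow> 1"
    by simp
qed

text \<open>Path and sample size both vary freely with \<open>m\<close>, as the contradiction in
  \<open>boot_root_cdf_uniform\<close> requires. The standardized root has the law of a sum of
  \<open>k m\<close> independent variables with law \<open>\<mu> m\<close>; the three parts of the
  defect supply the conditions of \<open>iid_array_char_limit\<close>, and continuity of the normal
  cdf upgrades weak convergence to uniform convergence.\<close>

theorem boot_root_cdf_uniform_limit:
  fixes x :: "nat \<Rightarrow> int \<Rightarrow> real" and b n :: "nat \<Rightarrow> nat"
  assumes b0: "\<And>m. b m > 0" and n: "filterlim n at_top sequentially"
    and small: "(\<lambda>m. b m / n m) \<longlonglongrightarrow> 0" and s: "s > 0"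
    and defect: "(\<lambda>m. boot_defect s (n m) (b m) (x m)) \<longlonglongrightarrow> 0"
  shows "uniform_limit UNIV (\<lambda>m y. boot_root_cdf (n m) (b m) (x m) y)
    (\<lambda>y. cdf std_normal_distribution (y / s)) sequentially"
proof -
  define k where "k m = num_blocks (n m) (b m)" for m
  define A where "A m h = block_avg (n m) (b m) h" for m h
  define U where "U m = block_sum (b m) (x m)" for m
  define v where "v m j = U m j - A m (U m)" for m j
  define a where "a m = sqrt (n m) / (k m * sqrt (b m)) / s" for m
  define \<mu> where "\<mu> m = distr (measure_pmf (pos_law (n m) (b m))) borel (\<lambda>j. a m * v m j)" for m
  define \<nu> where "\<nu> m = distr (measure_pmf (block_law (n m) (b m))) borel (\<lambda>I. \<Sum>d = 1..k m. a m * v m (I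
      d))" for m
  have kinf: "filterlim k at_top sequentially" and knb: "(\<lambda>m. n m / (real (k m) * b m)) \<longlonglongrightarrow> 1"
    using num_blocks_asymp[OF b0 n small] by (simp_all add: k_def[abs_def])
  have k0: "\<forall>\<^sub>F m in sequentially. k m > 0" by (rule eventually_compose_filterlim[OF eventually_gt_at_top kinf])
  have \<mu>: "real_distribution (\<mu> m)" and \<nu>: "real_distribution (\<nu> m)" for m
    unfolding \<mu>_def \<nu>_def by (auto intro!: prob_space.real_distribution_distr measure_pmf.prob_space_axioms)
  have int: "(\<integral>y. h y \<partial>\<mu> m) = A m (\<lambda>j. h (a m * v m j))" if "h \<in> borel_measurable borel" for h :: "real
      \<Rightarrow> real" and m
    unfolding \<mu>_def A_def integral_pos_law[symmetric] using that by (intro integral_distr) auto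
  have ka: "k m * (a m)\<^sup>2 = n m / (real (k m) * b m) / s\<^sup>2" for m
    by (simp add: a_def power_divide power_mult_distrib power2_eq_square)
  have a0: "a m \<ge> 0" for m using s by (simp add: a_def)
  have pos: "0 \<le> A m (\<lambda>j. tail_weight (sqrt (k m)) (U m j))" for m
    unfolding A_def by (intro block_avg_nonneg tail_weight_nonneg) simp
  have defect_eq: "boot_defect s (n m) (b m) (x m) =
     \<bar>A m (\<lambda>j. (U m j)\<^sup>2) - s\<^sup>2\<bar> + (A m (U m))\<^sup>2 + A m (\<lambda>j. tail_weight (sqrt (k m)) (U m j))" for m
    by (simp add: boot_defect_def A_def U_def k_def)
  have le: "\<bar>A m (\<lambda>j. (U m j)\<^sup>2) - s\<^sup>2\<bar> \<le> boot_defect s (n m) (b m) (x m)"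
    "(A m (U m))\<^sup>2 \<le> boot_defect s (n m) (b m) (x m)"
    "A m (\<lambda>j. tail_weight (sqrt (k m)) (U m j)) \<le> boot_defect s (n m) (b m) (x m)" for m
    using defect_eq[of m] pos[of m] zero_le_power2[of "A m (U m)"] by linarith+
  have lim1: "(\<lambda>m. A m (\<lambda>j. (U m j)\<^sup>2) - s\<^sup>2) \<longlonglongrightarrow> 0"
    by (rule Lim_null_comparison[OF _ defect]) (use le in simp)
  have lim2: "(\<lambda>m. (A m (U m))\<^sup>2) \<longlonglongrightarrow> 0"
    by (rule Lim_null_comparison[OF _ defect]) (use le in simp)
  have lim3: "(\<lambda>m. A m (\<lambda>j. tail_weight (sqrt (k m)) (U m j))) \<longlonglongrightarrow> 0"
    by (rule Lim_null_comparison[OF _ defect])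
      (use le(3) pos in simp)
  have Av: "A m (v m) = 0" for m unfolding v_def A_def block_avg_diff by simp
  \<comment> \<open>Centring costs exactly the second part of the defect.\<close>
  have Av2: "A m (\<lambda>j. (v m j)\<^sup>2) = A m (\<lambda>j. (U m j)\<^sup>2) - (A m (U m))\<^sup>2" for m
  proof -
    have "(v m j)\<^sup>2 = (U m j)\<^sup>2 - 2 * A m (U m) * U m j + (A m (U m))\<^sup>2" for j
      by (simp add: v_def power2_eq_square algebra_simps)
    then have "A m (\<lambda>j. (v m j)\<^sup>2) = A m (\<lambda>j. (U m j)\<^sup>2) - 2 * A m (U m) * A m (U m) + (A m (U m))\<^sup>2"
      by (simp add: A_def block_avg_add block_avg_diff block_avg_cmult)
    then show ?thesis by (simp add: power2_eq_square)
  qed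
  have Av2_lim: "(\<lambda>m. A m (\<lambda>j. (v m j)\<^sup>2)) \<longlonglongrightarrow> s\<^sup>2"
    using tendsto_diff[OF tendsto_add[OF lim1 tendsto_const[of "s\<^sup>2"]] lim2] by (simp add: Av2)
  have var_lim: "(\<lambda>m. k m * (\<integral>y. y\<^sup>2 \<partial>\<mu> m)) \<longlonglongrightarrow> 1"
  proof -
    have eq: "k m * (\<integral>y. y\<^sup>2 \<partial>\<mu> m) = n m / (real (k m) * b m) / s\<^sup>2 * A m (\<lambda>j. (v m j)\<^sup>2)" for m
      unfolding ka[symmetric] by (subst int) (auto simp: power_mult_distrib A_def block_avg_cmult)
    have "(\<lambda>m. n m / (real (k m) * b m) / s\<^sup>2 * A m (\<lambda>j. (v m j)\<^sup>2)) \<longlonglongrightarrow> 1 / s\<^sup>2 * s\<^sup>2"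
      using s by (intro tendsto_intros knb Av2_lim) simp
    then show ?thesis unfolding eq using s by simp
  qed
  have lind: "(\<lambda>m. k m * (\<integral>y. min (6 * y\<^sup>2) (\<bar>t\<bar> * \<bar>y\<bar> ^ 3) \<partial>\<mu> m)) \<longlonglongrightarrow> 0" for t
  proof -
    \<comment> \<open>The entries serve the two branches of \<open>tail_weight\<close>. Where
      \<open>\<bar>w\<bar> \<ge> sqrt k\<close> the quadratic term with coefficient \<open>6\<close>
      is used; elsewhere the cubic term, with one factor \<open>a\<close> bounded by
      \<open>2 / (s * sqrt k)\<close>.\<close>
    define C where "C = max 6 (2 * \<bar>t\<bar> / s)"
    have C: "C \<ge> 6" "C \<ge> 2 * \<bar>t\<bar> / s" by (auto simp: C_def)
    \<comment> \<open>The limit is \<open>1\<close>; the cruder bound \<open>4\<close> is a perfect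
      square and gives the \<open>2\<close> in \<open>C\<close>.\<close>
    have ev: "\<forall>\<^sub>F m in sequentially. n m / (real (k m) * b m) < 4"
      using order_tendstoD(2)[OF knb, of 4] by simp
    have bd: "\<forall>\<^sub>F m in sequentially. norm (k m * (\<integral>y. min (6 * y\<^sup>2) (\<bar>t\<bar> * \<bar>y\<bar> ^ 3) \<partial>\<mu> m)) \<le> 
       k m * (a m)\<^sup>2 * C * (8 * A m (\<lambda>j. tail_weight (sqrt (k m)) (U m j)) + 8 * (A m (U m))\<^sup>2)"
      using ev k0
    proof eventually_elim
      case (elim m)
      have "(a m)\<^sup>2 * k m \<le> 4 / s\<^sup>2" 
      proof -
        have "k m * (a m)\<^sup>2 \<le> 4 / s\<^sup>2" unfolding ka using elim(1) by (intro divide_right_mono) simp_all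
        then show ?thesis by (simp only: mult.commute)
      qed
      then have "(a m * sqrt (k m))\<^sup>2 \<le> (2 / s)\<^sup>2" by (simp add: power_mult_distrib power_divide)
      then have "a m * sqrt (k m) \<le> 2 / s" by (rule power2_le_imp_le) (use s in simp)
      then have ak: "a m \<le> 2 / s / sqrt (k m)" using elim(2) by (subst pos_le_divide_eq) simp_all
      have pt: "min (6 * (a m * w)\<^sup>2) (\<bar>t\<bar> * \<bar>a m * w\<bar> ^ 3) \<le> (a m)\<^sup>2 * C * tail_weight (sqrt (k m)) w" for w
      proof (cases "\<bar>w\<bar> / sqrt (k m) \<ge> 1")
        case True
        have "min (6 * (a m * w)\<^sup>2) (\<bar>t\<bar> * \<bar>a m * w\<bar> ^ 3) \<le> 6 * ((a m)\<^sup>2 * w\<^sup>2)" by (simp add: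
            power_mult_distrib)
        also have "\<dots> \<le> C * ((a m)\<^sup>2 * w\<^sup>2)" by (rule mult_right_mono[OF C(1)]) simp
        finally show ?thesis using True by (simp add: tail_weight_def mult_ac)
      next
        case False
        have "min (6 * (a m * w)\<^sup>2) (\<bar>t\<bar> * \<bar>a m * w\<bar> ^ 3) \<le> \<bar>t\<bar> * \<bar>a m * w\<bar> ^ 3" by simp
        also have "\<dots> = (\<bar>t\<bar> * a m) * ((a m)\<^sup>2 * w\<^sup>2 * \<bar>w\<bar>)"
          using a0[of m] by (simp add: abs_mult power_mult_distrib power3_eq_cube power2_eq_square)
        also have "\<dots> \<le> (\<bar>t\<bar> * (2 / s / sqrt (k m))) * ((a m)\<^sup>2 * w\<^sup>2 * \<bar>w\<bar>)"
          by (intro mult_right_mono mult_left_mono ak) auto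
        also have "\<dots> = (2 * \<bar>t\<bar> / s) * ((a m)\<^sup>2 * w\<^sup>2 * (\<bar>w\<bar> / sqrt (k m)))" by simp
        also have "\<dots> \<le> C * ((a m)\<^sup>2 * w\<^sup>2 * (\<bar>w\<bar> / sqrt (k m)))" by (rule mult_right_mono[OF C(2)]) simp
        finally show ?thesis using False by (simp add: tail_weight_def mult_ac)
      qed
      \<comment> \<open>The centring constant is treated as a second summand, and its tail weight is
        bounded by its square.\<close>
      have tw: "tail_weight (sqrt (k m)) (v m j) \<le> 8 * tail_weight (sqrt (k m)) (U m j) + 8 * (A m (U
          m))\<^sup>2" for j
      proof -
        have "tail_weight (sqrt (k m)) (- A m (U m)) \<le> (A m (U m))\<^sup>2"
          using tail_weight_le_square[of "sqrt (k m)" "- A m (U m)"] by simp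
        then show ?thesis using tail_weight_add[of "sqrt (k m)" "U m j" "- A m (U m)"]
          by (simp add: v_def)
      qed
      have "A m (\<lambda>j. min (6 * (a m * v m j)\<^sup>2) (\<bar>t\<bar> * \<bar>a m * v m j\<bar> ^ 3)) \<le> 
        A m (\<lambda>j. (a m)\<^sup>2 * C * tail_weight (sqrt (k m)) (v m j))"
        unfolding A_def by (intro block_avg_mono pt)
      also have "\<dots> = (a m)\<^sup>2 * C * A m (\<lambda>j. tail_weight (sqrt (k m)) (v m j))"
        by (simp add: A_def block_avg_cmult)
      also have "A m (\<lambda>j. tail_weight (sqrt (k m)) (v m j)) \<le>
          A m (\<lambda>j. 8 * tail_weight (sqrt (k m)) (U m j) + 8 * (A m (U m))\<^sup>2)"
        using tw unfolding A_def by (intro block_avg_mono)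
      also have "\<dots> = 8 * A m (\<lambda>j. tail_weight (sqrt (k m)) (U m j)) + 8 * (A m (U m))\<^sup>2"
        by (simp add: A_def block_avg_add block_avg_cmult)
      finally have "A m (\<lambda>j. min (6 * (a m * v m j)\<^sup>2) (\<bar>t\<bar> * \<bar>a m * v m j\<bar> ^ 3)) \<le> 
          (a m)\<^sup>2 * C * (8 * A m (\<lambda>j. tail_weight (sqrt (k m)) (U m j)) + 8 * (A m (U m))\<^sup>2)"
        using C by (simp add: mult_left_mono)
      then have "k m * A m (\<lambda>j. min (6 * (a m * v m j)\<^sup>2) (\<bar>t\<bar> * \<bar>a m * v m j\<bar> ^ 3)) \<le> 
          k m * ((a m)\<^sup>2 * C * (8 * A m (\<lambda>j. tail_weight (sqrt (k m)) (U m j)) + 8 * (A m (U m))\<^sup>2))"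
        by (rule mult_left_mono) simp
      moreover have "0 \<le> A m (\<lambda>j. min (6 * (a m * v m j)\<^sup>2) (\<bar>t\<bar> * \<bar>a m * v m j\<bar> ^ 3))"
        unfolding A_def by (intro block_avg_nonneg) auto
      ultimately show ?case by (subst int) (auto simp: mult.assoc)
    qed
    show ?thesis
    proof (rule Lim_null_comparison[OF bd])
      have "(\<lambda>m. n m / (real (k m) * b m) / s\<^sup>2 * C * (8 * A m (\<lambda>j. tail_weight (sqrt (k m)) (U m j)) +
          8 * (A m (U m))\<^sup>2))
          \<longlonglongrightarrow> 1 / s\<^sup>2 * C * (8 * 0 + 8 * 0)"
        using s by (intro tendsto_intros knb lim2 lim3) simp
      then show "(\<lambda>m. k m * (a m)\<^sup>2 * C * (8 * A m (\<lambda>j. tail_weight (sqrt (k m)) (U m j)) + 8 * (A m (U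
          m))\<^sup>2)) \<longlonglongrightarrow> 0"
        unfolding ka by simp
    qed
  qed
  have "weak_conv_m \<nu> std_normal_distribution"
  proof (rule levy_continuity[OF \<nu> real_dist_normal_dist])
    fix t
    have "char (\<nu> m) t = char (\<mu> m) t ^ k m" for m
      unfolding \<nu>_def \<mu>_def k_def by (rule char_sum_block_law)
    moreover have "(\<lambda>m. char (\<mu> m) t ^ k m) \<longlonglongrightarrow> char std_normal_distribution t"
    proof (rule iid_array_char_limit[OF \<mu> _ _ kinf var_lim lind])
      show "integrable (\<mu> m) (\<lambda>x. x\<^sup>2)" for m
        unfolding \<mu>_def by (subst integrable_distr_eq) (auto intro!: integrable_measure_pmf_finite)
      show "(\<integral>y. y \<partial>\<mu> m) = 0" for m using Av[of m] by (subst int) (auto simp: A_def block_avg_cmult)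
    qed
    ultimately show "(\<lambda>m. char (\<nu> m) t) \<longlonglongrightarrow> char std_normal_distribution t" by simp
  qed
  then have ul: "uniform_limit UNIV (\<lambda>m. cdf (\<nu> m)) (cdf std_normal_distribution) sequentially"
    by (rule uniform_limit_cdf[OF \<nu> real_dist_normal_dist _ isCont_cdf_std_normal])
  show ?thesis
  proof (rule uniform_limitI)
    fix e :: real assume "e > 0"
    from uniform_limitD[OF ul this] k0
    show "\<forall>\<^sub>F m in sequentially. \<forall>y\<in>UNIV. dist (boot_root_cdf (n m) (b m) (x m) y) (cdf
        std_normal_distribution (y / s)) < e"
    proof eventually_elim
      case (elim m)
      have "boot_root_cdf (n m) (b m) (x m) y = cdf (\<nu> m) (y / s)" for y
        using boot_root_cdf_eq_cdf[OF b0[of m], of "n m" s "x m" y] elim(2) s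
        by (simp add: \<nu>_def k_def a_def v_def U_def A_def)
      then show ?case using elim(1) by simp
    qed
  qed
qed

section \<open>Stationary martingale differences\<close>

lemma integrable_mult_of_squares:
  fixes f g :: "'a \<Rightarrow> real"
  assumes [measurable]: "f \<in> borel_measurable M" "g \<in> borel_measurable M"
    and "integrable M (\<lambda>x. (f x)\<^sup>2)" "integrable M (\<lambda>x. (g x)\<^sup>2)"
  shows "integrable M (\<lambda>x. f x * g x)"
proof (rule Bochner_Integration.integrable_bound)
  show "integrable M (\<lambda>x. (f x)\<^sup>2 + (g x)\<^sup>2)" using assms by simp
  show "AE x in M. norm (f x * g x) \<le> norm ((f x)\<^sup>2 + (g x)\<^sup>2)"
  proof (intro AE_I2)
    fix x
    have "2 * \<bar>f x\<bar> * \<bar>g x\<bar> \<le> (f x)\<^sup>2 + (g x)\<^sup>2" using sum_squares_bound[of "\<bar>f x\<bar>" "\<bar>g x\<bar>"] by simp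
    moreover have "0 \<le> \<bar>f x\<bar> * \<bar>g x\<bar>" by simp
    ultimately have "\<bar>f x\<bar> * \<bar>g x\<bar> \<le> (f x)\<^sup>2 + (g x)\<^sup>2" by linarith
    then show "norm (f x * g x) \<le> norm ((f x)\<^sup>2 + (g x)\<^sup>2)" by (simp add: abs_mult)
  qed
qed simp

lemma integrable_square_add:
  fixes f g :: "'a \<Rightarrow> real"
  assumes [measurable]: "f \<in> borel_measurable M" "g \<in> borel_measurable M"
    and "integrable M (\<lambda>x. (f x)\<^sup>2)" "integrable M (\<lambda>x. (g x)\<^sup>2)"
  shows "integrable M (\<lambda>x. (f x + g x)\<^sup>2)"
  using assms integrable_mult_of_squares[OF assms] by (simp add: power2_sum mult.assoc)

lemma integrable_square_diff:
  fixes f g :: "'a \<Rightarrow> real"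
  assumes [measurable]: "f \<in> borel_measurable M" "g \<in> borel_measurable M"
    and "integrable M (\<lambda>x. (f x)\<^sup>2)" "integrable M (\<lambda>x. (g x)\<^sup>2)"
  shows "integrable M (\<lambda>x. (f x - g x)\<^sup>2)"
  using assms integrable_mult_of_squares[OF assms] by (simp add: power2_diff mult.assoc)

lemma integrable_square_sum:
  fixes f :: "'i \<Rightarrow> 'a \<Rightarrow> real"
  assumes "finite I" "\<And>i. i \<in> I \<Longrightarrow> f i \<in> borel_measurable M" "\<And>i. i \<in> I \<Longrightarrow> integrable M (\<lambda>x. (f i x)\<^sup>2)"
  shows "integrable M (\<lambda>x. (\<Sum>i\<in>I. f i x)\<^sup>2)"
  using assms by (induction I rule: finite_induct) (auto intro!: integrable_square_add)

text \<open>Nonnegativity of the variance of \<open>\<bar>f\<bar>\<close>. Mean square estimates are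
  converted into estimates of first absolute moments by this lemma throughout.\<close>

lemma (in prob_space) abs_expectation_le_sqrt:
  fixes f :: "'a \<Rightarrow> real"
  assumes [measurable]: "f \<in> borel_measurable M" and f2: "integrable M (\<lambda>x. (f x)\<^sup>2)"
  shows "integrable M f" "(\<integral>x. \<bar>f x\<bar> \<partial>M) \<le> sqrt (\<integral>x. (f x)\<^sup>2 \<partial>M)"
proof -
  show f: "integrable M f" by (rule square_integrable_imp_integrable[OF _ f2]) simp
  let ?c = "\<integral>x. \<bar>f x\<bar> \<partial>M"
  have "0 \<le> (\<integral>x. (\<bar>f x\<bar> - ?c)\<^sup>2 \<partial>M)" by (intro integral_nonneg_AE) simp
  also have "\<dots> = (\<integral>x. (f x)\<^sup>2 + ?c\<^sup>2 - 2 * ?c * \<bar>f x\<bar> \<partial>M)"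
    by (intro Bochner_Integration.integral_cong) (auto simp: power2_diff)
  also have "\<dots> = (\<integral>x. (f x)\<^sup>2 \<partial>M) - ?c\<^sup>2"
    using f f2 by (simp add: prob_space power2_eq_square)
  finally have "?c\<^sup>2 \<le> (\<integral>x. (f x)\<^sup>2 \<partial>M)" by simp
  then show "?c \<le> sqrt (\<integral>x. (f x)\<^sup>2 \<partial>M)" by (rule real_le_rsqrt)
qed

lemma square_add_le: "(a + b :: real)\<^sup>2 \<le> 2 * a\<^sup>2 + 2 * b\<^sup>2"
  using zero_le_power2[of "a - b"] unfolding power2_sum power2_diff by linarith

text \<open>\<open>F\<close> plays the role of the past up to time \<open>0\<close>.
  \<open>F_shift\<close> states that \<open>F\<close> is contained in its own preimage under
  \<open>T\<close>; this makes \<open>filtration\<close> increasing without mentioning an inverse of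
  \<open>T\<close>.\<close>

locale filtered_system = prob_space M for M :: "'a measure" +
  fixes T :: "'a \<Rightarrow> 'a" and F :: "'a measure"
  assumes T_measurable [measurable]: "T \<in> measurable M M"
    and T_preserves: "distr M M T = M"
    and F_sub: "subalgebra M F"
    and F_shift: "\<And>A. A \<in> sets F \<Longrightarrow> \<exists>B\<in>sets F. A = T -` B \<inter> space M"
begin

text \<open>On the path space this is the sigma-algebra of the coordinates up to time
  \<open>i\<close>.\<close>

definition filtration :: "nat \<Rightarrow> 'a measure" where
  "filtration i = vimage_algebra (space M) (T ^^ i) F"

definition birkhoff_sum :: "nat \<Rightarrow> ('a \<Rightarrow> real) \<Rightarrow> 'a \<Rightarrow> real" where
  "birkhoff_sum n g x = (\<Sum>i<n. g ((T ^^ i) x))"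

text \<open>The index names the sigma-algebra that is conditioned on. It is kept general because
  composition with \<open>T ^^ i\<close> raises it by \<open>i\<close>, and because the cross terms
  of lag \<open>r\<close> in a squared block sum have index \<open>r\<close>.\<close>

definition martingale_diff :: "nat \<Rightarrow> ('a \<Rightarrow> real) \<Rightarrow> bool" where
  "martingale_diff j g \<longleftrightarrow> g \<in> borel_measurable (filtration (Suc j)) \<and> integrable M (\<lambda>x. (g x)\<^sup>2) \<and>
     (AE x in M. real_cond_exp M (filtration j) g x = 0)"

lemma iterate_measurable [measurable]: "T ^^ i \<in> measurable M M"
  by (induction i) (auto intro: measurable_comp[unfolded comp_def] simp: comp_def)

lemma iterate_space: "x \<in> space M \<Longrightarrow> (T ^^ i) x \<in> space M"
  using measurable_space[OF iterate_measurable] .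

lemma iterate_iterate: "(T ^^ i) ((T ^^ j) x) = (T ^^ (i + j)) x"
  by (simp add: funpow_add)

lemma iterate_preserves: "distr M M (T ^^ i) = M"
proof (induction i)
  case (Suc i)
  have "distr M M (T ^^ Suc i) = distr (distr M M (T ^^ i)) M T"
    by (subst distr_distr) auto
  then show ?case by (simp only: Suc T_preserves)
qed (simp add: distr_id id_def)

lemma measurable_shift [measurable (raw)]:
  "g \<in> measurable M N \<Longrightarrow> (\<lambda>x. g ((T ^^ i) x)) \<in> measurable M N"
  by (rule measurable_compose[OF iterate_measurable])

lemma integral_shift:
  fixes g :: "'a \<Rightarrow> 'b::{banach, second_countable_topology}"
  assumes [measurable]: "g \<in> borel_measurable M"
  shows "(\<integral>x. g ((T ^^ i) x) \<partial>M) = (\<integral>x. g x \<partial>M)"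
  using integral_distr[OF iterate_measurable[of i] assms] by (simp add: iterate_preserves)

lemma integrable_shift:
  fixes g :: "'a \<Rightarrow> 'b::{banach, second_countable_topology}"
  assumes "integrable M g"
  shows "integrable M (\<lambda>x. g ((T ^^ i) x))"
  using integrable_distr_eq[OF iterate_measurable[of i], of g] assms by (simp add: iterate_preserves)

lemma AE_shift:
  assumes "AE x in M. P x" shows "AE x in M. P ((T ^^ i) x)"
proof -
  from assms have "AE x in distr M M (T ^^ i). P x" by (simp only: iterate_preserves)
  then show ?thesis by (rule AE_distrD[OF iterate_measurable])
qed

lemma space_F [simp]: "space F = space M" using F_sub by (simp add: subalgebra_def)

lemma space_filtration [simp]: "space (filtration i) = space M" by (simp add: filtration_def)

lemma iterate_F: "T ^^ i \<in> space M \<rightarrow> space F" using iterate_space by auto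

lemma sets_filtration: "sets (filtration i) = {(T ^^ i) -` A \<inter> space M | A. A \<in> sets F}"
  unfolding filtration_def by (rule sets_vimage_algebra2[OF iterate_F])

lemma sets_filtration_0 [simp]: "sets (filtration 0) = sets F"
proof -
  have "A \<inter> space M = A" if "A \<in> sets F" for A using sets.sets_into_space[OF that] by auto
  then have "{A \<inter> space M | A. A \<in> sets F} = sets F" by auto
  then show ?thesis by (simp add: sets_filtration)
qed

lemma subalgebra_filtration: "subalgebra M (filtration i)"
proof -
  have "sets F \<subseteq> sets M" using F_sub by (simp add: subalgebra_def)
  then show ?thesis by (auto simp: subalgebra_def sets_filtration intro: measurable_sets[OF iterate_measurable])
qed

lemma sets_filtration_Suc: "sets (filtration i) \<subseteq> sets (filtration (Suc i))"
proof
  fix A assume "A \<in> sets (filtration i)"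
  then obtain B where B: "B \<in> sets F" "A = (T ^^ i) -` B \<inter> space M" by (auto simp: sets_filtration)
  obtain C where C: "C \<in> sets F" "B = T -` C \<inter> space M" using F_shift[OF B(1)] by auto
  have "A = (T ^^ Suc i) -` C \<inter> space M" using B(2) C(2) iterate_space by auto
  with C(1) show "A \<in> sets (filtration (Suc i))" by (auto simp: sets_filtration)
qed

lemma subalgebra_filtration_mono: "i \<le> j \<Longrightarrow> subalgebra (filtration j) (filtration i)"
  using lift_Suc_mono_le[of "\<lambda>i. sets (filtration i)", OF sets_filtration_Suc] by (auto simp: subalgebra_def)

lemma measurable_filtration_mono: "g \<in> measurable (filtration i) N \<Longrightarrow> i \<le> j \<Longrightarrow> g \<in> measurable (filtration j) N"
  using measurable_from_subalg[OF subalgebra_filtration_mono] by blast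

lemma measurable_filtrationD: "g \<in> measurable (filtration i) N \<Longrightarrow> g \<in> measurable M N"
  using measurable_from_subalg[OF subalgebra_filtration] by blast

lemma iterate_measurable_filtration: "T ^^ i \<in> measurable (filtration (i + j)) (filtration j)"
proof (rule measurableI)
  fix A assume "A \<in> sets (filtration j)"
  then obtain B where B: "B \<in> sets F" "A = (T ^^ j) -` B \<inter> space M" by (auto simp: sets_filtration)
  have "(T ^^ i) -` A \<inter> space M = (T ^^ (i + j)) -` B \<inter> space M"
    using B(2) iterate_space by (auto simp: iterate_iterate add.commute)
  with B(1) show "(T ^^ i) -` A \<inter> space (filtration (i + j)) \<in> sets (filtration (i + j))" by (auto simp:
      sets_filtration)
qed (simp add: iterate_space)

lemma measurable_filtration_shift:
  "g \<in> measurable (filtration j) N \<Longrightarrow> (\<lambda>x. g ((T ^^ i) x)) \<in> measurable (filtration (i + j)) N"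
  by (rule measurable_compose[OF iterate_measurable_filtration])

lemma sigma_finite_filtration: "sigma_finite_subalgebra M (filtration i)"
  using subalgebra_filtration by (intro finite_measure_subalgebra.axioms
      finite_measure_subalgebra_is_sigma_finite)
    (unfold_locales, auto)

text \<open>Every event of \<open>filtration (i + j)\<close> is the preimage under
  \<open>T ^^ i\<close> of an event of \<open>filtration j\<close>, so invariance of the measure
  carries the integrals that characterize the conditional expectation from one to the other.\<close>

lemma cond_exp_shift:
  assumes g: "integrable M g"
  shows "AE x in M. real_cond_exp M (filtration (i + j)) (\<lambda>x. g ((T ^^ i) x)) x = real_cond_exp M
      (filtration j) g ((T ^^ i) x)"
proof -
  interpret j: sigma_finite_subalgebra M "filtration j" by (rule sigma_finite_filtration)
  interpret ij: sigma_finite_subalgebra M "filtration (i + j)" by (rule sigma_finite_filtration)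
  have [measurable]: "g \<in> borel_measurable M" using g by simp
  show ?thesis
  proof (rule ij.real_cond_exp_charact)
    fix A assume "A \<in> sets (filtration (i + j))"
    then obtain C where C: "C \<in> sets F" "A = (T ^^ (i + j)) -` C \<inter> space M" by (auto simp: sets_filtration)
    define B where "B = (T ^^ j) -` C \<inter> space M"
    have B: "B \<in> sets (filtration j)" using C(1) by (auto simp: sets_filtration B_def)
    then have [measurable]: "B \<in> sets M" using subalgebra_filtration[of j] by (auto simp: subalgebra_def)
    have ind: "indicator A x = (indicator B ((T ^^ i) x) :: real)" if "x \<in> space M" for x
      using that iterate_space[OF that, of i] by (auto simp: C(2) B_def indicator_def iterate_iterate
          add.commute)
    have sh: "(\<integral>x\<in>A. h ((T ^^ i) x) \<partial>M) = (\<integral>x\<in>B. h x \<partial>M)" if [measurable]: "h \<in> borel_measurable M" for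
        h :: "'a \<Rightarrow> real"
      unfolding set_lebesgue_integral_def
      by (subst integral_shift[of _ i, symmetric]) (auto intro!: Bochner_Integration.integral_cong simp: ind)
    show "(\<integral>x\<in>A. g ((T ^^ i) x) \<partial>M) = (\<integral>x\<in>A. real_cond_exp M (filtration j) g ((T ^^ i) x) \<partial>M)"
      using j.real_cond_exp_intA[OF g B] by (simp add: sh)
  qed (use g j.real_cond_exp_int(1)[OF g] in \<open>auto intro!: integrable_shift measurable_filtration_shift\<close>)
qed

lemma martingale_diffD:
  assumes "martingale_diff j g"
  shows "g \<in> borel_measurable (filtration (Suc j))" "g \<in> borel_measurable M" "integrable M (\<lambda>x. (g x)\<^sup>2)"
    "integrable M g" "AE x in M. real_cond_exp M (filtration j) g x = 0"
  using assms measurable_filtrationD abs_expectation_le_sqrt(1) unfolding martingale_diff_def by blast+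

lemma martingale_diff_shift:
  assumes "martingale_diff j g" shows "martingale_diff (i + j) (\<lambda>x. g ((T ^^ i) x))"
proof -
  note g = martingale_diffD[OF assms]
  have "AE x in M. real_cond_exp M (filtration (i + j)) (\<lambda>x. g ((T ^^ i) x)) x = 0"
    using cond_exp_shift[OF g(4), of i j] AE_shift[OF g(5), of i] by eventually_elim simp
  then show ?thesis unfolding martingale_diff_def
    using measurable_filtration_shift[OF g(1), of i] integrable_shift[OF g(3)] by simp
qed

lemma martingale_diff_orthogonal:
  assumes "martingale_diff j g" "h \<in> borel_measurable (filtration j)" "integrable M (\<lambda>x. h x * g x)"
  shows "(\<integral>x. h x * g x \<partial>M) = 0"
proof -
  interpret j: sigma_finite_subalgebra M "filtration j" by (rule sigma_finite_filtration)
  note g = martingale_diffD[OF assms(1)]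
  have "(\<integral>x. h x * g x \<partial>M) = (\<integral>x. h x * real_cond_exp M (filtration j) g x \<partial>M)"
    using j.real_cond_exp_intg(2)[OF assms(3,2) g(2)] by simp
  also have "\<dots> = (\<integral>x. 0 \<partial>M)"
    using g(5) measurable_filtrationD[OF assms(2)] by (intro integral_cong_AE) auto
  finally show ?thesis by simp
qed

lemma birkhoff_sum_0 [simp]: "birkhoff_sum 0 g = (\<lambda>x. 0)" by (simp add: birkhoff_sum_def fun_eq_iff)

lemma birkhoff_sum_Suc: "birkhoff_sum (Suc n) g x = birkhoff_sum n g x + g ((T ^^ n) x)" by (simp add:
    birkhoff_sum_def)

lemma birkhoff_sum_measurable [measurable]: "g \<in> borel_measurable M \<Longrightarrow> birkhoff_sum n g \<in> borel_measurable M"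
  unfolding birkhoff_sum_def by measurable

lemma birkhoff_sum_square_integrable:
  "g \<in> borel_measurable M \<Longrightarrow> integrable M (\<lambda>x. (g x)\<^sup>2) \<Longrightarrow> integrable M (\<lambda>x. (birkhoff_sum n g x)\<^sup>2)"
  unfolding birkhoff_sum_def by (intro integrable_square_sum integrable_shift[of "\<lambda>x. (g x)\<^sup>2"]) auto

lemma birkhoff_sum_measurable_filtration:
  assumes "g \<in> borel_measurable (filtration (Suc j))" "j + n \<le> i"
  shows "birkhoff_sum n g \<in> borel_measurable (filtration i)"
  unfolding birkhoff_sum_def
proof (intro borel_measurable_sum)
  fix k assume "k \<in> {..<n}"
  then show "(\<lambda>x. g ((T ^^ k) x)) \<in> borel_measurable (filtration i)"
    using measurable_filtration_mono[OF measurable_filtration_shift[OF assms(1), of k], of i] assms(2) by simp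
qed

text \<open>Orthogonality of increments: the first \<open>n\<close> terms are measurable for
  \<open>filtration (n + j)\<close>, given which the next term has mean zero.\<close>

lemma martingale_diff_birkhoff_sum_second_moment:
  assumes "martingale_diff j g"
  shows "(\<integral>x. (birkhoff_sum n g x)\<^sup>2 \<partial>M) = n * (\<integral>x. (g x)\<^sup>2 \<partial>M)"
proof (induction n)
  case (Suc n)
  note g = martingale_diffD[OF assms]
  note gn = martingale_diffD[OF martingale_diff_shift[OF assms, of n]]
  have int: "integrable M (\<lambda>x. birkhoff_sum n g x * g ((T ^^ n) x))"
    using g gn by (intro integrable_mult_of_squares birkhoff_sum_square_integrable) auto
  have "(\<integral>x. (birkhoff_sum (Suc n) g x)\<^sup>2 \<partial>M)
     = (\<integral>x. (birkhoff_sum n g x)\<^sup>2 + (g ((T ^^ n) x))\<^sup>2 + 2 * (birkhoff_sum n g x * g ((T ^^ n) x)) \<partial>M)"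
    by (simp add: birkhoff_sum_Suc power2_sum mult.assoc)
  also have "\<dots> = (\<integral>x. (birkhoff_sum n g x)\<^sup>2 \<partial>M) + (\<integral>x. (g ((T ^^ n) x))\<^sup>2 \<partial>M) + 2 * (\<integral>x. birkhoff_sum n
      g x * g ((T ^^ n) x) \<partial>M)"
    using g gn int by (simp add: birkhoff_sum_square_integrable)
  also have "(\<integral>x. birkhoff_sum n g x * g ((T ^^ n) x) \<partial>M) = 0"
    using martingale_diff_orthogonal[OF martingale_diff_shift[OF assms, of n]
        birkhoff_sum_measurable_filtration[OF g(1)] int] by simp
  also have "(\<integral>x. (g ((T ^^ n) x))\<^sup>2 \<partial>M) = (\<integral>x. (g x)\<^sup>2 \<partial>M)"
    using g by (intro integral_shift[of "\<lambda>x. (g x)\<^sup>2"]) auto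
  finally show ?case by (simp add: Suc algebra_simps)
qed simp

end

section \<open>The mean ergodic theorem\<close>

locale ergodic_system = filtered_system +
  assumes ergodic: "\<And>A. A \<in> sets M \<Longrightarrow> T -` A \<inter> space M = A \<Longrightarrow> measure M A = 0 \<or> measure M A = 1"

lemma (in prob_space) integrable_of_bounded:
  fixes g :: "'a \<Rightarrow> 'b::{banach, second_countable_topology}"
  assumes "g \<in> borel_measurable M" "\<And>x. x \<in> space M \<Longrightarrow> norm (g x) \<le> C"
  shows "integrable M g"
  using assms by (intro integrable_const_bound[of _ C]) auto

lemma (in filtered_system) birkhoff_sum_abs_le:
  assumes "\<And>x. \<bar>g x\<bar> \<le> C" shows "\<bar>birkhoff_sum n g x\<bar> \<le> n * C"
  unfolding birkhoff_sum_def using sum_norm_bound[of "{..<n}" "\<lambda>i. g ((T ^^ i) x)" C] assms by simp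

text \<open>Splitting the sum of \<open>n + l\<close> terms in two ways shows that the difference
  equals \<open>birkhoff_sum l g ((T ^^ n) x) - birkhoff_sum l g x\<close>, which has only
  \<open>2 * l\<close> terms.\<close>

lemma (in filtered_system) birkhoff_sum_shift_diff:
  assumes "\<And>x. \<bar>g x\<bar> \<le> C" shows "\<bar>birkhoff_sum n g ((T ^^ l) x) - birkhoff_sum n g x\<bar> \<le> 2 * l * C"
proof -
  have *: "birkhoff_sum (n + m) g x = birkhoff_sum m g x + birkhoff_sum n g ((T ^^ m) x)" for n m x
  proof (induction n)
    case (Suc n)
    have "birkhoff_sum (Suc n + m) g x = birkhoff_sum (Suc (n + m)) g x" by simp
    also have "\<dots> = birkhoff_sum m g x + birkhoff_sum (Suc n) g ((T ^^ m) x)"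
      unfolding birkhoff_sum_Suc Suc by (simp add: iterate_iterate)
    finally show ?case .
  qed simp
  have "birkhoff_sum n g ((T ^^ l) x) - birkhoff_sum n g x = birkhoff_sum l g ((T ^^ n) x) - birkhoff_sum l g x"
    using *[of n l x] *[of l n x] by (simp add: add.commute)
  also have "\<bar>\<dots>\<bar> \<le> l * C + l * C"
    using birkhoff_sum_abs_le[of g C l "(T ^^ n) x", OF assms] birkhoff_sum_abs_le[of g C l x, OF assms]
        by linarith
  finally show ?thesis by (simp add: mult.commute)
qed

context filtered_system
begin

text \<open>Averaging the midpoint \<open>g\<close> over \<open>N\<close> further steps does not
  increase its mean square, by Jensen and invariance, and the result differs from \<open>A N\<close>
  by at most \<open>(n + k) * C / N\<close>. Factoring the difference of the squares contributes
  another \<open>2 * C\<close>.\<close>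

lemma mean_square_midpoint:
  fixes h :: "'a \<Rightarrow> real" and C :: real
  defines "A \<equiv> \<lambda>n x. birkhoff_sum n h x / n"
  assumes h [measurable]: "h \<in> borel_measurable M" and C: "\<And>x. \<bar>h x\<bar> \<le> C"
    and pos: "n > 0" "k > 0" "N > 0"
  shows "(\<integral>x. (A N x)\<^sup>2 \<partial>M) \<le> (\<integral>x. ((A n x + A k x) / 2)\<^sup>2 \<partial>M) + 2 * C\<^sup>2 * (n + k) / N"
proof -
  define g where "g x = (A n x + A k x) / 2" for x
  have [measurable]: "A n \<in> borel_measurable M" for n unfolding A_def by measurable
  have [measurable]: "g \<in> borel_measurable M" unfolding g_def by measurable
  have C0: "C \<ge> 0" using C[of undefined] by linarith
  have A: "\<bar>A n x\<bar> \<le> C" if "n > 0" for n x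
    using birkhoff_sum_abs_le[of h C n x, OF C] that by (simp add: A_def field_simps)
  have gC: "\<bar>g x\<bar> \<le> C" for x using A[OF pos(1), of x] A[OF pos(2), of x] by (auto simp: g_def abs_le_iff)
  have SA: "\<bar>birkhoff_sum N (A n) x - birkhoff_sum N h x\<bar> \<le> 2 * n * C" if "n > 0" for n x
  proof -
    have "birkhoff_sum N (A n) x = (\<Sum>l<n. birkhoff_sum N h ((T ^^ l) x)) / n"
      unfolding birkhoff_sum_def A_def sum_divide_distrib
      by (subst sum.swap) (simp add: iterate_iterate add.commute)
    then have "birkhoff_sum N (A n) x - birkhoff_sum N h x = (\<Sum>l<n. birkhoff_sum N h ((T ^^ l) x) -
        birkhoff_sum N h x) / n"
      using that by (simp add: sum_subtractf diff_divide_distrib)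
    also have "\<bar>\<dots>\<bar> \<le> (n * (2 * n * C)) / n"
      unfolding abs_divide abs_of_nat
    proof (rule divide_right_mono)
      have "\<bar>birkhoff_sum N h ((T ^^ l) x) - birkhoff_sum N h x\<bar> \<le> 2 * real n * C" if "l < n" for l
      proof -
        have "2 * real l * C \<le> 2 * real n * C" using C0 that by (intro mult_right_mono) auto
        then show ?thesis using birkhoff_sum_shift_diff[of h C N l x, OF C] by linarith
      qed
      then show "\<bar>\<Sum>l<n. birkhoff_sum N h ((T ^^ l) x) - birkhoff_sum N h x\<bar> \<le> n * (2 * n * C)"
        using sum_norm_bound[of "{..<n}" "\<lambda>l. birkhoff_sum N h ((T ^^ l) x) - birkhoff_sum N h x" "2 *
            real n * C"] by simp
    qed simp
    finally show ?thesis using that by simp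
  qed
  have Sg: "birkhoff_sum N g x = (birkhoff_sum N (A n) x + birkhoff_sum N (A k) x) / 2" for x
    unfolding birkhoff_sum_def g_def by (simp add: sum.distrib flip: sum_divide_distrib)
  have pt: "(A N x)\<^sup>2 \<le> (birkhoff_sum N g x / N)\<^sup>2 + 2 * C\<^sup>2 * (n + k) / N" for x
  proof -
    have "\<bar>birkhoff_sum N g x - birkhoff_sum N h x\<bar> \<le> (n + k) * C"
      using SA[OF pos(1), of x] SA[OF pos(2), of x] unfolding Sg abs_le_iff by (simp add: field_simps)
    then have "\<bar>birkhoff_sum N g x - birkhoff_sum N h x\<bar> / N \<le> (n + k) * C / N" by (intro
        divide_right_mono) auto
    then have d: "\<bar>A N x - birkhoff_sum N g x / N\<bar> \<le> (n + k) * C / N"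
      unfolding A_def diff_divide_distrib[symmetric] abs_divide by (simp add: abs_minus_commute)
    have c: "\<bar>birkhoff_sum N g x / N\<bar> \<le> C" using birkhoff_sum_abs_le[of g C N x, OF gC] pos(3) by (simp
        add: field_simps)
    have "(A N x)\<^sup>2 - (birkhoff_sum N g x / N)\<^sup>2 = (A N x + birkhoff_sum N g x / N) * (A N x -
        birkhoff_sum N g x / N)"
      by (simp add: power2_eq_square algebra_simps)
    also have "\<dots> \<le> \<bar>A N x + birkhoff_sum N g x / N\<bar> * \<bar>A N x - birkhoff_sum N g x / N\<bar>" by (metis
        abs_ge_self abs_mult)
    also have "\<dots> \<le> (2 * C) * ((n + k) * C / N)"
    proof (intro mult_mono d)
      show "\<bar>A N x + birkhoff_sum N g x / N\<bar> \<le> 2 * C"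
        using abs_triangle_ineq[of "A N x" "birkhoff_sum N g x / N"] c A[OF pos(3), of x] by linarith
    qed (use C0 in auto)
    also have "\<dots> = 2 * C\<^sup>2 * (n + k) / N" by (simp add: power2_eq_square)
    finally show ?thesis by linarith
  qed
  have jensen: "(birkhoff_sum N g x / N)\<^sup>2 \<le> birkhoff_sum N (\<lambda>x. (g x)\<^sup>2) x / N" for x
    using sum_squared_le_sum_of_squares[of "\<lambda>i. g ((T ^^ i) x)" "{..<N}"] pos(3)
    by (simp add: birkhoff_sum_def power_divide power2_eq_square field_simps)
  have int_g: "integrable M (\<lambda>x. (g x)\<^sup>2)"
    by (rule integrable_of_bounded[of _ "C\<^sup>2"]) (use gC C0 in \<open>auto simp: abs_le_square_iff[symmetric]\<close>)
  have int_Sg: "integrable M (birkhoff_sum N (\<lambda>x. (g x)\<^sup>2))"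
    unfolding birkhoff_sum_def by (intro Bochner_Integration.integrable_sum integrable_shift int_g)
  have "(\<integral>x. (A N x)\<^sup>2 \<partial>M) \<le> (\<integral>x. birkhoff_sum N (\<lambda>x. (g x)\<^sup>2) x / N + 2 * C\<^sup>2 * (n + k) / N \<partial>M)"
  proof (rule integral_mono)
    show "integrable M (\<lambda>x. (A N x)\<^sup>2)"
      by (rule integrable_of_bounded[of _ "C\<^sup>2"]) (use A[OF pos(3)] C0 in \<open>auto simp:
          abs_le_square_iff[symmetric]\<close>)
    show "integrable M (\<lambda>x. birkhoff_sum N (\<lambda>x. (g x)\<^sup>2) x / N + 2 * C\<^sup>2 * (n + k) / N)" using int_Sg by simp
    show "(A N x)\<^sup>2 \<le> birkhoff_sum N (\<lambda>x. (g x)\<^sup>2) x / N + 2 * C\<^sup>2 * (n + k) / N" for x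
      using pt[of x] jensen[of x] by linarith
  qed
  also have "\<dots> = (\<integral>x. birkhoff_sum N (\<lambda>x. (g x)\<^sup>2) x \<partial>M) / N + 2 * C\<^sup>2 * (n + k) / N"
    using int_Sg by (simp add: prob_space)
  also have "(\<integral>x. birkhoff_sum N (\<lambda>x. (g x)\<^sup>2) x \<partial>M) = N * (\<integral>x. (g x)\<^sup>2 \<partial>M)"
    unfolding birkhoff_sum_def
    by (subst Bochner_Integration.integral_sum)
       (auto intro!: integrable_shift int_g simp: integral_shift[of "\<lambda>x. (g x)\<^sup>2"])
  finally show ?thesis using pos(3) by (simp add: g_def)
qed

end

context ergodic_system
begin

text \<open>The set where \<open>l\<close> is positive is invariant, so it has measure
  \<open>0\<close> or \<open>1\<close>; measure \<open>1\<close> contradicts the vanishing integral.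
  The same argument applies to \<open>- l\<close>.\<close>

lemma invariant_AE_zero:
  fixes l :: "'a \<Rightarrow> real"
  assumes [measurable]: "l \<in> borel_measurable M" and inv: "\<And>x. x \<in> space M \<Longrightarrow> l (T x) = l x"
    and int: "integrable M l" and "(\<integral>x. l x \<partial>M) = 0"
  shows "AE x in M. l x = 0"
proof -
  have *: "AE x in M. \<not> k x > 0"
    if [measurable]: "k \<in> borel_measurable M" and inv: "\<And>x. x \<in> space M \<Longrightarrow> k (T x) = k x"
      and int: "integrable M k" and 0: "(\<integral>x. k x \<partial>M) = 0" for k :: "'a \<Rightarrow> real"
  proof (rule ccontr)
    assume neg: "\<not> (AE x in M. \<not> k x > 0)"
    have "T -` {x\<in>space M. k x > 0} \<inter> space M = {x\<in>space M. k x > 0}"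
      using inv measurable_space[OF T_measurable] by auto
    then have "measure M {x\<in>space M. k x > 0} = 0 \<or> measure M {x\<in>space M. k x > 0} = 1"
      by (intro ergodic) measurable
    moreover have "measure M {x\<in>space M. k x > 0} \<noteq> 0"
      using neg by (subst (asm) AE_iff_measurable[of "{x\<in>space M. k x > 0}"]) (auto simp: emeasure_eq_measure)
    ultimately have "measure M {x\<in>space M. k x > 0} = 1" by simp
    then have pos: "AE x in M. k x > 0" using prob_eq_1[of "{x\<in>space M. k x > 0}"] by simp
    then have "AE x in M. 0 \<le> k x" by eventually_elim simp
    then have "AE x in M. k x = 0" using integral_nonneg_eq_0_iff_AE[OF int] 0 by simp
    then have "AE x in M. \<not> k x > 0" by eventually_elim simp
    with neg show False by simp
  qed
  have "AE x in M. \<not> l x > 0" by (rule *) (use assms in auto)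
  moreover have "AE x in M. \<not> - l x > 0" by (rule *) (use assms in auto)
  ultimately show ?thesis by eventually_elim simp
qed

text \<open>The minimal norm argument: the norms of the averages converge to their infimum, which by
  \<open>mean_square_midpoint\<close> also bounds the midpoints, so the averages are Cauchy by the parallelogram law.
  Boundedness of \<open>h\<close> makes the subsequential limit invariant at every point, as \<open>ergodic\<close> demands.\<close>

lemma mean_ergodic_centred:
  fixes h :: "'a \<Rightarrow> real" and C :: real
  assumes h [measurable]: "h \<in> borel_measurable M" and C: "\<And>x. \<bar>h x\<bar> \<le> C"
    and mean: "(\<integral>x. h x \<partial>M) = 0"
  shows "(\<lambda>n. \<integral>x. (birkhoff_sum n h x / n)\<^sup>2 \<partial>M) \<longlonglongrightarrow> 0"
proof -
  define A where "A n x = birkhoff_sum n h x / n" for n x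
  define q where "q n = (\<integral>x. (A n x)\<^sup>2 \<partial>M)" for n
  define L where "L = (INF n\<in>{0<..}. q n)"
  have [measurable]: "A n \<in> borel_measurable M" for n unfolding A_def by measurable
  have C0: "C \<ge> 0" using C[of undefined] by linarith
  have A: "\<bar>A n x\<bar> \<le> C" for n x
    using birkhoff_sum_abs_le[of h C n x, OF C] C0 by (cases "n = 0") (auto simp: A_def field_simps)
  have A2: "(A n x)\<^sup>2 \<le> C\<^sup>2" for n x using A[of n x] C0 by (simp add: abs_le_square_iff[symmetric])
  have intA: "integrable M (A n)" for n by (rule integrable_of_bounded[of _ C]) (use A in auto)
  have intA2: "integrable M (\<lambda>x. (A n x)\<^sup>2)" for n by (rule integrable_of_bounded[of _ "C\<^sup>2"]) (use A2 in auto)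
  have q0: "0 \<le> q n" for n unfolding q_def by (intro integral_nonneg_AE) simp
  have Lq: "L \<le> q n" if "n > 0" for n
    unfolding L_def by (rule cINF_lower) (use that q0 in \<open>auto intro!: bdd_belowI\<close>)
  have mid: "q N \<le> (\<integral>x. ((A n x + A k x) / 2)\<^sup>2 \<partial>M) + 2 * C\<^sup>2 * (n + k) / N" if "n > 0" "k > 0" "N > 0"
      for n k N
    unfolding q_def A_def by (rule mean_square_midpoint[OF h C that])
  have over_N: "(\<lambda>N. c / real N) \<longlonglongrightarrow> 0" for c
    using tendsto_mult_left[OF lim_1_over_n, of c] by simp
  \<comment> \<open>Letting \<open>N\<close> grow in \<open>mid\<close> removes the error
    term.\<close>
  have Lmid: "L \<le> (\<integral>x. ((A n x + A k x) / 2)\<^sup>2 \<partial>M)" if "n > 0" "k > 0" for n k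
  proof -
    have "(\<lambda>N. (\<integral>x. ((A n x + A k x) / 2)\<^sup>2 \<partial>M) + 2 * C\<^sup>2 * (n + k) / real N) \<longlonglongrightarrow> (\<integral>x. ((A n x + A k x) /
        2)\<^sup>2 \<partial>M) + 0"
      by (intro tendsto_add tendsto_const over_N)
    moreover have "L \<le> (\<integral>x. ((A n x + A k x) / 2)\<^sup>2 \<partial>M) + 2 * C\<^sup>2 * (n + k) / real N" if "N \<ge> 1" for N
      using Lq[of N] mid[OF \<open>n > 0\<close> \<open>k > 0\<close>, of N] that by linarith
    ultimately show ?thesis by (intro LIMSEQ_le_const[where a = L]) auto
  qed
  have q_lim: "q \<longlonglongrightarrow> L"
  proof (rule LIMSEQ_I)
    fix e :: real assume e: "e > 0"
    have "\<exists>n\<in>{0<..}. q n < L + e / 2"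
      unfolding L_def by (subst cINF_less_iff[symmetric]) (use q0 e in \<open>auto intro!: bdd_belowI\<close>)
    then obtain n where n: "n > 0" "q n < L + e / 2" by auto
    have "(\<lambda>N. 2 * C\<^sup>2 * (n + n) / real N) \<longlonglongrightarrow> 0" by (rule over_N)
    then have "\<forall>\<^sub>F N in sequentially. 2 * C\<^sup>2 * (n + n) / real N < e / 2" using e by (intro order_tendstoD) auto
    then obtain N0 where N0: "\<And>N. N \<ge> N0 \<Longrightarrow> 2 * C\<^sup>2 * (n + n) / real N < e / 2"
      by (auto simp: eventually_sequentially)
    show "\<exists>N0. \<forall>N\<ge>N0. norm (q N - L) < e"
    proof (intro exI allI impI)
      fix N assume N: "N \<ge> max 1 N0"
      have "q N \<le> q n + 2 * C\<^sup>2 * (n + n) / N" using mid[OF n(1) n(1), of N] N by (simp add: q_def)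
      then have "q N < L + e" using n(2) N0[of N] N by simp
      then show "norm (q N - L) < e" using Lq[of N] N by simp
    qed
  qed
  have dist: "(\<integral>x. norm (A i x - A j x) \<partial>M) \<le> sqrt (2 * (q i - L) + 2 * (q j - L))" if "i > 0" "j > 0" for i j
  proof -
    have int: "integrable M (\<lambda>x. (A i x - A j x)\<^sup>2)" "integrable M (\<lambda>x. ((A i x + A j x) / 2)\<^sup>2)"
      using integrable_square_diff[OF _ _ intA2 intA2] integrable_square_add[OF _ _ intA2 intA2]
      by (auto simp: power_divide)
    have "(\<integral>x. (A i x - A j x)\<^sup>2 \<partial>M) = (\<integral>x. 2 * (A i x)\<^sup>2 + 2 * (A j x)\<^sup>2 - 4 * ((A i x + A j x) / 2)\<^sup>2 \<partial>M)"
      by (intro Bochner_Integration.integral_cong) (auto simp: power2_eq_square field_simps)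
    also have "\<dots> = 2 * q i + 2 * q j - 4 * (\<integral>x. ((A i x + A j x) / 2)\<^sup>2 \<partial>M)"
      using int intA2 by (simp add: q_def)
    also have "\<dots> \<le> 2 * (q i - L) + 2 * (q j - L)" using Lmid[OF that] by simp
    finally have "(\<integral>x. (A i x - A j x)\<^sup>2 \<partial>M) \<le> 2 * (q i - L) + 2 * (q j - L)" .
    then show ?thesis
      using abs_expectation_le_sqrt(2)[of "\<lambda>x. A i x - A j x", OF _ int(1)]
      by (auto intro: order_trans)
  qed
  have "\<exists>N. \<forall>i\<ge>N. \<forall>j\<ge>N. (\<integral>x. norm (A i x - A j x) \<partial>M) < e" if e: "e > 0" for e
  proof -
    have "\<forall>\<^sub>F N in sequentially. q N < L + e\<^sup>2 / 4" using q_lim e by (intro order_tendstoD) auto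
    then obtain N0 where N0: "\<And>N. N \<ge> N0 \<Longrightarrow> q N < L + e\<^sup>2 / 4" by (auto simp: eventually_sequentially)
    show ?thesis
    proof (intro exI allI impI)
      fix i j assume ij: "i \<ge> max 1 N0" "j \<ge> max 1 N0"
      have "2 * (q i - L) + 2 * (q j - L) < e\<^sup>2" using N0[of i] N0[of j] ij by (simp add: field_simps)
      then have "sqrt (2 * (q i - L) + 2 * (q j - L)) < e" using e by (simp add: real_less_lsqrt)
      then show "(\<integral>x. norm (A i x - A j x) \<partial>M) < e" using dist[of i j] ij by linarith
    qed
  qed
  then obtain r where r: "strict_mono r" "AE x in M. Cauchy (\<lambda>i. A (r i) x)"
    using cauchy_L1_AE_cauchy_subseq[of M A] intA by blast
  \<comment> \<open>\<open>lim\<close> is a definite description. The averages at \<open>T x\<close>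
    and at \<open>x\<close> converge to the same values, if to any, so \<open>l (T x) = l x\<close>
    holds even at points of divergence.\<close>
  define l where "l x = lim (\<lambda>i. A (r i) x)" for x
  have [measurable]: "l \<in> borel_measurable M" unfolding l_def by measurable
  have l: "AE x in M. (\<lambda>i. A (r i) x) \<longlonglongrightarrow> l x"
    using r(2) by eventually_elim (simp add: l_def Cauchy_convergent_iff convergent_LIMSEQ_iff)
  have r_lim: "filterlim r at_top sequentially" by (rule filterlim_subseq[OF r(1)])
  have inv: "l (T x) = l x" for x
  proof -
    have "\<bar>A n (T x) - A n x\<bar> \<le> 2 * C / n" for n
      using birkhoff_sum_shift_diff[of h C n 1 x, OF C]
      by (simp add: A_def diff_divide_distrib[symmetric] divide_right_mono)
    then have "(\<lambda>n. A n (T x) - A n x) \<longlonglongrightarrow> 0"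
      by (intro Lim_null_comparison[OF _ over_N[of "2 * C"]]) auto
    from filterlim_compose[OF this r_lim] have "(\<lambda>i. A (r i) (T x) - A (r i) x) \<longlonglongrightarrow> 0" .
    then have "(\<lambda>i. A (r i) (T x)) \<longlonglongrightarrow> y \<longleftrightarrow> (\<lambda>i. A (r i) x) \<longlonglongrightarrow> y" for y
      by (rule Lim_transform_eq)
    then show ?thesis by (simp add: l_def lim_def)
  qed
  have intA0: "(\<integral>x. A n x \<partial>M) = 0" for n
  proof -
    have inth: "integrable M h" by (rule integrable_of_bounded[of _ C]) (use C in auto)
    show ?thesis unfolding A_def birkhoff_sum_def
      by (simp add: Bochner_Integration.integral_sum integrable_shift inth integral_shift[OF h] mean)
  qed
  have lC: "AE x in M. \<bar>l x\<bar> \<le> C"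
    using l
  proof eventually_elim
    case (elim x)
    then have "(\<lambda>i. \<bar>A (r i) x\<bar>) \<longlonglongrightarrow> \<bar>l x\<bar>" by (rule tendsto_rabs)
    then show ?case by (rule LIMSEQ_le_const2) (use A in auto)
  qed
  have "(\<lambda>i. \<integral>x. A (r i) x \<partial>M) \<longlonglongrightarrow> (\<integral>x. l x \<partial>M)"
    using l A by (intro integral_dominated_convergence[where w = "\<lambda>_. C"]) auto
  then have l0: "(\<integral>x. l x \<partial>M) = 0" by (simp add: intA0 LIMSEQ_const_iff)
  have "integrable M l" by (rule integrable_const_bound[of _ C]) (use lC in auto)
  then have "AE x in M. l x = 0" using inv l0 by (intro invariant_AE_zero) auto
  with l have A_lim: "AE x in M. (\<lambda>i. (A (r i) x)\<^sup>2) \<longlonglongrightarrow> 0"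
  proof eventually_elim
    case (elim x)
    then show ?case using tendsto_power[of "\<lambda>i. A (r i) x" 0 sequentially 2] by simp
  qed
  have "(\<lambda>i. q (r i)) \<longlonglongrightarrow> (\<integral>x. 0 \<partial>M)"
    unfolding q_def using A_lim A2 by (intro integral_dominated_convergence[where w = "\<lambda>_. C\<^sup>2"]) auto
  \<comment> \<open>All of \<open>q\<close> converges to \<open>L\<close>, so the subsequence on
    which the limit function is identified determines \<open>L\<close>.\<close>
  moreover have "(\<lambda>i. q (r i)) \<longlonglongrightarrow> L" using filterlim_compose[OF q_lim r_lim] .
  ultimately have "L = 0" using LIMSEQ_unique by fastforce
  with q_lim show ?thesis by (simp add: q_def[abs_def] A_def)
qed

theorem mean_ergodic:
  fixes h :: "'a \<Rightarrow> real" and C :: real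
  assumes h [measurable]: "h \<in> borel_measurable M" and C: "\<And>x. \<bar>h x\<bar> \<le> C"
  shows "(\<lambda>n. \<integral>x. \<bar>birkhoff_sum n h x / n - (\<integral>x. h x \<partial>M)\<bar> \<partial>M) \<longlonglongrightarrow> 0"
proof -
  define c where "c = (\<integral>x. h x \<partial>M)"
  define g where "g x = h x - c" for x
  have [measurable]: "g \<in> borel_measurable M" unfolding g_def by measurable
  have gC: "\<bar>g x\<bar> \<le> C + \<bar>c\<bar>" for x using C[of x] unfolding g_def by linarith
  have inth: "integrable M h" by (rule integrable_of_bounded[of _ C]) (use C in auto)
  have g0: "(\<integral>x. g x \<partial>M) = 0" using inth by (simp add: g_def c_def prob_space)
  have Sg: "birkhoff_sum n g x / n = birkhoff_sum n h x / n - c" if "n > 0" for n x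
    using that by (simp add: birkhoff_sum_def g_def sum_subtractf diff_divide_distrib)
  have g2: "integrable M (\<lambda>x. (g x)\<^sup>2)"
    by (rule integrable_of_bounded[of _ "(C + \<bar>c\<bar>)\<^sup>2"]) (use gC C[of undefined] in \<open>auto simp:
        abs_le_square_iff[symmetric]\<close>)
  have "(\<lambda>n. sqrt (\<integral>x. (birkhoff_sum n g x / n)\<^sup>2 \<partial>M)) \<longlonglongrightarrow> sqrt 0"
    by (intro tendsto_intros mean_ergodic_centred[OF _ gC g0]) simp
  then have lim: "(\<lambda>n. sqrt (\<integral>x. (birkhoff_sum n g x / n)\<^sup>2 \<partial>M)) \<longlonglongrightarrow> 0" by simp
  show ?thesis
  proof (rule Lim_null_comparison[OF _ lim], rule eventually_sequentiallyI[of 1])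
    fix n :: nat assume "1 \<le> n"
    then have n: "n > 0" by simp
    have "integrable M (\<lambda>x. (birkhoff_sum n g x / n)\<^sup>2)"
      using birkhoff_sum_square_integrable[OF _ g2] by (simp add: power_divide)
    from abs_expectation_le_sqrt(2)[OF _ this]
    show "norm (\<integral>x. \<bar>birkhoff_sum n h x / n - (\<integral>x. h x \<partial>M)\<bar> \<partial>M) \<le> sqrt (\<integral>x. (birkhoff_sum n g x / n)\<^sup>2 \<partial>M)"
      unfolding Sg[OF n] c_def by simp
  qed
qed

end

section \<open>The central limit theorem for bounded martingale differences\<close>

lemma norm_one_plus_i_ge: "1 \<le> norm (1 + \<i> * complex_of_real x)"
  by (simp add: cmod_def)

lemma norm_one_plus_i_le: "norm (1 + \<i> * complex_of_real x) \<le> exp (x\<^sup>2 / 2)"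
proof -
  have "norm (1 + \<i> * complex_of_real x) = sqrt (1 + x\<^sup>2)" by (simp add: cmod_def)
  also have "\<dots> \<le> sqrt (exp (x\<^sup>2))" using exp_ge_add_one_self[of "x\<^sup>2"] by simp
  also have "sqrt (exp (x\<^sup>2)) = exp (x\<^sup>2 / 2)"
    by (rule real_sqrt_unique) (simp_all add: power2_eq_square flip: exp_add)
  finally show ?thesis .
qed

lemma norm_iexp_quotient_le: "norm (iexp x / (1 + \<i> * complex_of_real x)) \<le> 1"
  using norm_one_plus_i_ge[of x] by (simp add: norm_divide divide_le_eq_1)

text \<open>\<open>log (1 + i x) = i x + x^2 / 2 + O(x^3)\<close> near \<open>0\<close>, so the
  quotient is \<open>exp (- x^2 / 2)\<close> up to a cubic error. For
  \<open>\<bar>x\<bar> > 1\<close> both terms have modulus at most \<open>1\<close>.\<close>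

lemma iexp_quotient_approx:
  "norm (iexp x / (1 + \<i> * complex_of_real x) - complex_of_real (exp (- (x\<^sup>2 / 2)))) \<le> 2 * \<bar>x\<bar> ^ 3"
proof (cases "\<bar>x\<bar> \<le> 1")
  case True
  define z where "z = 1 + \<i> * complex_of_real x"
  define R where "R = iexp x - (1 + \<i> * x - x\<^sup>2 / 2)"
  define \<rho> where "\<rho> = exp (- (x\<^sup>2 / 2)) - (1 - x\<^sup>2 / 2)"
  have z1: "1 \<le> norm z" unfolding z_def by (rule norm_one_plus_i_ge)
  have z2: "norm z \<le> 2" unfolding z_def using norm_triangle_ineq[of 1 "\<i> * complex_of_real x"] True
    by (simp add: norm_mult)
  have R: "norm R \<le> \<bar>x\<bar> ^ 3 / 6"
    using iexp_approx1[of x 2] by (simp add: R_def numeral_eq_Suc power2_eq_square[unfolded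
        numeral_eq_Suc] algebra_simps)
  have "\<bar>\<rho>\<bar> \<le> (x\<^sup>2 / 2)\<^sup>2"
    using exp_minus_second_order[of "x\<^sup>2 / 2"] by (simp add: \<rho>_def abs_minus_commute)
  also have "(x\<^sup>2 / 2)\<^sup>2 = \<bar>x\<bar> * (\<bar>x\<bar> ^ 3) / 4" by (simp add: power2_eq_square power3_eq_cube flip: abs_mult)
  also have "\<dots> \<le> 1 * \<bar>x\<bar> ^ 3 / 4" using True by (intro divide_right_mono mult_right_mono) auto
  finally have \<rho>: "\<bar>\<rho>\<bar> \<le> \<bar>x\<bar> ^ 3 / 4" by simp
  \<comment> \<open>The polynomial parts cancel up to order two;
    \<open>(1 + i x) * (1 - x^2 / 2)\<close> leaves the cubic term
    \<open>- i x^3 / 2\<close>.\<close>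
  have "iexp x - z * exp (- (x\<^sup>2 / 2)) = R + \<i> * (x ^ 3 / 2) - z * \<rho>"
    by (simp add: R_def z_def \<rho>_def power2_eq_square power3_eq_cube field_simps)
  also have "norm \<dots> \<le> norm R + norm (\<i> * (x ^ 3 / 2)) + norm (z * \<rho>)"
    by (intro order_trans[OF norm_triangle_ineq4] add_mono norm_triangle_ineq) simp
  also have "norm (\<i> * (x ^ 3 / 2)) = \<bar>x\<bar> ^ 3 / 2" by (simp add: norm_mult norm_divide norm_power)
  also have "norm (z * complex_of_real \<rho>) \<le> 2 * (\<bar>x\<bar> ^ 3 / 4)"
    unfolding norm_mult using z2 \<rho> by (intro mult_mono) auto
  finally have "norm (iexp x - z * exp (- (x\<^sup>2 / 2))) \<le> \<bar>x\<bar> ^ 3 / 6 + \<bar>x\<bar> ^ 3 / 2 + 2 * (\<bar>x\<bar> ^ 3 / 4)"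
    using R by linarith
  also have "\<dots> \<le> 2 * \<bar>x\<bar> ^ 3" by simp
  finally have N: "norm (iexp x - z * exp (- (x\<^sup>2 / 2))) \<le> 2 * \<bar>x\<bar> ^ 3" .
  have "z \<noteq> 0" using z1 by auto
  then have "iexp x / z - exp (- (x\<^sup>2 / 2)) = (iexp x - z * exp (- (x\<^sup>2 / 2))) / z" by (simp add: field_simps)
  also have "norm \<dots> \<le> norm (iexp x - z * exp (- (x\<^sup>2 / 2))) / 1"
    unfolding norm_divide using z1 by (intro divide_left_mono) auto
  finally show ?thesis using N by (simp add: z_def)
next
  case False
  have "norm (iexp x / (1 + \<i> * complex_of_real x) - complex_of_real (exp (- (x\<^sup>2 / 2)))) \<le> 1 + 1"
    by (intro order_trans[OF norm_triangle_ineq4] add_mono norm_iexp_quotient_le) simp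
  also have "\<dots> \<le> 2 * \<bar>x\<bar> ^ 3" using False one_le_power[of "\<bar>x\<bar>" 3] by simp
  finally show ?thesis .
qed

lemma abs_exp_minus_diff_le:
  fixes a b :: real assumes "0 \<le> a" "0 \<le> b" shows "\<bar>exp (- a) - exp (- b)\<bar> \<le> \<bar>a - b\<bar>"
proof -
  have *: "exp (- a) - exp (- b) \<le> b - a" if "0 \<le> a" "a \<le> b" for a b :: real
  proof -
    have "exp (- a) - exp (- b) = exp (- a) * (1 - exp (- (b - a)))" by (simp add: algebra_simps flip: exp_add)
    also have "\<dots> \<le> 1 * (b - a)"
    proof (rule mult_mono)
      show "1 - exp (- (b - a)) \<le> b - a" using exp_ge_add_one_self[of "- (b - a)"] by linarith
    qed (use that in auto)
    finally show ?thesis by simp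
  qed
  show ?thesis using *[of a b] *[of b a] assms by (cases "a \<le> b") auto
qed

context filtered_system
begin

definition bounded_martingale_diff :: "('a \<Rightarrow> real) \<Rightarrow> real \<Rightarrow> bool" where
  "bounded_martingale_diff e K \<longleftrightarrow> martingale_diff 0 e \<and> (\<forall>x. \<bar>e x\<bar> \<le> K)"

lemma bounded_martingale_diffD:
  assumes "bounded_martingale_diff e K"
  shows "martingale_diff 0 e" "\<And>x. \<bar>e x\<bar> \<le> K" "0 \<le> K" "e \<in> borel_measurable M" "integrable M (\<lambda>x. (e x)\<^sup>2)"
    "\<And>x. (e x)\<^sup>2 \<le> K\<^sup>2" "(\<integral>x. (e x)\<^sup>2 \<partial>M) \<le> K\<^sup>2" "0 \<le> (\<integral>x. (e x)\<^sup>2 \<partial>M)"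
proof -
  show 1: "martingale_diff 0 e" "\<And>x. \<bar>e x\<bar> \<le> K" using assms by (auto simp: bounded_martingale_diff_def)
  show 0: "0 \<le> K" using 1(2)[of undefined] by linarith
  show "e \<in> borel_measurable M" and int: "integrable M (\<lambda>x. (e x)\<^sup>2)" using martingale_diffD[OF 1(1)] by auto
  show 2: "(e x)\<^sup>2 \<le> K\<^sup>2" for x using 1(2)[of x] 0 by (simp add: abs_le_square_iff[symmetric])
  have "(\<integral>x. (e x)\<^sup>2 \<partial>M) \<le> (\<integral>x. K\<^sup>2 \<partial>M)" using int 2 by (intro integral_mono) auto
  then show "(\<integral>x. (e x)\<^sup>2 \<partial>M) \<le> K\<^sup>2" by (simp add: prob_space)
qed (rule integral_nonneg_AE, simp)

text \<open>The term \<open>S^3 * D\<close> integrates to zero. The induction step therefore adds at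
  most \<open>8 * K^2 * (n * K^2) + 3 * K^4\<close>, while the claimed bound grows by
  \<open>(8 * n + 4) * K^4\<close>.\<close>

lemma bounded_martingale_diff_fourth_moment:
  assumes e: "bounded_martingale_diff e K"
  shows "(\<integral>x. (birkhoff_sum n e x) ^ 4 \<partial>M) \<le> 4 * K ^ 4 * (real n)\<^sup>2"
proof (induction n)
  case (Suc n)
  note b = bounded_martingale_diffD[OF e]
  note [measurable] = b(4)
  define S where "S = birkhoff_sum n e"
  define D where "D x = e ((T ^^ n) x)" for x
  have [measurable]: "S \<in> borel_measurable M" "D \<in> borel_measurable M" unfolding S_def D_def by measurable
  have SK: "\<bar>S x\<bar> \<le> n * K" for x unfolding S_def by (rule birkhoff_sum_abs_le[OF b(2)])
  have DK: "\<bar>D x\<bar> \<le> K" for x unfolding D_def by (rule b(2))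
  have SDK: "\<bar>S x + D x\<bar> \<le> n * K + K" for x using SK[of x] DK[of x] by linarith
  have D2: "(D x)\<^sup>2 \<le> K\<^sup>2" for x unfolding D_def by (rule b(6))
  have Sp: "integrable M (\<lambda>x. S x ^ p)" for p
    by (rule integrable_of_bounded[of _ "(n * K) ^ p"]) (auto simp: power_abs power_mono SK)
  have SD: "integrable M (\<lambda>x. S x ^ 3 * D x)"
    by (rule integrable_of_bounded[of _ "(n * K) ^ 3 * K"])
       (auto simp: abs_mult power_abs intro!: mult_mono power_mono SK DK zero_le_power mult_nonneg_nonneg b(3))
  \<comment> \<open>With \<open>\<bar>D\<bar> \<le> K\<close>, the term \<open>6 S^2 D^2\<close>
    contributes \<open>6 K^2 S^2\<close>. The term \<open>4 S D^3\<close>, by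
    \<open>2 S D \<le> S^2 + D^2\<close>, contributes \<open>2 K^2 S^2 + 2 K^4\<close>, and
    \<open>D^4\<close> the last \<open>K^4\<close>.\<close>
  have pt: "(S x + D x) ^ 4 \<le> S x ^ 4 + 4 * (S x ^ 3 * D x) + 8 * K\<^sup>2 * S x ^ 2 + 3 * K ^ 4" for x
  proof -
    have "6 * (S x)\<^sup>2 * (D x)\<^sup>2 \<le> 6 * (S x)\<^sup>2 * K\<^sup>2" using D2[of x] by (intro mult_left_mono) auto
    moreover have "4 * S x * D x * (D x)\<^sup>2 \<le> 2 * ((S x)\<^sup>2 + (D x)\<^sup>2) * (D x)\<^sup>2"
      using sum_squares_bound[of "S x" "D x"] by (intro mult_right_mono) auto
    moreover have "2 * ((S x)\<^sup>2 + (D x)\<^sup>2) * (D x)\<^sup>2 \<le> 2 * ((S x)\<^sup>2 + K\<^sup>2) * K\<^sup>2"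
      using D2[of x] by (intro mult_mono) auto
    moreover have "(D x)\<^sup>2 * (D x)\<^sup>2 \<le> K\<^sup>2 * K\<^sup>2" using D2[of x] by (intro mult_mono) auto
    ultimately show ?thesis by (simp add: power2_eq_square power3_eq_cube power4_eq_xxxx algebra_simps)
  qed
  have "(\<integral>x. (birkhoff_sum (Suc n) e x) ^ 4 \<partial>M) = (\<integral>x. (S x + D x) ^ 4 \<partial>M)" by (simp add:
      birkhoff_sum_Suc S_def D_def)
  also have "\<dots> \<le> (\<integral>x. S x ^ 4 + 4 * (S x ^ 3 * D x) + 8 * K\<^sup>2 * S x ^ 2 + 3 * K ^ 4 \<partial>M)"
  proof (rule integral_mono)
    show "integrable M (\<lambda>x. (S x + D x) ^ 4)"
    proof (rule integrable_of_bounded[of _ "(n * K + K) ^ 4"])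
      show "norm ((S x + D x) ^ 4) \<le> (n * K + K) ^ 4" for x using power_mono[OF SDK[of x], of 4] by simp
    qed simp
  qed (use Sp SD pt in auto)
  also have "\<dots> = (\<integral>x. S x ^ 4 \<partial>M) + 4 * (\<integral>x. S x ^ 3 * D x \<partial>M) + 8 * K\<^sup>2 * (\<integral>x. S x ^ 2 \<partial>M) + 3 * K ^ 4"
    using Sp SD by (simp add: prob_space)
  also have "(\<integral>x. S x ^ 3 * D x \<partial>M) = 0"
  proof (rule martingale_diff_orthogonal[OF _ _ SD])
    show "martingale_diff n D" using martingale_diff_shift[OF b(1), of n] unfolding D_def by simp
    show "(\<lambda>x. S x ^ 3) \<in> borel_measurable (filtration n)"
      unfolding S_def using birkhoff_sum_measurable_filtration[OF martingale_diffD(1)[OF b(1)], of n n] by simp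
  qed
  also have "(\<integral>x. S x ^ 2 \<partial>M) = n * (\<integral>x. (e x)\<^sup>2 \<partial>M)" unfolding S_def by (rule
      martingale_diff_birkhoff_sum_second_moment[OF b(1)])
  also have "8 * K\<^sup>2 * (n * (\<integral>x. (e x)\<^sup>2 \<partial>M)) \<le> 8 * K\<^sup>2 * (n * K\<^sup>2)"
    using b(7) by (intro mult_left_mono) auto
  also have "(\<integral>x. S x ^ 4 \<partial>M) \<le> 4 * K ^ 4 * (real n)\<^sup>2" using Suc by (simp add: S_def)
  also have "4 * K ^ 4 * (real n)\<^sup>2 + 4 * 0 + 8 * K\<^sup>2 * (n * K\<^sup>2) + 3 * K ^ 4 \<le> 4 * K ^ 4 * (real (Suc n))\<^sup>2"
    using b(3) by (simp add: power2_eq_square power4_eq_xxxx algebra_simps)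
  finally show ?case by simp
qed simp

text \<open>Multiplying by a new factor adds a multiple of \<open>P * D\<close>, where
  \<open>P\<close> is measurable for the sigma-algebra given which \<open>D\<close> has mean zero.
  Real and imaginary parts are treated separately since \<open>martingale_diff_orthogonal\<close>
  concerns real functions.\<close>

lemma bounded_martingale_diff_product:
  assumes e: "bounded_martingale_diff e K"
  shows "(\<integral>x. (\<Prod>j<n. 1 + \<i> * complex_of_real (c * e ((T ^^ j) x))) \<partial>M) = 1"
proof (induction n)
  case (Suc n)
  note b = bounded_martingale_diffD[OF e]
  note [measurable] = b(4)
  define P where "P x = (\<Prod>j<n. 1 + \<i> * complex_of_real (c * e ((T ^^ j) x)))" for x
  define D where "D x = e ((T ^^ n) x)" for x
  have [measurable]: "P \<in> borel_measurable M" "D \<in> borel_measurable M" unfolding P_def D_def by measurable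
  have PF: "P \<in> borel_measurable (filtration n)"
    unfolding P_def
  proof (rule borel_measurable_prod)
    fix j assume "j \<in> {..<n}"
    then have [measurable]: "(\<lambda>x. e ((T ^^ j) x)) \<in> borel_measurable (filtration n)"
      using measurable_filtration_mono[OF measurable_filtration_shift[OF martingale_diffD(1)[OF b(1)],
          of j], of n] by simp
    show "(\<lambda>x. 1 + \<i> * complex_of_real (c * e ((T ^^ j) x))) \<in> borel_measurable (filtration n)"
      by measurable
  qed
  have PB: "norm (P x) \<le> (1 + \<bar>c\<bar> * K) ^ n" for x
  proof -
    have "norm (P x) \<le> (\<Prod>j<n. 1 + \<bar>c\<bar> * K)"
      unfolding P_def prod_norm[symmetric]
    proof (intro prod_mono conjI)
      fix j
      have "norm (1 + \<i> * complex_of_real (c * e ((T ^^ j) x))) \<le> 1 + \<bar>c\<bar> * \<bar>e ((T ^^ j) x)\<bar>"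
        by (rule order_trans[OF norm_triangle_ineq]) (simp add: norm_mult)
      also have "\<dots> \<le> 1 + \<bar>c\<bar> * K" by (intro add_left_mono mult_left_mono b(2)) simp
      finally show "norm (1 + \<i> * complex_of_real (c * e ((T ^^ j) x))) \<le> 1 + \<bar>c\<bar> * K" .
    qed simp
    then show ?thesis by simp
  qed
  have intP: "integrable M P" by (rule integrable_of_bounded[OF _ PB]) simp
  have intPD: "integrable M (\<lambda>x. P x * D x)"
  proof (rule integrable_of_bounded[of _ "(1 + \<bar>c\<bar> * K) ^ n * K"])
    show "norm (P x * complex_of_real (D x)) \<le> (1 + \<bar>c\<bar> * K) ^ n * K" for x
      unfolding norm_mult D_def using b(2)[of "(T ^^ n) x"] by (intro mult_mono PB) (auto simp: b(3))
  qed simp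
  have mD: "martingale_diff n D" using martingale_diff_shift[OF b(1), of n] unfolding D_def by simp
  have "(\<integral>x. P x * D x \<partial>M) = 0"
  proof (rule complex_eqI)
    have "Re (\<integral>x. P x * D x \<partial>M) = (\<integral>x. Re (P x * D x) \<partial>M)"
      by (rule integral_bounded_linear[OF bounded_linear_Re intPD, symmetric])
    also have "\<dots> = (\<integral>x. Re (P x) * D x \<partial>M)" by simp
    also have "\<dots> = 0"
    proof (rule martingale_diff_orthogonal[OF mD])
      show "(\<lambda>x. Re (P x)) \<in> borel_measurable (filtration n)" using PF by measurable
      show "integrable M (\<lambda>x. Re (P x) * D x)" using integrable_bounded_linear[OF bounded_linear_Re
          intPD] by simp
    qed
    finally show "Re (\<integral>x. P x * D x \<partial>M) = Re 0" by simp
    have "Im (\<integral>x. P x * D x \<partial>M) = (\<integral>x. Im (P x * D x) \<partial>M)"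
      by (rule integral_bounded_linear[OF bounded_linear_Im intPD, symmetric])
    also have "\<dots> = (\<integral>x. Im (P x) * D x \<partial>M)" by simp
    also have "\<dots> = 0"
    proof (rule martingale_diff_orthogonal[OF mD])
      show "(\<lambda>x. Im (P x)) \<in> borel_measurable (filtration n)" using PF by measurable
      show "integrable M (\<lambda>x. Im (P x) * D x)" using integrable_bounded_linear[OF bounded_linear_Im
          intPD] by simp
    qed
    finally show "Im (\<integral>x. P x * D x \<partial>M) = Im 0" by simp
  qed
  moreover have "(\<integral>x. (\<Prod>j<Suc n. 1 + \<i> * complex_of_real (c * e ((T ^^ j) x))) \<partial>M)
     = (\<integral>x. P x + \<i> * c * (P x * D x) \<partial>M)"
    by (simp add: P_def D_def algebra_simps)
  moreover have "\<dots> = (\<integral>x. P x \<partial>M) + \<i> * c * (\<integral>x. P x * D x \<partial>M)"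
    using intP intPD by simp
  ultimately show ?case using Suc by (simp add: P_def)
qed (simp add: prob_space)

end

text \<open>McLeish's argument: \<open>P = \<Prod>\<^sub>j (1 + i y\<^sub>j)\<close> has expectation \<open>1\<close> and is bounded, and the quotient \<open>W\<close> of
  \<open>exp (i \<Sum>\<^sub>j y\<^sub>j)\<close> by \<open>P\<close> is close to \<open>exp (- \<Sum>\<^sub>j y\<^sub>j\<^sup>2 / 2)\<close>, which converges to a constant by the
      ergodic theorem.\<close>

theorem (in ergodic_system) bounded_martingale_diff_clt:
  assumes e: "bounded_martingale_diff e K"
  shows "(\<lambda>n. \<integral>x. iexp (t * (birkhoff_sum n e x / sqrt n)) \<partial>M) \<longlonglongrightarrow> exp (- (t\<^sup>2 * (\<integral>x. (e x)\<^sup>2 \<partial>M) / 2))"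
proof -
  note b = bounded_martingale_diffD[OF e]
  note [measurable] = b(4)
  define v where "v = (\<integral>x. (e x)\<^sup>2 \<partial>M)"
  define L where "L = exp (- (t\<^sup>2 * v / 2))"
  define B where "B = exp (t\<^sup>2 * K\<^sup>2 / 2)"
  define q where "q n = (\<integral>x. \<bar>birkhoff_sum n (\<lambda>x. (e x)\<^sup>2) x / n - v\<bar> \<partial>M)" for n
  have v0: "v \<ge> 0" unfolding v_def by (rule b(8))
  have q_lim: "q \<longlonglongrightarrow> 0" unfolding q_def[abs_def] v_def
    by (rule mean_ergodic[where C = "K\<^sup>2"]) (use b(6) in auto)
  have inv_sqrt: "(\<lambda>n. 1 / sqrt (real n)) \<longlonglongrightarrow> 0"
    by (rule tendsto_divide_0[OF tendsto_const filterlim_at_top_imp_at_infinity[OF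
      filterlim_compose[OF sqrt_at_top filterlim_real_sequentially]]])
  have main: "norm ((\<integral>x. iexp (t * (birkhoff_sum n e x / sqrt n)) \<partial>M) - L) \<le> B * (2 * \<bar>t\<bar> ^ 3 * K ^ 3 *
      (1 / sqrt n) + t\<^sup>2 / 2 * q n)"
    if n: "n > 0" for n :: nat
  proof -
    define c where "c = t / sqrt n"
    define y where "y j x = c * e ((T ^^ j) x)" for j x
    define P where "P x = (\<Prod>j<n. 1 + \<i> * complex_of_real (y j x))" for x
    define W where "W x = (\<Prod>j<n. iexp (y j x) / (1 + \<i> * complex_of_real (y j x)))" for x
    define Q where "Q x = birkhoff_sum n (\<lambda>x. (e x)\<^sup>2) x / n" for x
    have [measurable]: "y j \<in> borel_measurable M" for j unfolding y_def by measurable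
    have [measurable]: "P \<in> borel_measurable M" "W \<in> borel_measurable M" "Q \<in> borel_measurable M"
      unfolding P_def W_def Q_def by measurable
    have nz: "1 + \<i> * complex_of_real (y j x) \<noteq> 0" for j x
      using norm_one_plus_i_ge[of "y j x"] by auto
    have c2: "c\<^sup>2 = t\<^sup>2 / n" by (simp add: c_def power_divide)
    have PW: "iexp (t * (birkhoff_sum n e x / sqrt n)) = P x * W x" for x
    proof -
      have "P x * W x = (\<Prod>j<n. iexp (y j x))"
        unfolding P_def W_def by (simp add: nz flip: prod.distrib)
      also have "\<dots> = iexp (\<Sum>j<n. y j x)" by (simp add: exp_sum sum_distrib_left)
      also have "(\<Sum>j<n. y j x) = t * (birkhoff_sum n e x / sqrt n)"
        by (simp add: y_def birkhoff_sum_def c_def sum_distrib_left sum_divide_distrib)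
      finally show ?thesis by simp
    qed
    have sum_y2: "(\<Sum>j<n. (y j x)\<^sup>2) = t\<^sup>2 * Q x" for x
      unfolding y_def power_mult_distrib c2 Q_def birkhoff_sum_def by (simp add: sum_distrib_left
          sum_divide_distrib)
    have QK: "Q x \<le> K\<^sup>2" "0 \<le> Q x" for x
    proof -
      have "\<bar>birkhoff_sum n (\<lambda>x. (e x)\<^sup>2) x\<bar> \<le> n * K\<^sup>2" by (rule birkhoff_sum_abs_le) (use b(6) in simp)
      then show "Q x \<le> K\<^sup>2" using n by (simp add: Q_def divide_le_eq mult.commute abs_le_iff)
      show "0 \<le> Q x" unfolding Q_def birkhoff_sum_def by (intro divide_nonneg_nonneg sum_nonneg) auto
    qed
    \<comment> \<open>Boundedness of \<open>e\<close> keeps \<open>\<Sum>j<n. (y j x)^2\<close>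
      below \<open>t^2 * K^2\<close>, so this bound is independent of \<open>n\<close>.\<close>
    have PB: "norm (P x) \<le> B" for x
    proof -
      have "norm (P x) \<le> (\<Prod>j<n. exp ((y j x)\<^sup>2 / 2))"
        unfolding P_def prod_norm[symmetric] by (intro prod_mono conjI norm_one_plus_i_le) simp
      also have "\<dots> = exp (t\<^sup>2 * Q x / 2)" by (simp add: exp_sum[symmetric] sum_y2 flip: sum_divide_distrib)
      also have "\<dots> \<le> B" unfolding B_def using QK[of x] by (simp add: mult_left_mono divide_right_mono)
      finally show ?thesis .
    qed
    have WB: "norm (W x) \<le> 1" for x
      unfolding W_def prod_norm[symmetric] by (intro prod_le_1 conjI norm_iexp_quotient_le) simp
    have WL: "norm (W x - L) \<le> 2 * \<bar>t\<bar> ^ 3 * K ^ 3 * (1 / sqrt n) + t\<^sup>2 / 2 * \<bar>Q x - v\<bar>" for x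
    proof -
      have y3: "\<bar>y j x\<bar> ^ 3 \<le> \<bar>c\<bar> ^ 3 * K ^ 3" for j
        unfolding y_def abs_mult power_mult_distrib by (intro mult_left_mono power_mono b(2)) auto
      have "norm (W x - (\<Prod>j<n. complex_of_real (exp (- ((y j x)\<^sup>2 / 2)))))
         \<le> (\<Sum>j<n. norm (iexp (y j x) / (1 + \<i> * complex_of_real (y j x)) - complex_of_real (exp (- ((y j
             x)\<^sup>2 / 2)))))"
        unfolding W_def by (intro norm_prod_diff norm_iexp_quotient_le) simp
      also have "\<dots> \<le> (\<Sum>j<n. 2 * (\<bar>c\<bar> ^ 3 * K ^ 3))"
        by (intro sum_mono order_trans[OF iexp_quotient_approx] mult_left_mono y3) simp
      also have "\<dots> = 2 * \<bar>t\<bar> ^ 3 * K ^ 3 * (n * \<bar>1 / sqrt n\<bar> ^ 3)" by (simp add: c_def power_divide)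
      also have "n * \<bar>1 / sqrt n\<bar> ^ 3 = 1 / sqrt n"
        using n by (simp add: power3_eq_cube)
      finally have 1: "norm (W x - (\<Prod>j<n. complex_of_real (exp (- ((y j x)\<^sup>2 / 2))))) \<le> 2 * \<bar>t\<bar> ^ 3 * K
          ^ 3 * (1 / sqrt n)" .
      have "(\<Prod>j<n. complex_of_real (exp (- ((y j x)\<^sup>2 / 2)))) = complex_of_real (exp (- (t\<^sup>2 * Q x / 2)))"
        by (simp add: exp_sum[symmetric] sum_negf sum_y2 flip: of_real_prod sum_divide_distrib)
      then have "norm ((\<Prod>j<n. complex_of_real (exp (- ((y j x)\<^sup>2 / 2)))) - L) = \<bar>exp (- (t\<^sup>2 * Q x / 2))
          - exp (- (t\<^sup>2 * v / 2))\<bar>"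
        unfolding L_def by (simp flip: of_real_diff)
      also have "\<dots> \<le> \<bar>t\<^sup>2 * Q x / 2 - t\<^sup>2 * v / 2\<bar>"
        using QK[of x] v0 by (intro abs_exp_minus_diff_le) auto
      also have "\<dots> = \<bar>t\<^sup>2 / 2 * (Q x - v)\<bar>" by (simp add: right_diff_distrib)
      also have "\<dots> = t\<^sup>2 / 2 * \<bar>Q x - v\<bar>" unfolding abs_mult by simp
      finally have 2: "norm ((\<Prod>j<n. complex_of_real (exp (- ((y j x)\<^sup>2 / 2)))) - L) \<le> t\<^sup>2 / 2 * \<bar>Q x - v\<bar>" .
      show ?thesis using norm_triangle_le[OF add_mono[OF 1 2]] by simp
    qed
    have intP: "integrable M P" by (rule integrable_of_bounded[OF _ PB]) simp
    have intPW: "integrable M (\<lambda>x. P x * W x)"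
    proof (rule integrable_of_bounded[of _ "B * 1"])
      show "norm (P x * W x) \<le> B * 1" for x
        unfolding norm_mult by (intro mult_mono PB WB order_trans[OF norm_ge_zero PB]) simp
    qed simp
    have intQ: "integrable M (\<lambda>x. \<bar>Q x - v\<bar>)"
    proof (rule integrable_of_bounded[of _ "K\<^sup>2 + v"])
      show "norm \<bar>Q x - v\<bar> \<le> K\<^sup>2 + v" for x using QK[of x] v0 by simp
    qed simp
    \<comment> \<open>Since \<open>P\<close> has mean \<open>1\<close>, the constant
      \<open>L\<close> is the integral of \<open>P * L\<close>, and the error becomes the integral
      of \<open>P * (W - L)\<close>.\<close>
    have "(\<integral>x. P x \<partial>M) = 1" unfolding P_def y_def by (rule bounded_martingale_diff_product[OF e])
    then have "(\<integral>x. iexp (t * (birkhoff_sum n e x / sqrt n)) \<partial>M) - L = (\<integral>x. P x * W x - P x * L \<partial>M)"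
      unfolding PW using intP intPW by simp
    also have "\<dots> = (\<integral>x. P x * (W x - L) \<partial>M)" by (simp add: right_diff_distrib)
    also have "norm \<dots> \<le> (\<integral>x. norm (P x * (W x - L)) \<partial>M)" by (rule integral_norm_bound)
    also have "\<dots> \<le> (\<integral>x. B * (2 * \<bar>t\<bar> ^ 3 * K ^ 3 * (1 / sqrt n) + t\<^sup>2 / 2 * \<bar>Q x - v\<bar>) \<partial>M)"
    proof (rule integral_mono)
      show "integrable M (\<lambda>x. norm (P x * (W x - L)))"
        using intP intPW by (simp add: right_diff_distrib)
      show "norm (P x * (W x - L)) \<le> B * (2 * \<bar>t\<bar> ^ 3 * K ^ 3 * (1 / sqrt n) + t\<^sup>2 / 2 * \<bar>Q x - v\<bar>)" for x
        unfolding norm_mult by (intro mult_mono PB WL order_trans[OF norm_ge_zero PB]) simp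
    qed (use intQ in simp)
    also have "\<dots> = B * (2 * \<bar>t\<bar> ^ 3 * K ^ 3 * (1 / sqrt n) + t\<^sup>2 / 2 * q n)"
      using intQ by (simp add: prob_space q_def Q_def)
    finally show ?thesis .
  qed
  have "(\<lambda>n. B * (2 * \<bar>t\<bar> ^ 3 * K ^ 3 * (1 / sqrt n) + t\<^sup>2 / 2 * q n)) \<longlonglongrightarrow> B * (2 * \<bar>t\<bar> ^ 3 * K ^ 3 * 0 +
      t\<^sup>2 / 2 * 0)"
    by (intro tendsto_add tendsto_mult tendsto_const q_lim inv_sqrt)
  then have lim: "(\<lambda>n. B * (2 * \<bar>t\<bar> ^ 3 * K ^ 3 * (1 / sqrt n) + t\<^sup>2 / 2 * q n)) \<longlonglongrightarrow> 0" by simp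
  have "(\<lambda>n. (\<integral>x. iexp (t * (birkhoff_sum n e x / sqrt n)) \<partial>M) - L) \<longlonglongrightarrow> 0"
  proof (rule Lim_null_comparison[OF eventually_sequentiallyI[of 1] lim])
    fix n :: nat assume "1 \<le> n"
    then show "norm ((\<integral>x. iexp (t * (birkhoff_sum n e x / sqrt n)) \<partial>M) - L) \<le> B * (2 * \<bar>t\<bar> ^ 3 * K ^ 3 *
        (1 / sqrt n) + t\<^sup>2 / 2 * q n)"
      by (intro main) simp
  qed
  then show ?thesis unfolding L_def v_def by (rule Lim_null[THEN iffD2])
qed

section \<open>Martingale approximation\<close>

lemma (in prob_space) integrable_iexp_real:
  assumes "h \<in> borel_measurable M" shows "integrable M (\<lambda>x. iexp (h x))"
  using assms by (intro integrable_of_bounded[of _ 1]) auto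

lemma norm_iexp_diff_le: "norm (iexp a - iexp b) \<le> \<bar>a - b\<bar>"
proof -
  have "iexp a - iexp b = iexp b * (iexp (a - b) - 1)" by (simp add: algebra_simps flip: exp_add)
  also have "norm \<dots> = norm (iexp (a - b) - 1)" by (simp add: norm_mult)
  also have "\<dots> \<le> \<bar>a - b\<bar>" using iexp_approx1[of "a - b" 0] by simp
  finally show ?thesis .
qed

text \<open>Two successive limits: \<open>u\<close> may depend on \<epsilon> and tends to
  \<open>0\<close> for fixed \<epsilon>; the remaining error \<open>f \<epsilon>\<close> disappears
  afterwards as \<epsilon> decreases to \<open>0\<close>.\<close>

lemma LIMSEQ_by_approximation:
  fixes a :: "nat \<Rightarrow> 'b::real_normed_vector" and f :: "real \<Rightarrow> real"
  assumes f: "(f \<longlongrightarrow> 0) (at_right 0)"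
    and approx: "\<And>\<epsilon>. \<epsilon> > 0 \<Longrightarrow> \<exists>u. u \<longlonglongrightarrow> 0 \<and> (\<forall>\<^sub>F n in sequentially. norm (a n - L) \<le> u n + f \<epsilon>)"
  shows "a \<longlonglongrightarrow> L"
proof (rule tendstoI)
  fix \<delta> :: real assume \<delta>: "\<delta> > 0"
  have "\<forall>\<^sub>F \<epsilon> in at_right 0. f \<epsilon> < \<delta> / 2 \<and> \<epsilon> > 0"
    using \<delta> by (intro eventually_conj order_tendstoD(2)[OF f] eventually_at_right_less) simp
  then obtain \<epsilon> where \<epsilon>: "f \<epsilon> < \<delta> / 2" "\<epsilon> > 0"
    using eventually_happens'[OF trivial_limit_at_right_real] by blast
  obtain u where u: "u \<longlonglongrightarrow> 0" "\<forall>\<^sub>F n in sequentially. norm (a n - L) \<le> u n + f \<epsilon>"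
    using approx[OF \<epsilon>(2)] by blast
  have "\<forall>\<^sub>F n in sequentially. u n < \<delta> / 2" using \<delta> by (intro order_tendstoD(2)[OF u(1)]) simp
  with u(2) show "\<forall>\<^sub>F n in sequentially. dist (a n) L < \<delta>"
    by eventually_elim (use \<epsilon> in \<open>simp add: dist_norm\<close>)
qed

text \<open>This is all that the central limit theorem and the block statistics need to know about
  partial sums. The bound \<open>K\<close> may explode as \<epsilon> tends to \<open>0\<close>; it
  is only used at fixed \<epsilon>.\<close>

definition (in filtered_system) martingale_approx :: "(nat \<Rightarrow> 'a \<Rightarrow> real) \<Rightarrow> real \<Rightarrow> bool" where
  "martingale_approx Y v \<longleftrightarrow>
     (\<forall>n. Y n \<in> borel_measurable M \<and> integrable M (\<lambda>x. (Y n x)\<^sup>2)) \<and>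
     (\<forall>\<epsilon>>0. \<exists>e K. bounded_martingale_diff e K \<and> \<bar>(\<integral>x. (e x)\<^sup>2 \<partial>M) - v\<bar> \<le> \<epsilon> \<and>
        (\<forall>\<^sub>F n in sequentially. (\<integral>x. (Y n x - birkhoff_sum n e x)\<^sup>2 \<partial>M) \<le> \<epsilon> * n))"

lemma (in filtered_system) martingale_approxD:
  assumes "martingale_approx Y v"
  shows "Y n \<in> borel_measurable M" "integrable M (\<lambda>x. (Y n x)\<^sup>2)"
  using assms by (auto simp: martingale_approx_def)

lemma (in filtered_system) martingale_approxE:
  assumes "martingale_approx Y v" "\<epsilon> > 0"
  obtains e K where "bounded_martingale_diff e K" "\<bar>(\<integral>x. (e x)\<^sup>2 \<partial>M) - v\<bar> \<le> \<epsilon>"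
    "\<forall>\<^sub>F n in sequentially. (\<integral>x. (Y n x - birkhoff_sum n e x)\<^sup>2 \<partial>M) \<le> \<epsilon> * n"
  using assms unfolding martingale_approx_def by blast

lemma (in filtered_system) martingale_approx_nonneg:
  assumes "martingale_approx Y v" shows "v \<ge> 0"
proof (rule field_le_epsilon)
  fix \<epsilon> :: real assume "\<epsilon> > 0"
  then obtain e K where "bounded_martingale_diff e K" "\<bar>(\<integral>x. (e x)\<^sup>2 \<partial>M) - v\<bar> \<le> \<epsilon>"
    using martingale_approxE[OF assms] by blast
  then show "0 \<le> v + \<epsilon>" using bounded_martingale_diffD(8)[of e K] by linarith
qed

text \<open>In the error, \<open>\<bar>t\<bar> * sqrt \<epsilon>\<close> is the cost of replacing
  \<open>Y n\<close> by the bounded martingale, \<open>\<bar>t\<bar> / sqrt n\<close> times a first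
  moment of at most \<open>sqrt (\<epsilon> * n)\<close>. The term
  \<open>t^2 / 2 * \<epsilon>\<close> is the cost of replacing its variance by
  \<open>v\<close>.\<close>

theorem (in ergodic_system) martingale_approx_clt:
  assumes Y: "martingale_approx Y v"
  shows "(\<lambda>n. \<integral>x. iexp (t * (Y n x / sqrt n)) \<partial>M) \<longlonglongrightarrow> exp (- (t\<^sup>2 * v / 2))"
proof (rule LIMSEQ_by_approximation[where f = "\<lambda>\<epsilon>. \<bar>t\<bar> * sqrt \<epsilon> + t\<^sup>2 / 2 * \<epsilon>"])
  note [measurable] = martingale_approxD(1)[OF Y]
  have "((\<lambda>\<epsilon>. \<bar>t\<bar> * sqrt \<epsilon> + t\<^sup>2 / 2 * \<epsilon>) \<longlongrightarrow> \<bar>t\<bar> * sqrt 0 + t\<^sup>2 / 2 * 0) (at_right 0)"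
    by (intro tendsto_intros)
  then show "((\<lambda>\<epsilon>. \<bar>t\<bar> * sqrt \<epsilon> + t\<^sup>2 / 2 * \<epsilon>) \<longlongrightarrow> 0) (at_right 0)" by simp
  fix \<epsilon> :: real assume \<epsilon>: "\<epsilon> > 0"
  obtain e K where e: "bounded_martingale_diff e K" and v: "\<bar>(\<integral>x. (e x)\<^sup>2 \<partial>M) - v\<bar> \<le> \<epsilon>"
    and ev: "\<forall>\<^sub>F n in sequentially. (\<integral>x. (Y n x - birkhoff_sum n e x)\<^sup>2 \<partial>M) \<le> \<epsilon> * n"
    using martingale_approxE[OF Y \<epsilon>] .
  note b = bounded_martingale_diffD[OF e]
  note [measurable] = b(4)
  define w where "w = (\<integral>x. (e x)\<^sup>2 \<partial>M)"
  define u where "u n = norm ((\<integral>x. iexp (t * (birkhoff_sum n e x / sqrt n)) \<partial>M) - complex_of_real (exp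
      (- (t\<^sup>2 * w / 2))))" for n :: nat
  have "u \<longlonglongrightarrow> 0" unfolding u_def w_def
    using bounded_martingale_diff_clt[OF e, of t] by (intro tendsto_norm_zero) (simp add: LIM_zero)
  moreover have "\<forall>\<^sub>F n in sequentially. norm ((\<integral>x. iexp (t * (Y n x / sqrt n)) \<partial>M) - complex_of_real
      (exp (- (t\<^sup>2 * v / 2))))
     \<le> u n + (\<bar>t\<bar> * sqrt \<epsilon> + t\<^sup>2 / 2 * \<epsilon>)"
    using ev eventually_gt_at_top[of 0]
  proof eventually_elim
    case (elim n)
    have d2: "integrable M (\<lambda>x. (Y n x - birkhoff_sum n e x)\<^sup>2)"
      by (intro integrable_square_diff birkhoff_sum_square_integrable martingale_approxD(2)[OF Y] b) measurable
    note d = abs_expectation_le_sqrt[OF _ d2]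
    have "norm ((\<integral>x. iexp (t * (Y n x / sqrt n)) \<partial>M) - (\<integral>x. iexp (t * (birkhoff_sum n e x / sqrt n)) \<partial>M))
       = norm (\<integral>x. iexp (t * (Y n x / sqrt n)) - iexp (t * (birkhoff_sum n e x / sqrt n)) \<partial>M)"
      by (rule arg_cong[where f = norm], rule Bochner_Integration.integral_diff[symmetric]; rule
          integrable_iexp_real; measurable)
    also have "\<dots> \<le> (\<integral>x. norm (iexp (t * (Y n x / sqrt n)) - iexp (t * (birkhoff_sum n e x / sqrt n))) \<partial>M)"
      by (rule integral_norm_bound)
    also have "\<dots> \<le> (\<integral>x. \<bar>t\<bar> / sqrt n * \<bar>Y n x - birkhoff_sum n e x\<bar> \<partial>M)"
    proof (rule integral_mono)
      show "norm (iexp (t * (Y n x / sqrt n)) - iexp (t * (birkhoff_sum n e x / sqrt n))) \<le> \<bar>t\<bar> / sqrt n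
          * \<bar>Y n x - birkhoff_sum n e x\<bar>" for x
      proof -
        have "t * (Y n x / sqrt n) - t * (birkhoff_sum n e x / sqrt n) = t / sqrt n * (Y n x -
            birkhoff_sum n e x)"
          by (simp add: right_diff_distrib)
        then show ?thesis using norm_iexp_diff_le[of "t * (Y n x / sqrt n)" "t * (birkhoff_sum n e x / sqrt n)"]
          by (simp only: abs_mult abs_divide abs_of_nonneg[OF real_sqrt_ge_zero[OF of_nat_0_le_iff]])
      qed
      show "integrable M (\<lambda>x. norm (iexp (t * (Y n x / sqrt n)) - iexp (t * (birkhoff_sum n e x / sqrt n))))"
        by (rule integrable_norm, rule Bochner_Integration.integrable_diff; rule integrable_iexp_real;
            measurable)
      show "integrable M (\<lambda>x. \<bar>t\<bar> / sqrt n * \<bar>Y n x - birkhoff_sum n e x\<bar>)"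
        by (intro integrable_mult_right integrable_abs d(1)) simp
    qed
    also have "\<dots> = \<bar>t\<bar> / sqrt n * (\<integral>x. \<bar>Y n x - birkhoff_sum n e x\<bar> \<partial>M)" by simp
    also have "\<dots> \<le> \<bar>t\<bar> / sqrt n * sqrt (\<epsilon> * real n)"
    proof (rule mult_left_mono)
      have "(\<integral>x. \<bar>Y n x - birkhoff_sum n e x\<bar> \<partial>M) \<le> sqrt (\<integral>x. (Y n x - birkhoff_sum n e x)\<^sup>2 \<partial>M)" by
          (rule d(2)) simp
      also have "\<dots> \<le> sqrt (\<epsilon> * real n)" using elim(1) by simp
      finally show "(\<integral>x. \<bar>Y n x - birkhoff_sum n e x\<bar> \<partial>M) \<le> sqrt (\<epsilon> * real n)" .
    qed simp
    also have "\<dots> = \<bar>t\<bar> * sqrt \<epsilon>" using elim(2) by (simp add: real_sqrt_mult)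
    finally have 1: "norm ((\<integral>x. iexp (t * (Y n x / sqrt n)) \<partial>M) - (\<integral>x. iexp (t * (birkhoff_sum n e x /
        sqrt n)) \<partial>M)) \<le> \<bar>t\<bar> * sqrt \<epsilon>" .
    have "norm (complex_of_real (exp (- (t\<^sup>2 * w / 2))) - complex_of_real (exp (- (t\<^sup>2 * v / 2)))) =
        \<bar>exp (- (t\<^sup>2 * w / 2)) - exp (- (t\<^sup>2 * v / 2))\<bar>"
      by (simp flip: of_real_diff)
    also have "\<dots> \<le> \<bar>t\<^sup>2 * w / 2 - t\<^sup>2 * v / 2\<bar>"
      using b(8) martingale_approx_nonneg[OF Y] by (intro abs_exp_minus_diff_le) (auto simp: w_def)
    also have "\<dots> = \<bar>t\<^sup>2 / 2 * (w - v)\<bar>" by (simp add: right_diff_distrib)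
    also have "\<dots> \<le> t\<^sup>2 / 2 * \<epsilon>" unfolding abs_mult using v by (intro mult_mono) (auto simp: w_def)
    finally have 2: "norm (complex_of_real (exp (- (t\<^sup>2 * w / 2))) - complex_of_real (exp (- (t\<^sup>2 * v /
        2)))) \<le> t\<^sup>2 / 2 * \<epsilon>" .
    have tri: "norm (p - q) \<le> norm (p1 - q1) + (x + y)" if "norm (p - p1) \<le> x" "norm (q1 - q) \<le> y" for p
        q p1 q1 :: complex and x y
    proof -
      have "(p - p1) + (p1 - q) = p - q" "(p1 - q1) + (q1 - q) = p1 - q" by simp_all
      then show ?thesis
        using norm_triangle_ineq[of "p - p1" "p1 - q"] norm_triangle_ineq[of "p1 - q1" "q1 - q"] that by simp
    qed
    show ?case unfolding u_def by (rule tri[OF 1 2])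
  qed
  ultimately show "\<exists>u. u \<longlonglongrightarrow> 0 \<and> (\<forall>\<^sub>F n in sequentially. norm ((\<integral>x. iexp (t * (Y n x / sqrt n)) \<partial>M) -
      complex_of_real (exp (- (t\<^sup>2 * v / 2))))
     \<le> u n + (\<bar>t\<bar> * sqrt \<epsilon> + t\<^sup>2 / 2 * \<epsilon>))" by blast
qed

section \<open>Squares of overlapping block sums of bounded martingale differences\<close>

context filtered_system
begin

lemma birkhoff_sum_integral:
  assumes "integrable M g"
  shows "integrable M (birkhoff_sum n g)" "(\<integral>x. birkhoff_sum n g x \<partial>M) = n * (\<integral>x. g x \<partial>M)"
proof -
  have [measurable]: "g \<in> borel_measurable M" using assms by simp
  show "integrable M (birkhoff_sum n g)" unfolding birkhoff_sum_def by (intro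
      Bochner_Integration.integrable_sum integrable_shift assms)
  show "(\<integral>x. birkhoff_sum n g x \<partial>M) = n * (\<integral>x. g x \<partial>M)"
    unfolding birkhoff_sum_def by (subst Bochner_Integration.integral_sum) (auto intro!:
        integrable_shift assms simp: integral_shift)
qed

text \<open>Off-diagonal products are grouped by their larger index \<open>r\<close>, so that each
  group is a factor from the past times one new increment.\<close>

lemma square_birkhoff_sum: "(birkhoff_sum b e x)\<^sup>2 = (\<Sum>r<b. (e ((T ^^ r) x))\<^sup>2 + 2 * (birkhoff_sum r e x
    * e ((T ^^ r) x)))"
  by (induction b) (simp_all add: birkhoff_sum_Suc power2_sum)

text \<open>The past sum is measurable for \<open>filtration r\<close> and can be taken out of the
  conditional expectation. Its second moment is at most \<open>r * K^2\<close>, and the increment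
  contributes another \<open>K^2\<close>.\<close>

lemma bounded_martingale_diff_cross_terms:
  assumes e: "bounded_martingale_diff e K"
  shows "martingale_diff r (\<lambda>x. birkhoff_sum r e x * e ((T ^^ r) x))"
    and "(\<integral>x. (birkhoff_sum r e x * e ((T ^^ r) x))\<^sup>2 \<partial>M) \<le> r * K ^ 4"
proof -
  note b = bounded_martingale_diffD[OF e]
  note [measurable] = b(4)
  define D where "D x = e ((T ^^ r) x)" for x
  have mD: "martingale_diff r D" using martingale_diff_shift[OF b(1), of r] unfolding D_def by simp
  note D = martingale_diffD[OF mD]
  note [measurable] = D(2)
  have D2: "(D x)\<^sup>2 \<le> K\<^sup>2" for x unfolding D_def by (rule b(6))
  have SF: "birkhoff_sum r e \<in> borel_measurable (filtration r)" by (rule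
      birkhoff_sum_measurable_filtration[OF martingale_diffD(1)[OF b(1)]]) simp
  have S2: "integrable M (\<lambda>x. (birkhoff_sum r e x)\<^sup>2)" by (intro birkhoff_sum_square_integrable b(5)) simp
  have pt: "(birkhoff_sum r e x * D x)\<^sup>2 \<le> (birkhoff_sum r e x)\<^sup>2 * K\<^sup>2" for x
    unfolding power_mult_distrib by (intro mult_left_mono D2) simp
  have int: "integrable M (\<lambda>x. (birkhoff_sum r e x * D x)\<^sup>2)"
    using pt by (intro Bochner_Integration.integrable_bound[OF integrable_mult_left[OF S2, of "K\<^sup>2"]]) auto
  interpret r: sigma_finite_subalgebra M "filtration r" by (rule sigma_finite_filtration)
  have "AE x in M. real_cond_exp M (filtration r) (\<lambda>x. birkhoff_sum r e x * D x) x = birkhoff_sum r e x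
      * real_cond_exp M (filtration r) D x"
    by (rule r.real_cond_exp_mult[OF SF D(2) abs_expectation_le_sqrt(1)[OF _ int]]) simp
  then have "AE x in M. real_cond_exp M (filtration r) (\<lambda>x. birkhoff_sum r e x * D x) x = 0"
    using D(5) by eventually_elim simp
  then have "martingale_diff r (\<lambda>x. birkhoff_sum r e x * D x)"
    unfolding martingale_diff_def using int D(1) measurable_filtration_mono[OF SF, of "Suc r"] by auto
  then show "martingale_diff r (\<lambda>x. birkhoff_sum r e x * e ((T ^^ r) x))" by (simp add: D_def)
  have "(\<integral>x. (birkhoff_sum r e x * D x)\<^sup>2 \<partial>M) \<le> (\<integral>x. (birkhoff_sum r e x)\<^sup>2 * K\<^sup>2 \<partial>M)"
    using int S2 pt by (intro integral_mono) auto
  also have "\<dots> = (r * (\<integral>x. (e x)\<^sup>2 \<partial>M)) * K\<^sup>2" by (simp add: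
      martingale_diff_birkhoff_sum_second_moment[OF b(1)])
  also have "\<dots> \<le> (r * K\<^sup>2) * K\<^sup>2" by (intro mult_right_mono mult_left_mono b(7)) auto
  finally show "(\<integral>x. (birkhoff_sum r e x * e ((T ^^ r) x))\<^sup>2 \<partial>M) \<le> r * K ^ 4"
    by (simp add: D_def power2_eq_square power4_eq_xxxx)
qed

text \<open>For fixed lag \<open>r\<close> the cross terms \<open>S\<^sub>r \<cdot> e \<circ> T\<^sup>r\<close>, summed along the orbit, form a martingale again.
  This is why only \<open>b = o(N)\<close> is needed.\<close>

lemma bounded_martingale_diff_block_variance:
  assumes e: "bounded_martingale_diff e K" and b0: "b > 0" and N0: "N > 0"
  defines "w \<equiv> \<integral>x. (e x)\<^sup>2 \<partial>M"
  shows "(\<integral>x. \<bar>birkhoff_sum N (\<lambda>x. (birkhoff_sum b e x)\<^sup>2 / b) x / N - w\<bar> \<partial>M)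
     \<le> (\<integral>x. \<bar>birkhoff_sum N (\<lambda>x. (e x)\<^sup>2) x / N - w\<bar> \<partial>M) + 2 * K\<^sup>2 * sqrt (b / N)"
proof -
  note b = bounded_martingale_diffD[OF e]
  note [measurable] = b(4)
  define g where "g r x = birkhoff_sum r e x * e ((T ^^ r) x)" for r x
  define a where "a x = \<bar>birkhoff_sum N (\<lambda>x. (e x)\<^sup>2) x / N - w\<bar>" for x
  note g = bounded_martingale_diff_cross_terms[OF e, folded g_def]
  have [measurable]: "g r \<in> borel_measurable M" for r by (rule martingale_diffD(2)[OF g(1)])
  have [measurable]: "a \<in> borel_measurable M" unfolding a_def by measurable
  have int_e2: "integrable M (birkhoff_sum N (\<lambda>x. (e x)\<^sup>2))" by (rule birkhoff_sum_integral(1)[OF b(5)])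
  have int_a: "integrable M a" unfolding a_def using int_e2 by simp
  have Sg2: "integrable M (\<lambda>x. (birkhoff_sum N (g r) x)\<^sup>2)" for r
    by (intro birkhoff_sum_square_integrable martingale_diffD(3)[OF g(1)]) simp
  note Sg = abs_expectation_le_sqrt[OF _ Sg2]
  have Sg_le: "(\<integral>x. \<bar>birkhoff_sum N (g r) x\<bar> \<partial>M) \<le> K\<^sup>2 * sqrt (real N * real b)" if "r < b" for r
  proof -
    have "(\<integral>x. (birkhoff_sum N (g r) x)\<^sup>2 \<partial>M) \<le> N * (r * K ^ 4)"
      unfolding martingale_diff_birkhoff_sum_second_moment[OF g(1)] by (intro mult_left_mono g(2)) simp
    also have "\<dots> \<le> N * (b * K ^ 4)" using that by (intro mult_left_mono mult_right_mono) auto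
    also have "\<dots> = (K\<^sup>2)\<^sup>2 * (real N * real b)" by simp
    finally have "sqrt (\<integral>x. (birkhoff_sum N (g r) x)\<^sup>2 \<partial>M) \<le> sqrt ((K\<^sup>2)\<^sup>2 * (real N * real b))" by
        (rule real_sqrt_le_mono)
    also have "\<dots> = K\<^sup>2 * sqrt (real N * real b)" by (simp only: real_sqrt_mult[of "(K\<^sup>2)\<^sup>2"]
        real_sqrt_abs abs_power2)
    finally show ?thesis using Sg(2)[of r] by simp
  qed
  \<comment> \<open>Exchanging the two sums gives, for each position \<open>r\<close> in the block,
    an orbit average of \<open>e^2\<close> started at \<open>(T ^^ r) x\<close> and an orbit sum of
    the cross terms of lag \<open>r\<close>.\<close>
  have dec: "birkhoff_sum N (\<lambda>x. (birkhoff_sum b e x)\<^sup>2 / b) x / N - w =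
      (\<Sum>r<b. (birkhoff_sum N (\<lambda>x. (e x)\<^sup>2) ((T ^^ r) x) / N - w) + 2 / N * birkhoff_sum N (g r) x) / b" for x
  proof -
    have "birkhoff_sum N (\<lambda>x. (birkhoff_sum b e x)\<^sup>2 / b) x
        = (\<Sum>i<N. \<Sum>r<b. ((e ((T ^^ r) ((T ^^ i) x)))\<^sup>2 + 2 * g r ((T ^^ i) x)) / b)"
      unfolding square_birkhoff_sum g_def[symmetric] by (simp only: birkhoff_sum_def[of N] sum_divide_distrib)
    also have "\<dots> = (\<Sum>r<b. \<Sum>i<N. ((e ((T ^^ i) ((T ^^ r) x)))\<^sup>2 + 2 * g r ((T ^^ i) x)) / b)"
      by (subst sum.swap) (simp only: iterate_iterate add.commute)
    also have "\<dots> = (\<Sum>r<b. birkhoff_sum N (\<lambda>x. (e x)\<^sup>2) ((T ^^ r) x) + 2 * birkhoff_sum N (g r) x) / b"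
      by (simp only: birkhoff_sum_def[of N] sum.distrib sum_distrib_left sum_divide_distrib add_divide_distrib)
    finally have "birkhoff_sum N (\<lambda>x. (birkhoff_sum b e x)\<^sup>2 / b) x = (\<Sum>r<b. birkhoff_sum N (\<lambda>x. (e
        x)\<^sup>2) ((T ^^ r) x) + 2 * birkhoff_sum N (g r) x) / b" .
    moreover have "(\<Sum>r<b. (birkhoff_sum N (\<lambda>x. (e x)\<^sup>2) ((T ^^ r) x) / N - w) + 2 / N * birkhoff_sum N (g r) x)
       = (\<Sum>r<b. birkhoff_sum N (\<lambda>x. (e x)\<^sup>2) ((T ^^ r) x) + 2 * birkhoff_sum N (g r) x) / N - b * w"
      by (simp add: sum.distrib sum_subtractf sum_divide_distrib add_divide_distrib)
    ultimately show ?thesis using b0 by (simp add: diff_divide_distrib mult.commute)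
  qed
  have "(\<integral>x. \<bar>birkhoff_sum N (\<lambda>x. (birkhoff_sum b e x)\<^sup>2 / b) x / N - w\<bar> \<partial>M) \<le>
     (\<integral>x. (\<Sum>r<b. a ((T ^^ r) x) + 2 / N * \<bar>birkhoff_sum N (g r) x\<bar>) / b \<partial>M)"
  proof (rule integral_mono')
    show "integrable M (\<lambda>x. (\<Sum>r<b. a ((T ^^ r) x) + 2 / N * \<bar>birkhoff_sum N (g r) x\<bar>) / b)"
      using Sg(1) by (intro integrable_divide_zero Bochner_Integration.integrable_sum
          Bochner_Integration.integrable_add
        integrable_shift int_a integrable_mult_right integrable_abs) auto
    fix x
    show "\<bar>birkhoff_sum N (\<lambda>x. (birkhoff_sum b e x)\<^sup>2 / b) x / N - w\<bar> \<le> (\<Sum>r<b. a ((T ^^ r) x) + 2 / N *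
        \<bar>birkhoff_sum N (g r) x\<bar>) / b"
      unfolding dec abs_divide abs_of_nat
    proof (intro divide_right_mono order_trans[OF sum_abs sum_mono])
      fix r
      show "\<bar>(birkhoff_sum N (\<lambda>x. (e x)\<^sup>2) ((T ^^ r) x) / N - w) + 2 / N * birkhoff_sum N (g r) x\<bar> \<le> a
          ((T ^^ r) x) + 2 / N * \<bar>birkhoff_sum N (g r) x\<bar>"
        unfolding a_def by (rule order_trans[OF abs_triangle_ineq]) (simp add: abs_mult)
    qed simp
    show "0 \<le> (\<Sum>r<b. a ((T ^^ r) x) + 2 / N * \<bar>birkhoff_sum N (g r) x\<bar>) / b"
      unfolding a_def by (intro divide_nonneg_nonneg sum_nonneg) auto
  qed
  \<comment> \<open>By invariance the starting point \<open>(T ^^ r) x\<close> does not affect the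
    integral of \<open>a\<close>.\<close>
  also have "\<dots> = (\<Sum>r<b. (\<integral>x. a x \<partial>M) + 2 / N * (\<integral>x. \<bar>birkhoff_sum N (g r) x\<bar> \<partial>M)) / b"
    using Sg(1) int_a by (simp add: Bochner_Integration.integral_sum integrable_shift integral_shift)
  also have "\<dots> \<le> (\<Sum>r<b. (\<integral>x. a x \<partial>M) + 2 / N * (K\<^sup>2 * sqrt (real N * real b))) / b"
    by (intro divide_right_mono sum_mono add_left_mono mult_left_mono Sg_le) auto
  also have "\<dots> = (\<integral>x. a x \<partial>M) + 2 / N * (K\<^sup>2 * sqrt (real N * real b))" using b0 by simp
  also have "2 / N * (K\<^sup>2 * sqrt (real N * real b)) = 2 * K\<^sup>2 * sqrt (b / N)"
  proof -
    have "real N * b = (real N)\<^sup>2 * (b / N)" using N0 by (simp add: power2_eq_square)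
    then have "sqrt (real N * real b) = N * sqrt (b / N)"
      by (simp only: real_sqrt_mult[of "(real N)\<^sup>2"] real_sqrt_abs abs_of_nat)
    then show ?thesis using N0 by simp
  qed
  finally show ?thesis unfolding a_def .
qed

end

section \<open>Block statistics\<close>

text \<open>In \<open>y^2 - s^2 = (y - s)^2 + 2 * s * (y - s)\<close> the product is split by the
  weighted inequality between arithmetic and geometric mean. Taking \<eta> small makes the price in
  \<open>s^2\<close> small when \<open>y - s\<close> is smaller still.\<close>

lemma abs_diff_squares_le:
  fixes y s \<eta> :: real assumes "\<eta> > 0"
  shows "\<bar>y\<^sup>2 - s\<^sup>2\<bar> \<le> \<eta> * s\<^sup>2 + (1 + 1 / \<eta>) * (y - s)\<^sup>2"
proof -
  have "2 * (sqrt \<eta> * \<bar>s\<bar>) * (\<bar>y - s\<bar> / sqrt \<eta>) \<le> (sqrt \<eta> * \<bar>s\<bar>)\<^sup>2 + (\<bar>y - s\<bar> / sqrt \<eta>)\<^sup>2"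
    by (rule sum_squares_bound)
  then have *: "2 * \<bar>s\<bar> * \<bar>y - s\<bar> \<le> \<eta> * s\<^sup>2 + (y - s)\<^sup>2 / \<eta>"
    using assms by (simp add: power_mult_distrib power_divide)
  have "y\<^sup>2 - s\<^sup>2 = (y - s)\<^sup>2 + 2 * s * (y - s)" by (simp add: power2_eq_square algebra_simps)
  also have "\<bar>\<dots>\<bar> \<le> (y - s)\<^sup>2 + 2 * \<bar>s\<bar> * \<bar>y - s\<bar>"
    by (rule order_trans[OF abs_triangle_ineq]) (simp add: abs_mult)
  also have "\<dots> \<le> (y - s)\<^sup>2 + (\<eta> * s\<^sup>2 + (y - s)\<^sup>2 / \<eta>)" using * by simp
  also have "\<dots> = \<eta> * s\<^sup>2 + (1 + 1 / \<eta>) * (y - s)\<^sup>2" by (simp add: algebra_simps)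
  finally show ?thesis .
qed

lemma (in filtered_system) martingale_approx_error_square_integrable:
  assumes "martingale_approx Y v" "bounded_martingale_diff e K"
  shows "integrable M (\<lambda>x. (Y n x - birkhoff_sum n e x)\<^sup>2)"
  using martingale_approxD[OF assms(1)] bounded_martingale_diffD(4,5)[OF assms(2)]
  by (intro integrable_square_diff birkhoff_sum_square_integrable) auto

context ergodic_system
begin

text \<open>Replacing \<open>Y\<close> by the bounded martingale changes the block average of
  squares by \<open>h\<close> in mean, uniformly in \<open>N\<close> by invariance. The martingale
  itself is covered by \<open>bounded_martingale_diff_block_variance\<close>.\<close>

lemma block_second_moment_tendsto:
  assumes Y: "martingale_approx Y v"
    and b: "filterlim b at_top sequentially" and N: "filterlim N at_top sequentially"
    and bN: "(\<lambda>n. real (b n) / real (N n)) \<longlonglongrightarrow> 0"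
  shows "(\<lambda>n. \<integral>x. \<bar>birkhoff_sum (N n) (\<lambda>x. (Y (b n) x)\<^sup>2 / b n) x / N n - v\<bar> \<partial>M) \<longlonglongrightarrow> 0"
proof (rule LIMSEQ_by_approximation[where f = "\<lambda>\<epsilon>. sqrt \<epsilon> * (v + \<epsilon>) + (\<epsilon> + sqrt \<epsilon>) + \<epsilon>"])
  note [measurable] = martingale_approxD(1)[OF Y]
  have "((\<lambda>\<epsilon>. sqrt \<epsilon> * (v + \<epsilon>) + (\<epsilon> + sqrt \<epsilon>) + \<epsilon>) \<longlongrightarrow> sqrt 0 * (v + 0) + (0 + sqrt 0) + 0) (at_right 0)"
    by (intro tendsto_intros)
  then show "((\<lambda>\<epsilon>. sqrt \<epsilon> * (v + \<epsilon>) + (\<epsilon> + sqrt \<epsilon>) + \<epsilon>) \<longlongrightarrow> 0) (at_right 0)" by simp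
  fix \<epsilon> :: real assume \<epsilon>: "\<epsilon> > 0"
  obtain e K where e: "bounded_martingale_diff e K" and v: "\<bar>(\<integral>x. (e x)\<^sup>2 \<partial>M) - v\<bar> \<le> \<epsilon>"
    and ev: "\<forall>\<^sub>F n in sequentially. (\<integral>x. (Y n x - birkhoff_sum n e x)\<^sup>2 \<partial>M) \<le> \<epsilon> * n"
    using martingale_approxE[OF Y \<epsilon>] .
  note bm = bounded_martingale_diffD[OF e]
  note [measurable] = bm(4)
  define w where "w = (\<integral>x. (e x)\<^sup>2 \<partial>M)"
  define a where "a n = (\<integral>x. \<bar>birkhoff_sum n (\<lambda>x. (e x)\<^sup>2) x / n - w\<bar> \<partial>M)" for n :: nat
  define u where "u n = a (N n) + 2 * K\<^sup>2 * sqrt (b n / N n)" for n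
  have "a \<longlonglongrightarrow> 0" unfolding a_def[abs_def] w_def
    by (rule mean_ergodic[where C = "K\<^sup>2"]) (use bm(6) in auto)
  from filterlim_compose[OF this N] have "(\<lambda>n. a (N n)) \<longlonglongrightarrow> 0" .
  then have "u \<longlonglongrightarrow> 0 + 2 * K\<^sup>2 * sqrt 0" unfolding u_def
    by (intro tendsto_intros bN)
  then have u: "u \<longlonglongrightarrow> 0" by simp
  have "\<forall>\<^sub>F n in sequentially. norm ((\<integral>x. \<bar>birkhoff_sum (N n) (\<lambda>x. (Y (b n) x)\<^sup>2 / b n) x / N n - v\<bar> \<partial>M) - 0)
      \<le> u n + (sqrt \<epsilon> * (v + \<epsilon>) + (\<epsilon> + sqrt \<epsilon>) + \<epsilon>)"
    using eventually_compose_filterlim[OF ev b] eventually_compose_filterlim[OF eventually_gt_at_top[of 0] b]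
      eventually_compose_filterlim[OF eventually_gt_at_top[of 0] N]
  proof eventually_elim
    case (elim n)
    let ?b = "b n" and ?N = "N n"
    define y where "y = Y ?b" define s where "s = birkhoff_sum ?b e"
    have [measurable]: "y \<in> borel_measurable M" "s \<in> borel_measurable M" unfolding y_def s_def by measurable
    have y2: "integrable M (\<lambda>x. (y x)\<^sup>2)" unfolding y_def by (rule martingale_approxD(2)[OF Y])
    have s2: "integrable M (\<lambda>x. (s x)\<^sup>2)" unfolding s_def by (intro birkhoff_sum_square_integrable bm)
    have d2: "integrable M (\<lambda>x. (y x - s x)\<^sup>2)" by (intro integrable_square_diff y2 s2) measurable
    define h where "h x = \<bar>(y x)\<^sup>2 - (s x)\<^sup>2\<bar> / ?b" for x
    have h: "integrable M h" unfolding h_def using y2 s2 by simp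
    \<comment> \<open>The weight \<open>sqrt \<epsilon>\<close> balances the two terms: one is of
      order \<open>sqrt \<epsilon>\<close>, the other
      \<open>\<epsilon> + \<epsilon> / sqrt \<epsilon>\<close>.\<close>
    have "(\<integral>x. h x \<partial>M) \<le> (\<integral>x. (sqrt \<epsilon> * (s x)\<^sup>2 + (1 + 1 / sqrt \<epsilon>) * (y x - s x)\<^sup>2) / ?b \<partial>M)"
      unfolding h_def using y2 s2 d2 \<epsilon>
      by (intro integral_mono divide_right_mono abs_diff_squares_le) auto
    also have "\<dots> = (sqrt \<epsilon> * (\<integral>x. (s x)\<^sup>2 \<partial>M) + (1 + 1 / sqrt \<epsilon>) * (\<integral>x. (y x - s x)\<^sup>2 \<partial>M)) / ?b"
      using s2 d2 by simp
    also have "\<dots> \<le> (sqrt \<epsilon> * (?b * w) + (1 + 1 / sqrt \<epsilon>) * (\<epsilon> * ?b)) / ?b"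
      using elim(1) \<epsilon> martingale_diff_birkhoff_sum_second_moment[OF bm(1), of ?b]
      by (intro divide_right_mono add_mono mult_left_mono) (auto simp: s_def y_def w_def)
    also have "\<dots> = sqrt \<epsilon> * w + (\<epsilon> + \<epsilon> / sqrt \<epsilon>)" using elim(2) by (simp add: field_simps)
    also have "\<epsilon> / sqrt \<epsilon> = sqrt \<epsilon>" using \<epsilon> by (simp add: real_div_sqrt)
    also have "sqrt \<epsilon> * w \<le> sqrt \<epsilon> * (v + \<epsilon>)" using v \<epsilon> by (intro mult_left_mono) (auto simp: w_def)
    finally have h_le: "(\<integral>x. h x \<partial>M) \<le> sqrt \<epsilon> * (v + \<epsilon>) + (\<epsilon> + sqrt \<epsilon>)" by simp
    define p where "p x = \<bar>birkhoff_sum ?N (\<lambda>x. (s x)\<^sup>2 / ?b) x / ?N - w\<bar>" for x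
    have p: "integrable M p"
      unfolding p_def using s2 by (intro integrable_abs Bochner_Integration.integrable_diff
          integrable_divide_zero birkhoff_sum_integral(1)) auto
    have "(\<integral>x. \<bar>birkhoff_sum ?N (\<lambda>x. (y x)\<^sup>2 / ?b) x / ?N - v\<bar> \<partial>M) \<le> (\<integral>x. p x + birkhoff_sum ?N h x / ?N
        + \<epsilon> \<partial>M)"
    proof (rule integral_mono)
      show "integrable M (\<lambda>x. \<bar>birkhoff_sum ?N (\<lambda>x. (y x)\<^sup>2 / ?b) x / ?N - v\<bar>)"
        using y2 by (intro integrable_abs Bochner_Integration.integrable_diff integrable_divide_zero
            birkhoff_sum_integral(1)) auto
      show "integrable M (\<lambda>x. p x + birkhoff_sum ?N h x / ?N + \<epsilon>)" using p birkhoff_sum_integral(1)[OF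
          h] by simp
      fix x
      have "birkhoff_sum ?N (\<lambda>x. (y x)\<^sup>2 / ?b) x - birkhoff_sum ?N (\<lambda>x. (s x)\<^sup>2 / ?b) x
         = (\<Sum>i<?N. ((y ((T ^^ i) x))\<^sup>2 - (s ((T ^^ i) x))\<^sup>2) / ?b)"
        unfolding birkhoff_sum_def by (simp add: sum_subtractf diff_divide_distrib)
      also have "\<bar>\<dots>\<bar> \<le> birkhoff_sum ?N h x"
        unfolding birkhoff_sum_def h_def by (rule order_trans[OF sum_abs]) (simp add: abs_divide)
      finally have "\<bar>birkhoff_sum ?N (\<lambda>x. (y x)\<^sup>2 / ?b) x - birkhoff_sum ?N (\<lambda>x. (s x)\<^sup>2 / ?b) x\<bar> / ?N \<le>
          birkhoff_sum ?N h x / ?N"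
        by (intro divide_right_mono) auto
      then have "\<bar>birkhoff_sum ?N (\<lambda>x. (y x)\<^sup>2 / ?b) x / ?N - birkhoff_sum ?N (\<lambda>x. (s x)\<^sup>2 / ?b) x / ?N\<bar>
          \<le> birkhoff_sum ?N h x / ?N"
        by (simp add: abs_divide flip: diff_divide_distrib)
      then show "\<bar>birkhoff_sum ?N (\<lambda>x. (y x)\<^sup>2 / ?b) x / ?N - v\<bar> \<le> p x + birkhoff_sum ?N h x / ?N + \<epsilon>"
        using v unfolding p_def w_def by linarith
    qed
    also have "\<dots> = (\<integral>x. p x \<partial>M) + (\<integral>x. h x \<partial>M) + \<epsilon>"
      using p birkhoff_sum_integral[OF h] elim(3) by (simp add: prob_space)
    also have "(\<integral>x. p x \<partial>M) \<le> u n"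
      unfolding p_def u_def a_def s_def w_def by (rule bounded_martingale_diff_block_variance[OF e elim(2,3)])
    finally have "(\<integral>x. \<bar>birkhoff_sum ?N (\<lambda>x. (y x)\<^sup>2 / ?b) x / ?N - v\<bar> \<partial>M) \<le> u n + (sqrt \<epsilon> * (v + \<epsilon>) +
        (\<epsilon> + sqrt \<epsilon>) + \<epsilon>)"
      using h_le by linarith
    moreover have "0 \<le> (\<integral>x. \<bar>birkhoff_sum ?N (\<lambda>x. (y x)\<^sup>2 / ?b) x / ?N - v\<bar> \<partial>M)" by (intro
        integral_nonneg_AE) simp
    ultimately show ?case by (simp add: y_def)
  qed
  with u show "\<exists>u. u \<longlonglongrightarrow> 0 \<and> (\<forall>\<^sub>F n in sequentially. norm ((\<integral>x. \<bar>birkhoff_sum (N n) (\<lambda>x. (Y (b n) x)\<^sup>2 / b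
      n) x / N n - v\<bar> \<partial>M) - 0)
      \<le> u n + (sqrt \<epsilon> * (v + \<epsilon>) + (\<epsilon> + sqrt \<epsilon>) + \<epsilon>))" by blast
qed

text \<open>The approximation with \<epsilon> equal to \<open>1\<close> already gives linear
  growth.\<close>

lemma martingale_approx_second_moment_growth:
  assumes Y: "martingale_approx Y v"
  shows "\<exists>C::real. \<forall>\<^sub>F n in sequentially. (\<integral>x. (Y n x)\<^sup>2 \<partial>M) \<le> C * n"
proof -
  note [measurable] = martingale_approxD(1)[OF Y]
  obtain e K where e: "bounded_martingale_diff e K"
    and ev: "\<forall>\<^sub>F n in sequentially. (\<integral>x. (Y n x - birkhoff_sum n e x)\<^sup>2 \<partial>M) \<le> 1 * real n"
    using martingale_approxE[OF Y zero_less_one] .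
  note bm = bounded_martingale_diffD[OF e]
  have "\<forall>\<^sub>F n in sequentially. (\<integral>x. (Y n x)\<^sup>2 \<partial>M) \<le> (2 + 2 * K\<^sup>2) * n"
    using ev
  proof eventually_elim
    case (elim n)
    have s2: "integrable M (\<lambda>x. (birkhoff_sum n e x)\<^sup>2)" by (intro birkhoff_sum_square_integrable bm)
    note d2 = martingale_approx_error_square_integrable[OF Y e, of n]
    have "(\<integral>x. (Y n x)\<^sup>2 \<partial>M) \<le> (\<integral>x. 2 * (Y n x - birkhoff_sum n e x)\<^sup>2 + 2 * (birkhoff_sum n e x)\<^sup>2 \<partial>M)"
    proof (rule integral_mono)
      show "(Y n x)\<^sup>2 \<le> 2 * (Y n x - birkhoff_sum n e x)\<^sup>2 + 2 * (birkhoff_sum n e x)\<^sup>2" for x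
        using square_add_le[of "Y n x - birkhoff_sum n e x" "birkhoff_sum n e x"] by simp
    qed (use s2 d2 martingale_approxD(2)[OF Y] in auto)
    also have "\<dots> = 2 * (\<integral>x. (Y n x - birkhoff_sum n e x)\<^sup>2 \<partial>M) + 2 * (n * (\<integral>x. (e x)\<^sup>2 \<partial>M))"
      using s2 d2 by (simp add: martingale_diff_birkhoff_sum_second_moment[OF bm(1)])
    also have "\<dots> \<le> 2 * n + 2 * (n * K\<^sup>2)" using elim bm(7) by (intro add_mono mult_left_mono) auto
    finally show ?case by (simp add: algebra_simps)
  qed
  then show ?thesis by blast
qed

text \<open>After exchanging the sums, the block mean is a sum over \<open>r < b\<close> of long
  sums \<open>birkhoff_sum N g\<close> with shifted starting points. Cauchy-Schwarz over
  \<open>r\<close> and invariance bound its mean square by \<open>b / N^2\<close> times that of one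
  long sum, hence by \<open>C * b / N\<close>.\<close>

lemma block_mean_tendsto:
  assumes Y: "martingale_approx (\<lambda>n. birkhoff_sum n g) v" and g: "g \<in> borel_measurable M" "integrable M
      (\<lambda>x. (g x)\<^sup>2)"
    and N: "filterlim N at_top sequentially"
    and bN: "(\<lambda>n. real (b n) / real (N n)) \<longlonglongrightarrow> 0"
  shows "(\<lambda>n. \<integral>x. (birkhoff_sum (N n) (\<lambda>x. birkhoff_sum (b n) g x / sqrt (b n)) x / N n)\<^sup>2 \<partial>M) \<longlonglongrightarrow> 0"
proof -
  note [measurable] = g(1)
  obtain C :: real where C: "\<forall>\<^sub>F n in sequentially. (\<integral>x. (birkhoff_sum n g x)\<^sup>2 \<partial>M) \<le> C * n"
    using martingale_approx_second_moment_growth[OF Y] by blast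
  have lim: "(\<lambda>n. C * (real (b n) / real (N n))) \<longlonglongrightarrow> 0" using tendsto_mult_left[OF bN, of C] by simp
  show ?thesis
  proof (rule Lim_null_comparison[OF _ lim])
    show "\<forall>\<^sub>F n in sequentially. norm (\<integral>x. (birkhoff_sum (N n) (\<lambda>x. birkhoff_sum (b n) g x / sqrt (b n))
        x / N n)\<^sup>2 \<partial>M) \<le> C * (real (b n) / real (N n))"
      using eventually_compose_filterlim[OF C N] eventually_compose_filterlim[OF eventually_gt_at_top[of 0] N]
    proof eventually_elim
      case (elim n)
      let ?b = "b n" and ?N = "N n"
      have s2: "integrable M (\<lambda>x. (birkhoff_sum ?N g x)\<^sup>2)" by (intro birkhoff_sum_square_integrable g)
      have pt: "(birkhoff_sum ?N (\<lambda>x. birkhoff_sum ?b g x / sqrt ?b) x / ?N)\<^sup>2 \<le> birkhoff_sum ?b (\<lambda>x.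
          (birkhoff_sum ?N g x)\<^sup>2) x / (real ?N)\<^sup>2" for x
      proof -
        have "birkhoff_sum ?N (\<lambda>x. birkhoff_sum ?b g x / sqrt ?b) x = (\<Sum>i<?N. \<Sum>r<?b. g ((T ^^ r) ((T ^^
            i) x)) / sqrt ?b)"
          by (simp only: birkhoff_sum_def sum_divide_distrib)
        also have "\<dots> = (\<Sum>r<?b. \<Sum>i<?N. g ((T ^^ i) ((T ^^ r) x)) / sqrt ?b)"
          by (subst sum.swap) (simp only: iterate_iterate add.commute)
        also have "\<dots> = (\<Sum>r<?b. birkhoff_sum ?N g ((T ^^ r) x)) / sqrt ?b"
          by (simp only: birkhoff_sum_def sum_divide_distrib)
        finally have "(birkhoff_sum ?N (\<lambda>x. birkhoff_sum ?b g x / sqrt ?b) x)\<^sup>2 = (\<Sum>r<?b. birkhoff_sum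
            ?N g ((T ^^ r) x))\<^sup>2 / ?b"
          by (simp add: power_divide)
        also have "\<dots> \<le> ((\<Sum>r<?b. (birkhoff_sum ?N g ((T ^^ r) x))\<^sup>2) * ?b) / ?b"
          using sum_squared_le_sum_of_squares[of "\<lambda>r. birkhoff_sum ?N g ((T ^^ r) x)" "{..<?b}"]
          by (intro divide_right_mono) auto
        also have "\<dots> \<le> birkhoff_sum ?b (\<lambda>x. (birkhoff_sum ?N g x)\<^sup>2) x" by (simp add:
            birkhoff_sum_def[of ?b] sum_nonneg)
        finally show ?thesis unfolding power_divide by (intro divide_right_mono) auto
      qed
      have "(\<integral>x. (birkhoff_sum ?N (\<lambda>x. birkhoff_sum ?b g x / sqrt ?b) x / ?N)\<^sup>2 \<partial>M) \<le> (\<integral>x. birkhoff_sum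
          ?b (\<lambda>x. (birkhoff_sum ?N g x)\<^sup>2) x / (real ?N)\<^sup>2 \<partial>M)"
      proof (rule integral_mono')
        show "integrable M (\<lambda>x. birkhoff_sum ?b (\<lambda>x. (birkhoff_sum ?N g x)\<^sup>2) x / (real ?N)\<^sup>2)" using
            birkhoff_sum_integral(1)[OF s2] by simp
        show "0 \<le> birkhoff_sum ?b (\<lambda>x. (birkhoff_sum ?N g x)\<^sup>2) x / (real ?N)\<^sup>2" for x
          unfolding birkhoff_sum_def[of ?b] by (intro divide_nonneg_nonneg sum_nonneg) auto
      qed (rule pt)
      also have "\<dots> = ?b * (\<integral>x. (birkhoff_sum ?N g x)\<^sup>2 \<partial>M) / (real ?N)\<^sup>2" using
          birkhoff_sum_integral(2)[OF s2] by simp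
      also have "\<dots> \<le> ?b * (C * ?N) / (real ?N)\<^sup>2" by (intro divide_right_mono mult_left_mono elim(1)) auto
      also have "\<dots> = C * (real ?b / real ?N)" using elim(2) by (simp add: power2_eq_square)
      finally have "(\<integral>x. (birkhoff_sum ?N (\<lambda>x. birkhoff_sum ?b g x / sqrt ?b) x / ?N)\<^sup>2 \<partial>M) \<le> C * (real
          ?b / real ?N)" .
      moreover have "0 \<le> (\<integral>x. (birkhoff_sum ?N (\<lambda>x. birkhoff_sum ?b g x / sqrt ?b) x / ?N)\<^sup>2 \<partial>M)" by
          (intro integral_nonneg_AE) simp
      ultimately show ?case by simp
    qed
  qed
qed

text \<open>\<open>\<bar>p\<bar> \<le> 1 + p^2\<close> trades the odd power for the second and
  fourth moments, which are controlled for bounded martingales.\<close>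

lemma tail_weight_le_fourth:
  assumes "c > 0" shows "tail_weight c p \<le> (p\<^sup>2 + p ^ 4) / c"
proof -
  have "2 * \<bar>p\<bar> \<le> 1 + p\<^sup>2" using sum_squares_bound[of 1 "\<bar>p\<bar>"] by simp
  then have "\<bar>p\<bar> \<le> 1 + p\<^sup>2" using abs_ge_zero[of p] by linarith
  then have "\<bar>p\<bar> / c \<le> (1 + p\<^sup>2) / c" using assms by (intro divide_right_mono) auto
  then have "p\<^sup>2 * min 1 (\<bar>p\<bar> / c) \<le> p\<^sup>2 * ((1 + p\<^sup>2) / c)" by (intro mult_left_mono) auto
  also have "\<dots> = (p\<^sup>2 + p ^ 4) / c" by (simp add: power2_eq_square power4_eq_xxxx algebra_simps)
  finally show ?thesis by (simp add: tail_weight_def)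
qed

lemma tail_weight_measurable [measurable]: "tail_weight c \<in> borel_measurable borel"
  unfolding tail_weight_def[abs_def] by measurable

text \<open>\<open>tail_weight_add\<close> separates the bounded martingale from the approximation
  error. Fourth moments of order \<open>b^2\<close> make the first part vanish as \<open>c\<close>
  grows; the second has only a second moment, but that is at most \<epsilon> after
  normalization.\<close>

lemma block_tail_tendsto:
  assumes Y: "martingale_approx Y v"
    and b: "filterlim b at_top sequentially" and c: "filterlim c at_top sequentially"
  shows "(\<lambda>n. \<integral>x. tail_weight (c n) (Y (b n) x / sqrt (b n)) \<partial>M) \<longlonglongrightarrow> 0"
proof (rule LIMSEQ_by_approximation[where f = "\<lambda>\<epsilon>. 8 * \<epsilon>"])
  note [measurable] = martingale_approxD(1)[OF Y]
  have "((\<lambda>\<epsilon>. 8 * \<epsilon>) \<longlongrightarrow> 8 * (0::real)) (at_right 0)" by (intro tendsto_intros)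
  then show "((\<lambda>\<epsilon>. 8 * \<epsilon>) \<longlongrightarrow> (0::real)) (at_right 0)" by simp
  fix \<epsilon> :: real assume \<epsilon>: "\<epsilon> > 0"
  obtain e K where e: "bounded_martingale_diff e K"
    and ev: "\<forall>\<^sub>F n in sequentially. (\<integral>x. (Y n x - birkhoff_sum n e x)\<^sup>2 \<partial>M) \<le> \<epsilon> * n"
    using martingale_approxE[OF Y \<epsilon>] .
  note bm = bounded_martingale_diffD[OF e]
  note [measurable] = bm(4)
  define u where "u n = 8 * (K\<^sup>2 + 4 * K ^ 4) * inverse (c n)" for n
  have "u \<longlonglongrightarrow> 8 * (K\<^sup>2 + 4 * K ^ 4) * 0" unfolding u_def
    by (intro tendsto_intros tendsto_inverse_0_at_top[OF c])
  then have u: "u \<longlonglongrightarrow> 0" by simp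
  have "\<forall>\<^sub>F n in sequentially. norm ((\<integral>x. tail_weight (c n) (Y (b n) x / sqrt (b n)) \<partial>M) - 0) \<le> u n + 8 * \<epsilon>"
    using eventually_compose_filterlim[OF ev b] eventually_compose_filterlim[OF eventually_gt_at_top[of 0] b]
      eventually_compose_filterlim[OF eventually_gt_at_top[of 0] c]
  proof eventually_elim
    case (elim n)
    let ?b = "b n" and ?c = "c n"
    define s where "s x = birkhoff_sum ?b e x" for x
    define d where "d x = Y ?b x - s x" for x
    have [measurable]: "s \<in> borel_measurable M" "d \<in> borel_measurable M" unfolding s_def d_def by measurable
    have s2: "integrable M (\<lambda>x. (s x)\<^sup>2)" unfolding s_def by (intro birkhoff_sum_square_integrable bm)
    have s4: "integrable M (\<lambda>x. (s x) ^ 4)"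
    proof (rule integrable_of_bounded[of _ "(?b * K) ^ 4"])
      show "norm ((s x) ^ 4) \<le> (?b * K) ^ 4" for x
        using power_mono[OF birkhoff_sum_abs_le[of e K ?b x, OF bm(2)], of 4] by (simp add: s_def)
    qed simp
    have d2: "integrable M (\<lambda>x. (d x)\<^sup>2)"
      unfolding d_def s_def by (rule martingale_approx_error_square_integrable[OF Y e])
    have pt: "tail_weight ?c (Y ?b x / sqrt ?b) \<le> 8 * (((s x)\<^sup>2 / ?b + s x ^ 4 / (real ?b)\<^sup>2) / ?c + (d
        x)\<^sup>2 / ?b)" for x
    proof -
      have "Y ?b x / sqrt ?b = s x / sqrt ?b + d x / sqrt ?b" by (simp add: d_def diff_divide_distrib)
      then have 1: "tail_weight ?c (Y ?b x / sqrt ?b) \<le> 8 * (tail_weight ?c (s x / sqrt ?b) +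
          tail_weight ?c (d x / sqrt ?b))"
        using tail_weight_add[of ?c "s x / sqrt ?b" "d x / sqrt ?b"] elim(3) by simp
      have 2: "tail_weight ?c (s x / sqrt ?b) \<le> ((s x)\<^sup>2 / ?b + s x ^ 4 / (real ?b)\<^sup>2) / ?c"
      proof -
        have "sqrt (real ?b) ^ 4 = (real ?b)\<^sup>2"
          by (simp add: power2_eq_square power4_eq_xxxx)
        then show ?thesis using tail_weight_le_fourth[OF elim(3), of "s x / sqrt ?b"] by (simp add:
            power_divide)
      qed
      have 3: "tail_weight ?c (d x / sqrt ?b) \<le> (d x)\<^sup>2 / ?b"
        using tail_weight_le_square[of ?c "d x / sqrt ?b"] by (simp add: power_divide)
      show ?thesis by (rule order_trans[OF 1 mult_left_mono[OF add_mono[OF 2 3]]]) simp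
    qed
    have "(\<integral>x. tail_weight ?c (Y ?b x / sqrt ?b) \<partial>M) \<le> (\<integral>x. 8 * (((s x)\<^sup>2 / ?b + s x ^ 4 / (real ?b)\<^sup>2)
        / ?c + (d x)\<^sup>2 / ?b) \<partial>M)"
      using s2 s4 d2 elim(3) pt by (intro integral_mono') auto
    also have "\<dots> = 8 * (((\<integral>x. (s x)\<^sup>2 \<partial>M) / ?b + (\<integral>x. s x ^ 4 \<partial>M) / (real ?b)\<^sup>2) / ?c + (\<integral>x. (d x)\<^sup>2 \<partial>M) / ?b)"
      using s2 s4 d2 by simp
    also have "\<dots> \<le> 8 * ((?b * K\<^sup>2 / ?b + 4 * K ^ 4 * (real ?b)\<^sup>2 / (real ?b)\<^sup>2) / ?c + \<epsilon> * ?b / ?b)"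
      using elim bm(7) bounded_martingale_diff_fourth_moment[OF e, of ?b]
          martingale_diff_birkhoff_sum_second_moment[OF bm(1), of ?b]
      by (intro mult_left_mono add_mono divide_right_mono) (auto simp: s_def d_def intro!: mult_left_mono)
    also have "\<dots> = u n + 8 * \<epsilon>" using elim(2) by (simp add: u_def field_simps)
    finally have "(\<integral>x. tail_weight ?c (Y ?b x / sqrt ?b) \<partial>M) \<le> u n + 8 * \<epsilon>" .
    moreover have "0 \<le> (\<integral>x. tail_weight ?c (Y ?b x / sqrt ?b) \<partial>M)"
      using elim(3) by (intro integral_nonneg_AE) (auto intro!: tail_weight_nonneg)
    ultimately show ?case by simp
  qed
  with u show "\<exists>u. u \<longlonglongrightarrow> 0 \<and> (\<forall>\<^sub>F n in sequentially. norm ((\<integral>x. tail_weight (c n) (Y (b n) x / sqrt (b n))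
      \<partial>M) - 0) \<le> u n + 8 * \<epsilon>)"
    by blast
qed

end

section \<open>Coboundaries and Gordin's decomposition\<close>

lemma Cauchy_Schwarz_integral:
  fixes f g :: "'a \<Rightarrow> real"
  assumes [measurable]: "f \<in> borel_measurable M" "g \<in> borel_measurable M"
    and f2: "integrable M (\<lambda>x. (f x)\<^sup>2)" and g2: "integrable M (\<lambda>x. (g x)\<^sup>2)"
  shows "(\<integral>x. \<bar>f x * g x\<bar> \<partial>M) \<le> sqrt (\<integral>x. (f x)\<^sup>2 \<partial>M) * sqrt (\<integral>x. (g x)\<^sup>2 \<partial>M)"
proof -
  define p q where "p = sqrt (\<integral>x. (f x)\<^sup>2 \<partial>M)" and "q = sqrt (\<integral>x. (g x)\<^sup>2 \<partial>M)"
  have p2: "(\<integral>x. (f x)\<^sup>2 \<partial>M) = p\<^sup>2" and q2: "(\<integral>x. (g x)\<^sup>2 \<partial>M) = q\<^sup>2"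
    unfolding p_def q_def by (auto intro!: real_sqrt_pow2[symmetric] integral_nonneg_AE)
  have pq: "0 \<le> p" "0 \<le> q" unfolding p_def q_def by (auto intro!: integral_nonneg_AE)
  show ?thesis
  proof (cases "p = 0 \<or> q = 0")
    case True
    then have "(AE x in M. (f x)\<^sup>2 = 0) \<or> (AE x in M. (g x)\<^sup>2 = 0)"
      using p2 q2 integral_nonneg_eq_0_iff_AE[OF f2] integral_nonneg_eq_0_iff_AE[OF g2] by auto
    then have "AE x in M. \<bar>f x * g x\<bar> = 0" by (auto elim: eventually_mono)
    then have "(\<integral>x. \<bar>f x * g x\<bar> \<partial>M) = 0" using integral_cong_AE[of "\<lambda>x. \<bar>f x * g x\<bar>" M "\<lambda>x. 0"] by simp
    then show ?thesis using pq by (simp add: p_def q_def)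
  next
    case False
    then have pos: "p > 0" "q > 0" using pq by auto
    have "(\<integral>x. \<bar>f x * g x\<bar> / (p * q) \<partial>M) \<le> (\<integral>x. ((f x)\<^sup>2 / p\<^sup>2 + (g x)\<^sup>2 / q\<^sup>2) / 2 \<partial>M)"
    proof (rule integral_mono)
      show "integrable M (\<lambda>x. \<bar>f x * g x\<bar> / (p * q))" using integrable_mult_of_squares[OF assms] by simp
      show "integrable M (\<lambda>x. ((f x)\<^sup>2 / p\<^sup>2 + (g x)\<^sup>2 / q\<^sup>2) / 2)" using f2 g2 by simp
      show "\<bar>f x * g x\<bar> / (p * q) \<le> ((f x)\<^sup>2 / p\<^sup>2 + (g x)\<^sup>2 / q\<^sup>2) / 2" for x
        using sum_squares_bound[of "\<bar>f x\<bar> / p" "\<bar>g x\<bar> / q"] by (simp add: abs_mult power_divide mult_ac)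
    qed
    also have "\<dots> = 1" using f2 g2 pos by (simp add: p2 q2)
    finally show ?thesis using pos by (simp add: p_def[symmetric] q_def[symmetric] divide_le_eq)
  qed
qed

text \<open>These are the facts that Gordin's series requires: pointwise convergence almost
  everywhere, a square integrable sum, and summable first moments for integration term by
  term.\<close>

lemma (in prob_space) L2_series:
  fixes f :: "nat \<Rightarrow> 'a \<Rightarrow> real"
  assumes [measurable]: "\<And>j. f j \<in> borel_measurable M" and f2: "\<And>j. integrable M (\<lambda>x. (f j x)\<^sup>2)"
    and c: "summable (\<lambda>j. sqrt (\<integral>x. (f j x)\<^sup>2 \<partial>M))"
  shows "AE x in M. summable (\<lambda>j. \<bar>f j x\<bar>)" "integrable M (\<lambda>x. (\<Sum>j. f j x)\<^sup>2)"
    "summable (\<lambda>j. \<integral>x. \<bar>f j x\<bar> \<partial>M)"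
proof -
  define c where "c j = sqrt (\<integral>x. (f j x)\<^sup>2 \<partial>M)" for j
  define A where "A n x = (\<Sum>j<n. \<bar>f j x\<bar>)" for n x
  have c0: "0 \<le> c j" for j unfolding c_def by (auto intro!: integral_nonneg_AE)
  have csum: "summable c" using c unfolding c_def .
  note f1 = abs_expectation_le_sqrt[OF _ f2]
  have f1': "integrable M (f j)" "(\<integral>x. \<bar>f j x\<bar> \<partial>M) \<le> c j" for j unfolding c_def by (intro f1; simp)+
  have I0: "0 \<le> (\<integral>x. \<bar>f j x\<bar> \<partial>M)" for j by (intro integral_nonneg_AE) simp
  show s1: "summable (\<lambda>j. \<integral>x. \<bar>f j x\<bar> \<partial>M)"
    by (rule summable_comparison_test'[OF csum, of 0]) (use f1'(2) I0 in auto)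
  have "(\<integral>\<^sup>+x. (\<Sum>j. ennreal \<bar>f j x\<bar>) \<partial>M) = (\<Sum>j. \<integral>\<^sup>+x. ennreal \<bar>f j x\<bar> \<partial>M)"
    by (rule nn_integral_suminf) simp
  also have "\<dots> = (\<Sum>j. ennreal (\<integral>x. \<bar>f j x\<bar> \<partial>M))"
    using f1'(1) by (intro arg_cong[where f = suminf] ext nn_integral_eq_integral) auto
  also have "\<dots> \<noteq> top" using s1 I0 by (simp add: ennreal_suminf_neq_top)
  finally have "AE x in M. (\<Sum>j. ennreal \<bar>f j x\<bar>) \<noteq> \<infinity>" by (intro nn_integral_noteq_infinite) auto
  then show AEs: "AE x in M. summable (\<lambda>j. \<bar>f j x\<bar>)"
    by eventually_elim (rule summable_suminf_not_top, auto)
  have [measurable]: "A n \<in> borel_measurable M" for n unfolding A_def by measurable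
  have A2: "integrable M (\<lambda>x. (A n x)\<^sup>2)" for n
    unfolding A_def by (intro integrable_square_sum) (auto intro: f2)
  have A0: "0 \<le> (\<integral>x. (A n x)\<^sup>2 \<partial>M)" for n by (intro integral_nonneg_AE) simp
  \<comment> \<open>Minkowski's inequality for the partial sums of the absolute values, by induction
    through Cauchy-Schwarz; monotone convergence then passes to the full sum.\<close>
  have Mink: "sqrt (\<integral>x. (A n x)\<^sup>2 \<partial>M) \<le> (\<Sum>j<n. c j)" for n
  proof (induction n)
    case (Suc n)
    define p where "p = sqrt (\<integral>x. (A n x)\<^sup>2 \<partial>M)"
    have p0: "0 \<le> p" using A0 by (simp add: p_def)
    have Af: "integrable M (\<lambda>x. A n x * \<bar>f n x\<bar>)"
      by (intro integrable_mult_of_squares A2) (auto intro: f2)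
    have "(\<integral>x. A n x * \<bar>f n x\<bar> \<partial>M) \<le> (\<integral>x. \<bar>A n x * \<bar>f n x\<bar>\<bar> \<partial>M)"
      using Af by (intro integral_mono) auto
    also have "\<dots> \<le> p * c n"
      using Cauchy_Schwarz_integral[of "A n" M "\<lambda>x. \<bar>f n x\<bar>"] A2 f2 by (simp add: p_def c_def)
    finally have cs: "(\<integral>x. A n x * \<bar>f n x\<bar> \<partial>M) \<le> p * c n" .
    have "(\<integral>x. (A (Suc n) x)\<^sup>2 \<partial>M) = (\<integral>x. (A n x)\<^sup>2 + (f n x)\<^sup>2 + 2 * (A n x * \<bar>f n x\<bar>) \<partial>M)"
      by (simp add: A_def power2_sum mult.assoc)
    also have "\<dots> = (\<integral>x. (A n x)\<^sup>2 \<partial>M) + (\<integral>x. (f n x)\<^sup>2 \<partial>M) + 2 * (\<integral>x. A n x * \<bar>f n x\<bar> \<partial>M)"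
      using A2 f2 Af by simp
    also have "\<dots> \<le> p\<^sup>2 + (c n)\<^sup>2 + 2 * (p * c n)"
      using cs A0[of n] by (simp add: p_def c_def integral_nonneg_AE)
    also have "\<dots> = (p + c n)\<^sup>2" by (simp add: power2_sum)
    finally have "sqrt (\<integral>x. (A (Suc n) x)\<^sup>2 \<partial>M) \<le> p + c n"
      using p0 c0[of n] by (intro real_le_lsqrt) auto
    then show ?case using Suc by (simp add: p_def)
  qed (simp add: A_def)
  define C where "C = suminf c"
  have bound: "(\<integral>x. (A n x)\<^sup>2 \<partial>M) \<le> C\<^sup>2" for n
  proof -
    have "sqrt (\<integral>x. (A n x)\<^sup>2 \<partial>M) \<le> C"
      using Mink[of n] sum_le_suminf[OF csum, of "{..<n}"] c0 by (simp add: C_def)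
    then show ?thesis by (rule sqrt_le_D)
  qed
  have A_nonneg: "0 \<le> A n x" for n x unfolding A_def by (intro sum_nonneg) simp
  have monoA: "mono (\<lambda>n. (A n x)\<^sup>2)" for x
  proof (rule monoI)
    fix m n :: nat assume "m \<le> n"
    then have "A m x \<le> A n x" unfolding A_def by (intro sum_mono2) auto
    then show "(A m x)\<^sup>2 \<le> (A n x)\<^sup>2" using A_nonneg by (intro power_mono) auto
  qed
  have "incseq (\<lambda>n. \<integral>x. (A n x)\<^sup>2 \<partial>M)"
    using monoA by (intro incseq_SucI integral_mono A2) (auto simp: mono_def)
  from incseq_convergent[OF this, of "C\<^sup>2"] bound obtain l where l: "(\<lambda>n. \<integral>x. (A n x)\<^sup>2 \<partial>M) \<longlonglongrightarrow> l" by blast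
  have "integrable M (\<lambda>x. (\<Sum>j. \<bar>f j x\<bar>)\<^sup>2)"
  proof (rule integrable_monotone_convergence[OF A2 _ _ l])
    show "AE x in M. (\<lambda>n. (A n x)\<^sup>2) \<longlonglongrightarrow> (\<Sum>j. \<bar>f j x\<bar>)\<^sup>2"
      using AEs by eventually_elim (auto simp: A_def intro!: tendsto_power summable_LIMSEQ)
  qed (use monoA in auto)
  then show "integrable M (\<lambda>x. (\<Sum>j. f j x)\<^sup>2)"
  proof (rule Bochner_Integration.integrable_bound)
    show "AE x in M. norm ((\<Sum>j. f j x)\<^sup>2) \<le> norm ((\<Sum>j. \<bar>f j x\<bar>)\<^sup>2)"
      using AEs
    proof eventually_elim
      case (elim x)
      have "\<bar>\<Sum>j. f j x\<bar> \<le> (\<Sum>j. \<bar>f j x\<bar>)" by (rule summable_rabs[OF elim])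
      then have "\<bar>\<Sum>j. f j x\<bar>\<^sup>2 \<le> (\<Sum>j. \<bar>f j x\<bar>)\<^sup>2" by (intro power_mono) auto
      then show ?case by simp
    qed
  qed simp
qed

section \<open>Truncation of martingale differences and removal of coboundaries\<close>

context filtered_system
begin

lemma martingale_diff_diff:
  assumes "martingale_diff j g" "martingale_diff j h" shows "martingale_diff j (\<lambda>x. g x - h x)"
proof -
  note g = martingale_diffD[OF assms(1)] and h = martingale_diffD[OF assms(2)]
  interpret j: sigma_finite_subalgebra M "filtration j" by (rule sigma_finite_filtration)
  have "AE x in M. real_cond_exp M (filtration j) (\<lambda>x. g x - h x) x = 0"
    using j.real_cond_exp_diff[OF g(4) h(4)] g(5) h(5) by eventually_elim simp
  then show ?thesis unfolding martingale_diff_def using g h by (auto intro: integrable_square_diff)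
qed

text \<open>The truncation \<open>t\<close> is recentred by its conditional mean. Recentring is an
  orthogonal projection, so it does not increase the mean square distance to \<open>d\<close>, which
  is itself a martingale difference.\<close>

lemma martingale_diff_truncation_error:
  assumes d: "martingale_diff 0 d" and K: "K \<ge> 0"
  shows "\<exists>e. bounded_martingale_diff e (2 * K) \<and> (\<integral>x. (d x - e x)\<^sup>2 \<partial>M) \<le> (\<integral>x. (if \<bar>d x\<bar> \<le> K then 0 else
      (d x)\<^sup>2) \<partial>M)"
proof -
  note D = martingale_diffD[OF d]
  note [measurable] = D(2)
  interpret F0: sigma_finite_subalgebra M "filtration 0" by (rule sigma_finite_filtration)
  define t where "t x = (if \<bar>d x\<bar> \<le> K then d x else 0)" for x
  define r where "r x = d x - t x" for x
  \<comment> \<open>The conditional expectation lies in \<open>[-K, K]\<close> only almost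
    everywhere; clipping yields the pointwise bound that \<open>bounded_martingale_diff\<close> asks
    for.\<close>
  define h where "h x = max (- K) (min K (real_cond_exp M (filtration 0) t x))" for x
  define e where "e x = t x - h x" for x
  have tF: "t \<in> borel_measurable (filtration (Suc 0))" unfolding t_def using D(1) by measurable
  have hF: "h \<in> borel_measurable (filtration 0)" unfolding h_def by measurable
  have [measurable]: "t \<in> borel_measurable M" "h \<in> borel_measurable M"
    using measurable_filtrationD[OF tF] measurable_filtrationD[OF hF] by auto
  have [measurable]: "r \<in> borel_measurable M" "e \<in> borel_measurable M" unfolding r_def e_def by measurable
  have tK: "\<bar>t x\<bar> \<le> K" for x using K by (simp add: t_def)
  have hK: "\<bar>h x\<bar> \<le> K" for x using K by (auto simp: h_def)
  have eK: "\<bar>e x\<bar> \<le> 2 * K" for x using tK[of x] hK[of x] unfolding e_def by linarith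
  have int: "integrable M t" "integrable M h"
    using tK hK by (auto intro!: integrable_of_bounded[of _ K])
  have e2: "integrable M (\<lambda>x. (e x)\<^sup>2)"
  proof (rule integrable_of_bounded[of _ "(2 * K)\<^sup>2"])
    show "norm ((e x)\<^sup>2) \<le> (2 * K)\<^sup>2" for x using power_mono[OF eK[of x], of 2] by simp
  qed simp
  have "AE x in M. -K \<le> real_cond_exp M (filtration 0) t x" "AE x in M. real_cond_exp M (filtration 0) t x \<le> K"
    using tK by (auto intro!: F0.real_cond_exp_ge_c F0.real_cond_exp_le_c int simp: abs_le_iff minus_le_iff)
  then have h_eq: "AE x in M. h x = real_cond_exp M (filtration 0) t x" by eventually_elim (simp add: h_def)
  have "AE x in M. real_cond_exp M (filtration 0) e x = 0"
    using F0.real_cond_exp_diff[OF int] F0.real_cond_exp_F_meas[OF int(2) hF] h_eq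
    unfolding e_def[abs_def] by eventually_elim simp
  then have e: "martingale_diff 0 e"
    unfolding martingale_diff_def using e2 tF measurable_filtration_mono[OF hF, of "Suc 0"] by (auto
        simp: e_def[abs_def])
  have de: "martingale_diff 0 (\<lambda>x. d x - e x)" by (rule martingale_diff_diff[OF d e])
  note de2 = martingale_diffD(3)[OF de]
  have r2: "integrable M (\<lambda>x. (r x)\<^sup>2)"
    using D(3) by (rule Bochner_Integration.integrable_bound) (auto simp: r_def t_def)
  have hde: "integrable M (\<lambda>x. h x * (d x - e x))"
  proof (rule integrable_mult_of_squares[OF _ _ _ de2])
    show "integrable M (\<lambda>x. (h x)\<^sup>2)"
    proof (rule integrable_of_bounded[of _ "K\<^sup>2"])
      show "norm ((h x)\<^sup>2) \<le> K\<^sup>2" for x using power_mono[OF hK[of x], of 2] by simp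
    qed simp
  qed simp_all
  have rde: "integrable M (\<lambda>x. r x * (d x - e x))"
    by (rule integrable_mult_of_squares[OF _ _ r2 de2]) simp_all
  \<comment> \<open>Here \<open>d - e = r + h\<close>, and \<open>h\<close> belongs to the past, to
    which \<open>d - e\<close> is orthogonal.\<close>
  have "(\<integral>x. (d x - e x)\<^sup>2 \<partial>M) = (\<integral>x. r x * (d x - e x) + h x * (d x - e x) \<partial>M)"
    by (intro Bochner_Integration.integral_cong) (auto simp: r_def e_def power2_eq_square algebra_simps)
  also have "\<dots> = (\<integral>x. r x * (d x - e x) \<partial>M)"
    using rde hde martingale_diff_orthogonal[OF de hF hde] by simp
  also have "\<dots> \<le> (\<integral>x. ((r x)\<^sup>2 + (d x - e x)\<^sup>2) / 2 \<partial>M)"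
  proof (rule integral_mono[OF rde])
    show "r x * (d x - e x) \<le> ((r x)\<^sup>2 + (d x - e x)\<^sup>2) / 2" for x
      using sum_squares_bound[of "r x" "d x - e x"] by simp
  qed (use r2 de2 in simp)
  also have "\<dots> = ((\<integral>x. (r x)\<^sup>2 \<partial>M) + (\<integral>x. (d x - e x)\<^sup>2 \<partial>M)) / 2" using r2 de2 by simp
  finally have "(\<integral>x. (d x - e x)\<^sup>2 \<partial>M) \<le> (\<integral>x. (r x)\<^sup>2 \<partial>M)" by simp
  also have "(\<integral>x. (r x)\<^sup>2 \<partial>M) = (\<integral>x. (if \<bar>d x\<bar> \<le> K then 0 else (d x)\<^sup>2) \<partial>M)"
    by (intro Bochner_Integration.integral_cong) (auto simp: r_def t_def)
  finally show ?thesis using e eK by (auto simp: bounded_martingale_diff_def)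
qed

lemma martingale_diff_bounded_approx:
  assumes d: "martingale_diff 0 d" and \<epsilon>: "\<epsilon> > 0"
  shows "\<exists>e K. bounded_martingale_diff e K \<and> (\<integral>x. (d x - e x)\<^sup>2 \<partial>M) \<le> \<epsilon>"
proof -
  note D = martingale_diffD[OF d]
  note [measurable] = D(2)
  have "(\<lambda>n. \<integral>x. (if \<bar>d x\<bar> \<le> real n then 0 else (d x)\<^sup>2) \<partial>M) \<longlonglongrightarrow> (\<integral>x. 0 \<partial>M)"
  proof (rule integral_dominated_convergence[OF _ _ D(3)])
    show "AE x in M. (\<lambda>n. if \<bar>d x\<bar> \<le> real n then 0 else (d x)\<^sup>2) \<longlonglongrightarrow> 0"
    proof (intro AE_I2 tendsto_eventually)
      fix x
      show "\<forall>\<^sub>F n in sequentially. (if \<bar>d x\<bar> \<le> real n then 0 else (d x)\<^sup>2) = 0"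
        using eventually_compose_filterlim[OF eventually_ge_at_top[of "\<bar>d x\<bar>"] filterlim_real_sequentially]
        by eventually_elim simp
    qed
  qed auto
  then have "\<forall>\<^sub>F n in sequentially. (\<integral>x. (if \<bar>d x\<bar> \<le> real n then 0 else (d x)\<^sup>2) \<partial>M) < \<epsilon>"
    using \<epsilon> by (intro order_tendstoD(2)) auto
  then obtain n where "(\<integral>x. (if \<bar>d x\<bar> \<le> real n then 0 else (d x)\<^sup>2) \<partial>M) < \<epsilon>"
    using eventually_happens'[OF sequentially_bot] by blast
  with martingale_diff_truncation_error[OF d, of "real n"] show ?thesis by (meson less_imp_le
      of_nat_0_le_iff order_trans)
qed

text \<open>The terms with \<open>z\<close> telescope to \<open>z x - z ((T ^^ n) x)\<close>, whose
  second moment is bounded in \<open>n\<close> and hence negligible against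
  \<open>\<epsilon> * n\<close>.\<close>

lemma martingale_approx_coboundary:
  assumes d: "martingale_diff 0 d" and [measurable]: "g \<in> borel_measurable M" "z \<in> borel_measurable M"
    and z2: "integrable M (\<lambda>x. (z x)\<^sup>2)"
    and g: "\<And>x. g x = d x - z (T x) + z x"
  shows "martingale_approx (\<lambda>n. birkhoff_sum n g) (\<integral>x. (d x)\<^sup>2 \<partial>M)"
proof -
  note D = martingale_diffD[OF d]
  note [measurable] = D(2)
  have zn2: "integrable M (\<lambda>x. (z ((T ^^ n) x))\<^sup>2)" for n by (rule integrable_shift[OF z2])
  have g_eq: "g = (\<lambda>x. (d x - z (T x)) + z x)" by (rule ext) (rule g)
  have g2: "integrable M (\<lambda>x. (g x)\<^sup>2)"
    unfolding g_eq using zn2[of 1] by (intro integrable_square_add integrable_square_diff D(3) z2) auto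
  have Sg: "birkhoff_sum n g x = birkhoff_sum n d x + (z x - z ((T ^^ n) x))" for n x
    by (induction n) (simp_all add: birkhoff_sum_Suc g)
  show ?thesis
    unfolding martingale_approx_def
  proof (intro conjI allI impI)
    fix n show "birkhoff_sum n g \<in> borel_measurable M" "integrable M (\<lambda>x. (birkhoff_sum n g x)\<^sup>2)"
      by (auto intro!: birkhoff_sum_square_integrable g2)
  next
    fix \<epsilon> :: real assume \<epsilon>: "\<epsilon> > 0"
    define v where "v = (\<integral>x. (d x)\<^sup>2 \<partial>M)"
    define Z where "Z = (\<integral>x. (z x)\<^sup>2 \<partial>M)"
    have v0: "0 \<le> v" unfolding v_def by (intro integral_nonneg_AE) simp
    \<comment> \<open>Chosen so that \<open>\<eta> * v \<le> \<epsilon> / 2\<close>, with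
      \<open>v + 1\<close> guarding against \<open>v = 0\<close>. In \<delta> the entry
      \<open>\<epsilon> / 4\<close> bounds the growth of the error sums, and the other entry bounds
      the second half of the variance error.\<close>
    define \<eta> where "\<eta> = \<epsilon> / (2 * (v + 1))"
    define \<delta> where "\<delta> = min (\<epsilon> / 4) (\<epsilon> / (2 * (1 + 1 / \<eta>)))"
    have \<eta>: "\<eta> > 0" using \<epsilon> v0 by (simp add: \<eta>_def)
    have \<eta>v: "\<eta> * v \<le> \<epsilon> / 2" using \<epsilon> v0 by (simp add: \<eta>_def field_simps)
    have \<delta>: "\<delta> > 0" "\<delta> \<le> \<epsilon> / 4" "(1 + 1 / \<eta>) * \<delta> \<le> \<epsilon> / 2"
    proof -
      have pos: "1 + 1 / \<eta> > 0" using \<eta> by (simp add: add_pos_pos)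
      show "\<delta> > 0" using \<epsilon> pos by (simp add: \<delta>_def)
      show "\<delta> \<le> \<epsilon> / 4" unfolding \<delta>_def by (rule min.cobounded1)
      have "(1 + 1 / \<eta>) * \<delta> \<le> (1 + 1 / \<eta>) * (\<epsilon> / (2 * (1 + 1 / \<eta>)))"
        using pos by (intro mult_left_mono) (auto simp: \<delta>_def)
      also have "\<dots> = \<epsilon> / 2"
      proof -
        have "P * (\<epsilon> / (2 * P)) = \<epsilon> / 2" if "P > 0" for P using that by simp
        from this[OF pos] show ?thesis .
      qed
      finally show "(1 + 1 / \<eta>) * \<delta> \<le> \<epsilon> / 2" .
    qed
    obtain e K where e: "bounded_martingale_diff e K" and de: "(\<integral>x. (d x - e x)\<^sup>2 \<partial>M) \<le> \<delta>"
      using martingale_diff_bounded_approx[OF d \<delta>(1)] by blast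
    note b = bounded_martingale_diffD[OF e]
    note [measurable] = b(4)
    have mde: "martingale_diff 0 (\<lambda>x. d x - e x)" by (rule martingale_diff_diff[OF d b(1)])
    note de2 = martingale_diffD(3)[OF mde]
    have "\<bar>(\<integral>x. (e x)\<^sup>2 \<partial>M) - v\<bar> = \<bar>\<integral>x. (e x)\<^sup>2 - (d x)\<^sup>2 \<partial>M\<bar>"
      using b(5) D(3) by (simp add: v_def)
    also have "\<dots> \<le> (\<integral>x. \<bar>(e x)\<^sup>2 - (d x)\<^sup>2\<bar> \<partial>M)" using integral_norm_bound[of M "\<lambda>x. (e x)\<^sup>2 - (d x)\<^sup>2"] by simp
    also have "\<dots> \<le> (\<integral>x. \<eta> * (d x)\<^sup>2 + (1 + 1 / \<eta>) * (d x - e x)\<^sup>2 \<partial>M)"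
    proof (rule integral_mono)
      show "\<bar>(e x)\<^sup>2 - (d x)\<^sup>2\<bar> \<le> \<eta> * (d x)\<^sup>2 + (1 + 1 / \<eta>) * (d x - e x)\<^sup>2" for x
        using abs_diff_squares_le[OF \<eta>, of "e x" "d x"] by (simp add: power2_commute)
    qed (use b(5) D(3) de2 in auto)
    also have "\<dots> = \<eta> * v + (1 + 1 / \<eta>) * (\<integral>x. (d x - e x)\<^sup>2 \<partial>M)" using D(3) de2 by (simp add: v_def)
    also have "\<dots> \<le> \<epsilon> / 2 + (1 + 1 / \<eta>) * \<delta>"
      using \<eta>v de \<eta> by (intro add_mono mult_left_mono) auto
    finally have 1: "\<bar>(\<integral>x. (e x)\<^sup>2 \<partial>M) - v\<bar> \<le> \<epsilon>" using \<delta>(3) by linarith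
    have 2: "(\<integral>x. (birkhoff_sum n g x - birkhoff_sum n e x)\<^sup>2 \<partial>M) \<le> 2 * (n * \<delta>) + 8 * Z" for n
    proof -
      have zd2: "integrable M (\<lambda>x. (z x - z ((T ^^ n) x))\<^sup>2)"
        by (intro integrable_square_diff z2 zn2) measurable
      have S2: "integrable M (\<lambda>x. (birkhoff_sum n (\<lambda>x. d x - e x) x)\<^sup>2)" by (intro
          birkhoff_sum_square_integrable de2) measurable
      have eq: "birkhoff_sum n g x - birkhoff_sum n e x = birkhoff_sum n (\<lambda>x. d x - e x) x + (z x - z
          ((T ^^ n) x))" for x
        unfolding Sg by (simp add: birkhoff_sum_def sum_subtractf)
      have "(\<integral>x. (z x - z ((T ^^ n) x))\<^sup>2 \<partial>M) \<le> (\<integral>x. 2 * (z x)\<^sup>2 + 2 * (z ((T ^^ n) x))\<^sup>2 \<partial>M)"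
      proof (rule integral_mono[OF zd2])
        show "(z x - z ((T ^^ n) x))\<^sup>2 \<le> 2 * (z x)\<^sup>2 + 2 * (z ((T ^^ n) x))\<^sup>2" for x
          using square_add_le[of "z x" "- z ((T ^^ n) x)"] by simp
      qed (use z2 zn2 in simp)
      also have "\<dots> = 4 * Z" using z2 zn2[of n] integral_shift[of "\<lambda>x. (z x)\<^sup>2" n] by (simp add: Z_def)
      finally have zd: "(\<integral>x. (z x - z ((T ^^ n) x))\<^sup>2 \<partial>M) \<le> 4 * Z" .
      have "(\<integral>x. (birkhoff_sum n g x - birkhoff_sum n e x)\<^sup>2 \<partial>M) \<le> (\<integral>x. 2 * (birkhoff_sum n (\<lambda>x. d x - e
          x) x)\<^sup>2 + 2 * (z x - z ((T ^^ n) x))\<^sup>2 \<partial>M)"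
        unfolding eq
        by (intro integral_mono square_add_le integrable_square_add S2 zd2) (use S2 zd2 in auto)
      also have "\<dots> = 2 * (n * (\<integral>x. (d x - e x)\<^sup>2 \<partial>M)) + 2 * (\<integral>x. (z x - z ((T ^^ n) x))\<^sup>2 \<partial>M)"
        using S2 zd2 by (simp add: martingale_diff_birkhoff_sum_second_moment[OF mde])
      also have "\<dots> \<le> 2 * (n * \<delta>) + 2 * (4 * Z)" using de zd by (intro add_mono mult_left_mono) auto
      finally show ?thesis by simp
    qed
    \<comment> \<open>From here on the coboundary error \<open>8 * Z\<close> is at most
      \<open>\<epsilon> * n / 2\<close>.\<close>
    have "\<forall>\<^sub>F n in sequentially. 16 * Z / \<epsilon> \<le> real n"
      by (rule eventually_compose_filterlim[OF eventually_ge_at_top filterlim_real_sequentially])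
    then have "\<forall>\<^sub>F n in sequentially. (\<integral>x. (birkhoff_sum n g x - birkhoff_sum n e x)\<^sup>2 \<partial>M) \<le> \<epsilon> * n"
    proof eventually_elim
      case (elim n)
      have "2 * (n * \<delta>) \<le> 2 * (n * (\<epsilon> / 4))" using \<delta>(2) by (intro mult_left_mono) auto
      moreover have "16 * Z \<le> n * \<epsilon>" using elim \<epsilon> by (simp add: divide_le_eq)
      ultimately show ?case using 2[of n] by (simp add: mult.commute)
    qed
    with e 1 show "\<exists>e K. bounded_martingale_diff e K \<and> \<bar>(\<integral>x. (e x)\<^sup>2 \<partial>M) - (\<integral>x. (d x)\<^sup>2 \<partial>M)\<bar> \<le> \<epsilon> \<and>
        (\<forall>\<^sub>F n in sequentially. (\<integral>x. (birkhoff_sum n g x - birkhoff_sum n e x)\<^sup>2 \<partial>M) \<le> \<epsilon> * n)"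
      unfolding v_def by blast
  qed
qed

end

text \<open>Gordin's decomposition: with \<open>z = \<Sum>\<^sub>j\<^sub>\<ge>\<^sub>1 E[f \<circ> T\<^sup>j | F]\<close> the function \<open>d = f \<circ> T + z \<circ> T - z\<close> is a
  martingale difference, and expanding \<open>E[((f + z) \<circ> T)\<^sup>2] = E[(d + z)\<^sup>2]\<close> identifies \<open>E[d\<^sup>2]\<close>.\<close>

theorem (in filtered_system) Gordin_approximation:
  assumes f: "f \<in> borel_measurable F" and f2: "integrable M (\<lambda>x. (f x)\<^sup>2)"
    and sum: "summable (\<lambda>j. sqrt (\<integral>x. (real_cond_exp M (filtration 0) (\<lambda>x. f ((T ^^ Suc j) x)) x)\<^sup>2 \<partial>M))"
    and cond2: "\<And>j. integrable M (\<lambda>x. (real_cond_exp M (filtration 0) (\<lambda>x. f ((T ^^ Suc j) x)) x)\<^sup>2)"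
  shows "martingale_approx (\<lambda>n. birkhoff_sum n (\<lambda>x. f (T x)))
    ((\<integral>x. (f x)\<^sup>2 \<partial>M) + 2 * (\<Sum>j. \<integral>x. f x * f ((T ^^ Suc j) x) \<partial>M))"
proof -
  interpret F0: sigma_finite_subalgebra M "filtration 0" by (rule sigma_finite_filtration)
  interpret F1: sigma_finite_subalgebra M "filtration 1" by (rule sigma_finite_filtration)
  have f0: "f \<in> borel_measurable (filtration 0)" using f by (simp add: measurable_def)
  note [measurable] = measurable_filtrationD[OF f0]
  define c where "c j = real_cond_exp M (filtration 0) (\<lambda>x. f ((T ^^ Suc j) x))" for j
  define z where "z x = (\<Sum>j. c j x)" for x
  define d where "d x = f (T x) + z (T x) - z x" for x
  have c0: "c j \<in> borel_measurable (filtration 0)" for j unfolding c_def by simp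
  note [measurable] = measurable_filtrationD[OF c0]
  have z0: "z \<in> borel_measurable (filtration 0)" unfolding z_def using c0 by measurable
  note [measurable] = measurable_filtrationD[OF z0]
  have [measurable]: "d \<in> borel_measurable M" unfolding d_def by measurable
  have c2: "integrable M (\<lambda>x. (c j x)\<^sup>2)" for j unfolding c_def by (rule cond2)
  have c1: "integrable M (c j)" for j by (rule abs_expectation_le_sqrt(1)[OF _ c2]) simp
  have sum': "summable (\<lambda>j. sqrt (\<integral>x. (c j x)\<^sup>2 \<partial>M))" using sum by (simp add: c_def)
  note ser = L2_series[OF _ c2 sum', simplified]
  have z2: "integrable M (\<lambda>x. (z x)\<^sup>2)" unfolding z_def by (rule ser(2))
  have fT2: "integrable M (\<lambda>x. (f ((T ^^ i) x))\<^sup>2)" for i by (rule integrable_shift[OF f2])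
  have zT2: "integrable M (\<lambda>x. (z ((T ^^ i) x))\<^sup>2)" for i by (rule integrable_shift[OF z2])
  have fT1: "integrable M (\<lambda>x. f ((T ^^ i) x))" for i by (rule abs_expectation_le_sqrt(1)[OF _ fT2]) simp
  have zT1: "integrable M (\<lambda>x. z ((T ^^ i) x))" for i by (rule abs_expectation_le_sqrt(1)[OF _ zT2]) simp
  have d2: "integrable M (\<lambda>x. (d x)\<^sup>2)"
    unfolding d_def using fT2[of 1] zT2[of 1] z2
    by (intro integrable_square_diff integrable_square_add) auto
  have d1: "integrable M d" by (rule abs_expectation_le_sqrt(1)[OF _ d2]) simp
  have dF: "d \<in> borel_measurable (filtration (Suc 0))"
    using measurable_filtration_shift[OF f0, of 1] measurable_filtration_shift[OF z0, of 1]
        measurable_filtration_mono[OF z0, of "Suc 0"]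
    unfolding d_def by (intro borel_measurable_diff borel_measurable_add) auto
  \<comment> \<open>Term by term integration over an event, used for both \<open>z\<close> and
    \<open>z\<close> after \<open>T\<close>.\<close>
  have set_sums: "(\<lambda>j. \<integral>x\<in>A. h j x \<partial>M) sums (\<integral>x\<in>A. (\<Sum>j. h j x) \<partial>M)"
    if [measurable]: "A \<in> sets M" and h1: "\<And>j. integrable M (h j)" and AE: "AE x in M. summable (\<lambda>j. \<bar>h j x\<bar>)"
      and su: "summable (\<lambda>j. \<integral>x. \<bar>h j x\<bar> \<partial>M)" for A and h :: "nat \<Rightarrow> 'a \<Rightarrow> real"
  proof -
    have int: "integrable M (\<lambda>x. indicator A x * h j x)" for j
      using integrable_real_mult_indicator[OF that(1) h1] by (simp add: mult.commute)
    have "(\<lambda>j. \<integral>x. indicator A x * h j x \<partial>M) sums (\<integral>x. (\<Sum>j. indicator A x * h j x) \<partial>M)"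
    proof (rule sums_integral[OF int])
      show "AE x in M. summable (\<lambda>j. norm (indicator A x * h j x))"
        using AE by eventually_elim (auto simp: abs_mult indicator_def)
      show "summable (\<lambda>j. \<integral>x. norm (indicator A x * h j x) \<partial>M)"
      proof (rule summable_comparison_test'[OF su, of 0])
        fix j
        have "(\<integral>x. norm (indicator A x * h j x) \<partial>M) \<le> (\<integral>x. \<bar>h j x\<bar> \<partial>M)"
          by (rule integral_mono[OF integrable_norm[OF int] integrable_abs[OF h1]]) (auto simp: abs_mult
              indicator_def)
        then show "norm (\<integral>x. norm (indicator A x * h j x) \<partial>M) \<le> (\<integral>x. \<bar>h j x\<bar> \<partial>M)" by simp
      qed
    qed
    also have "(\<integral>x. (\<Sum>j. indicator A x * h j x) \<partial>M) = (\<integral>x. indicator A x * (\<Sum>j. h j x) \<partial>M)"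
      by (intro Bochner_Integration.integral_cong) (auto simp: indicator_def)
    finally show ?thesis by (simp add: set_lebesgue_integral_def)
  qed
  have ce_d: "AE x in M. real_cond_exp M (filtration 0) d x = 0"
  proof (rule F0.real_cond_exp_charact)
    fix A assume A: "A \<in> sets (filtration 0)"
    then have A1: "A \<in> sets (filtration 1)" using sets_filtration_Suc[of 0] by auto
    have [measurable]: "A \<in> sets M" using A subalgebra_filtration[of 0] by (auto simp: subalgebra_def)
    \<comment> \<open>Over an event \<open>A\<close> of the past, \<open>z\<close> integrates to the
      sum of all \<open>s j\<close> and \<open>z\<close> after \<open>T\<close> to the sum from
      \<open>j = 1\<close> on. The missing term \<open>s 0\<close> is the integral of
      \<open>f\<close> after \<open>T\<close>, so \<open>d\<close> integrates to zero.\<close>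
    define s where "s j = (\<integral>x\<in>A. f ((T ^^ Suc j) x) \<partial>M)" for j
    have "(\<integral>x\<in>A. c j x \<partial>M) = s j" for j
      unfolding s_def c_def by (rule F0.real_cond_exp_intA[OF fT1 A, symmetric])
    then have s0: "s sums (\<integral>x\<in>A. z x \<partial>M)"
      using set_sums[of A c] c1 ser(1,3) unfolding z_def by simp
    \<comment> \<open>\<open>c j\<close> after \<open>T\<close> is the conditional expectation of
      \<open>f\<close> after \<open>T ^^ Suc (Suc j)\<close> given \<open>filtration 1\<close>, and
      \<open>A\<close> is an event of that sigma-algebra as well.\<close>
    have "(\<integral>x\<in>A. c j (T x) \<partial>M) = s (Suc j)" for j
    proof -
      have "s (Suc j) = (\<integral>x\<in>A. real_cond_exp M (filtration 1) (\<lambda>x. f ((T ^^ Suc (Suc j)) x)) x \<partial>M)"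
        unfolding s_def by (rule F1.real_cond_exp_intA[OF fT1 A1])
      also have "\<dots> = (\<integral>x\<in>A. c j (T x) \<partial>M)"
      proof (rule set_lebesgue_integral_cong_AE)
        have "AE x in M. real_cond_exp M (filtration (1 + 0)) (\<lambda>x. f ((T ^^ Suc j) ((T ^^ 1) x))) x = c
            j ((T ^^ 1) x)"
          unfolding c_def by (rule cond_exp_shift[OF fT1])
        then have "AE x in M. real_cond_exp M (filtration 1) (\<lambda>x. f ((T ^^ Suc (Suc j)) x)) x = c j (T x)"
          by (simp add: funpow_swap1)
        then show "AE x in M. x \<in> A \<longrightarrow> real_cond_exp M (filtration 1) (\<lambda>x. f ((T ^^ Suc (Suc j)) x)) x =
            c j (T x)"
          by eventually_elim blast
      qed (simp_all add: measurable_filtrationD)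
      finally show ?thesis by simp
    qed
    moreover have "(\<lambda>j. \<integral>x\<in>A. c j (T x) \<partial>M) sums (\<integral>x\<in>A. z (T x) \<partial>M)"
    proof -
      have "AE x in M. summable (\<lambda>j. \<bar>c j (T x)\<bar>)" using AE_shift[OF ser(1), of 1] by simp
      moreover have "integrable M (\<lambda>x. c j (T x))" for j using integrable_shift[OF c1, of j 1] by simp
      moreover have "(\<integral>x. \<bar>c j (T x)\<bar> \<partial>M) = (\<integral>x. \<bar>c j x\<bar> \<partial>M)" for j
        using integral_shift[of "\<lambda>x. \<bar>c j x\<bar>" 1] by simp
      ultimately show ?thesis
        using set_sums[of A "\<lambda>j x. c j (T x)"] ser(3) unfolding z_def by simp
    qed
    ultimately have s1: "(\<lambda>j. s (Suc j)) sums (\<integral>x\<in>A. z (T x) \<partial>M)" by simp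
    have "(\<integral>x\<in>A. z x \<partial>M) = (\<integral>x\<in>A. z (T x) \<partial>M) + s 0"
      using sums_unique2[OF s0] s1 by (simp add: sums_Suc_iff)
    moreover have int: "set_integrable M A (\<lambda>x. f (T x))" "set_integrable M A (\<lambda>x. z (T x))"
        "set_integrable M A z"
    proof -
      have "set_integrable M A g" if "integrable M g" for g :: "'a \<Rightarrow> real"
        unfolding set_integrable_def by (rule integrable_mult_indicator[OF \<open>A \<in> sets M\<close> that])
      then show "set_integrable M A (\<lambda>x. f (T x))" "set_integrable M A (\<lambda>x. z (T x))" "set_integrable M A z"
        using fT1[of 1] zT1[of 1] zT1[of 0] by simp_all
    qed
    ultimately show "(\<integral>x\<in>A. d x \<partial>M) = (\<integral>x\<in>A. 0 \<partial>M)"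
      unfolding d_def by (simp add: set_integral_diff set_integral_add s_def set_integral_const)
  qed (use d1 in auto)
  have md: "martingale_diff 0 d" unfolding martingale_diff_def using dF d2 ce_d by simp
  have approx: "martingale_approx (\<lambda>n. birkhoff_sum n (\<lambda>x. f (T x))) (\<integral>x. (d x)\<^sup>2 \<partial>M)"
    by (rule martingale_approx_coboundary[OF md, where z = z]) (use z2 in \<open>auto simp: d_def\<close>)
  have fz: "integrable M (\<lambda>x. f x * z x)" by (rule integrable_mult_of_squares[OF _ _ f2 z2]) simp_all
  have zd: "integrable M (\<lambda>x. z x * d x)" by (rule integrable_mult_of_squares[OF _ _ z2 d2]) simp_all
  have "(\<lambda>j. \<integral>x. f x * c j x \<partial>M) sums (\<integral>x. (\<Sum>j. f x * c j x) \<partial>M)"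
  proof (rule sums_integral)
    show "integrable M (\<lambda>x. f x * c j x)" for j by (rule integrable_mult_of_squares[OF _ _ f2 c2]) simp_all
    show "AE x in M. summable (\<lambda>j. norm (f x * c j x))"
      using ser(1) by eventually_elim (simp add: abs_mult summable_mult)
    show "summable (\<lambda>j. \<integral>x. norm (f x * c j x) \<partial>M)"
    proof (rule summable_comparison_test'[OF summable_mult[OF sum'], of 0])
      fix j
      show "norm (\<integral>x. norm (f x * c j x) \<partial>M) \<le> sqrt (\<integral>x. (f x)\<^sup>2 \<partial>M) * sqrt (\<integral>x. (c j x)\<^sup>2 \<partial>M)"
        using Cauchy_Schwarz_integral[OF _ _ f2 c2] by simp
    qed
  qed
  also have "(\<integral>x. (\<Sum>j. f x * c j x) \<partial>M) = (\<integral>x. f x * z x \<partial>M)"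
  proof (rule integral_cong_AE)
    show "AE x in M. (\<Sum>j. f x * c j x) = f x * z x"
      using ser(1) by eventually_elim (simp add: z_def suminf_mult summable_rabs_cancel)
  qed simp_all
  also have "(\<lambda>j. \<integral>x. f x * c j x \<partial>M) = (\<lambda>j. \<integral>x. f x * f ((T ^^ Suc j) x) \<partial>M)"
  proof
    fix j
    have "integrable M (\<lambda>x. f x * f ((T ^^ Suc j) x))"
      by (rule integrable_mult_of_squares[OF _ _ f2 fT2]) simp_all
    then show "(\<integral>x. f x * c j x \<partial>M) = (\<integral>x. f x * f ((T ^^ Suc j) x) \<partial>M)"
      unfolding c_def by (intro F0.real_cond_exp_intg(2) f0) simp_all
  qed
  finally have fz_sum: "(\<integral>x. f x * z x \<partial>M) = (\<Sum>j. \<integral>x. f x * f ((T ^^ Suc j) x) \<partial>M)"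
    by (rule sums_unique)
  have "(\<integral>x. (f x + z x)\<^sup>2 \<partial>M) = (\<integral>x. (f (T x) + z (T x))\<^sup>2 \<partial>M)"
    using integral_shift[of "\<lambda>x. (f x + z x)\<^sup>2" 1] by simp
  also have "\<dots> = (\<integral>x. (d x)\<^sup>2 + (z x)\<^sup>2 + 2 * (z x * d x) \<partial>M)"
    by (intro Bochner_Integration.integral_cong) (auto simp: d_def power2_eq_square algebra_simps)
  also have "\<dots> = (\<integral>x. (d x)\<^sup>2 \<partial>M) + (\<integral>x. (z x)\<^sup>2 \<partial>M)"
    using d2 z2 zd martingale_diff_orthogonal[OF md z0 zd] by simp
  finally have "(\<integral>x. (d x)\<^sup>2 \<partial>M) + (\<integral>x. (z x)\<^sup>2 \<partial>M) = (\<integral>x. (f x + z x)\<^sup>2 \<partial>M)" by simp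
  also have "\<dots> = (\<integral>x. (f x)\<^sup>2 + (z x)\<^sup>2 + 2 * (f x * z x) \<partial>M)" by (simp add: power2_sum mult.assoc)
  also have "\<dots> = (\<integral>x. (f x)\<^sup>2 \<partial>M) + (\<integral>x. (z x)\<^sup>2 \<partial>M) + 2 * (\<integral>x. f x * z x \<partial>M)"
    using f2 z2 fz by simp
  finally have "(\<integral>x. (d x)\<^sup>2 \<partial>M) = (\<integral>x. (f x)\<^sup>2 \<partial>M) + 2 * (\<Sum>j. \<integral>x. f x * f ((T ^^ Suc j) x) \<partial>M)"
    by (simp add: fz_sum)
  with approx show ?thesis by simp
qed

section \<open>Measurability and the path space\<close>

text \<open>Right continuity moves a near-maximal point to a rational just above it. The supremum
  becomes countable, which makes the distance between distribution functions measurable.\<close>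

lemma SUP_abs_Rats_eq:
  fixes h :: "real \<Rightarrow> real"
  assumes cont: "\<And>x. continuous (at_right x) h" and bdd: "bdd_above (range (\<lambda>x. \<bar>h x\<bar>))"
  shows "(SUP x. \<bar>h x\<bar>) = (SUP x\<in>\<rat>. \<bar>h x\<bar>)"
proof (rule antisym)
  have bddQ: "bdd_above ((\<lambda>x. \<bar>h x\<bar>) ` \<rat>)" using bdd by (rule bdd_above_mono) auto
  show "(SUP x. \<bar>h x\<bar>) \<le> (SUP x\<in>\<rat>. \<bar>h x\<bar>)"
  proof (rule cSUP_least)
    fix x :: real
    show "\<bar>h x\<bar> \<le> (SUP x\<in>\<rat>. \<bar>h x\<bar>)"
    proof (rule ccontr)
      assume "\<not> ?thesis"
      then have less: "(SUP x\<in>\<rat>. \<bar>h x\<bar>) < \<bar>h x\<bar>" by simp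
      have "((\<lambda>y. \<bar>h y\<bar>) \<longlongrightarrow> \<bar>h x\<bar>) (at_right x)"
        using cont[of x] unfolding continuous_within by (rule tendsto_rabs)
      from order_tendstoD(1)[OF this less] obtain u where u: "u > x" "\<And>y. x < y \<Longrightarrow> y < u \<Longrightarrow> (SUP x\<in>\<rat>. \<bar>h
          x\<bar>) < \<bar>h y\<bar>"
        unfolding eventually_at_right_field by blast
      obtain r where r: "r \<in> \<rat>" "x < r" "r < u" using Rats_dense_in_real[OF u(1)] by blast
      then show False using u(2)[of r] cSUP_upper[OF r(1) bddQ] by simp
    qed
  qed simp
  show "(SUP x\<in>\<rat>. \<bar>h x\<bar>) \<le> (SUP x. \<bar>h x\<bar>)"
    by (rule cSUP_subset_mono[OF _ bdd]) (auto intro: Rats_0)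
qed

lemma root_cdf_eq_cdf:
  assumes "prob_space M" and [measurable]: "\<And>i. X i \<in> borel_measurable M"
  shows "root_cdf M X n = cdf (distr M borel (\<lambda>\<omega>. sqrt (real n) * (1 / real n * (\<Sum>i = 1..n. X (int i) \<omega>))))"
proof
  fix x
  show "root_cdf M X n x = cdf (distr M borel (\<lambda>\<omega>. sqrt (real n) * (1 / real n * (\<Sum>i = 1..n. X (int i) \<omega>)))) x"
    unfolding root_cdf_def cdf_def2 by (subst measure_distr) (auto intro!: arg_cong[where f = "measure M"])
qed

lemma boot_root_cdf_eq_cdf_distr:
  "boot_root_cdf n b xs = cdf (distr (measure_pmf (block_law n b)) borel
     (\<lambda>I. sqrt (real n) * (boot_mean n b xs I - measure_pmf.expectation (block_law n b) (boot_mean n b xs))))"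
proof
  fix x
  show "boot_root_cdf n b xs x = cdf (distr (measure_pmf (block_law n b)) borel
     (\<lambda>I. sqrt (real n) * (boot_mean n b xs I - measure_pmf.expectation (block_law n b) (boot_mean n b xs)))) x"
    unfolding boot_root_cdf_def cdf_def2 by (subst measure_distr) (auto simp: vimage_def)
qed

text \<open>The block law has finite support, so the bootstrap distribution function is a finite
  weighted sum of indicators of events that are measurable in the path.\<close>

lemma boot_root_cdf_measurable:
  assumes [measurable]: "\<And>i. X i \<in> borel_measurable M"
  shows "(\<lambda>\<omega>. boot_root_cdf n b (sample_path X \<omega>) y) \<in> borel_measurable M"
proof -
  define S where "S = set_pmf (block_law n b)"
  have S: "finite S" by (simp add: S_def)
  have sum: "(\<integral>I. h I \<partial>measure_pmf (block_law n b)) = (\<Sum>I\<in>S. pmf (block_law n b) I * h I)" for h :: "_ \<Rightarrow> real"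
    by (subst integral_measure_pmf[OF S]) (auto simp: S_def)
  define m where "m I \<omega> = boot_mean n b (sample_path X \<omega>) I" for I \<omega>
  have [measurable]: "m I \<in> borel_measurable M" for I
    unfolding m_def boot_mean_def boot_sample_def sample_path_def by measurable
  define A where "A \<omega> = {I. sqrt (real n) * (m I \<omega> - (\<Sum>I\<in>S. pmf (block_law n b) I * m I \<omega>)) \<le> y}" for \<omega>
  have "boot_root_cdf n b (sample_path X \<omega>) y = (\<Sum>I\<in>S. pmf (block_law n b) I * indicator (A \<omega>) I)" for \<omega>
  proof -
    have "boot_root_cdf n b (sample_path X \<omega>) y = measure_pmf.prob (block_law n b) (A \<omega>)"
      unfolding boot_root_cdf_def A_def m_def sum ..
    also have "\<dots> = (\<integral>I. indicator (A \<omega>) I \<partial>measure_pmf (block_law n b))" by simp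
    finally show ?thesis unfolding sum .
  qed
  moreover have "(\<lambda>\<omega>. indicator (A \<omega>) I :: real) \<in> borel_measurable M" for I
    unfolding A_def indicator_def mem_Collect_eq by measurable
  ultimately show ?thesis by simp
qed

lemma cdf_diff_bounded:
  assumes "real_distribution \<mu>" "real_distribution \<nu>" shows "\<bar>cdf \<mu> x - cdf \<nu> x\<bar> \<le> 1"
proof -
  interpret \<mu>: real_distribution \<mu> by fact
  interpret \<nu>: real_distribution \<nu> by fact
  show ?thesis
    using \<mu>.cdf_nonneg[of x] \<mu>.cdf_bounded_prob[of x] \<nu>.cdf_nonneg[of x] \<nu>.cdf_bounded_prob[of x] by linarith
qed

lemma root_cdf_distance:
  assumes M: "prob_space M" and [measurable]: "\<And>i. X i \<in> borel_measurable M"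
  shows "\<bar>root_cdf M X n x - boot_root_cdf n b xs x\<bar> \<le> 1"
    and "continuous (at_right x) (\<lambda>x. root_cdf M X n x - boot_root_cdf n b xs x)"
proof -
  have r: "real_distribution (distr M borel (\<lambda>\<omega>. sqrt (real n) * (1 / real n * (\<Sum>i = 1..n. X (int i) \<omega>))))"
    by (rule prob_space.real_distribution_distr[OF M]) measurable
  have b: "real_distribution (distr (measure_pmf (block_law n b)) borel
     (\<lambda>I. sqrt (real n) * (boot_mean n b xs I - measure_pmf.expectation (block_law n b) (boot_mean n b xs))))"
    by (rule prob_space.real_distribution_distr[OF measure_pmf.prob_space_axioms]) simp
  show "\<bar>root_cdf M X n x - boot_root_cdf n b xs x\<bar> \<le> 1"
    unfolding root_cdf_eq_cdf[OF assms] boot_root_cdf_eq_cdf_distr by (rule cdf_diff_bounded[OF r b])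
  show "continuous (at_right x) (\<lambda>x. root_cdf M X n x - boot_root_cdf n b xs x)"
    unfolding root_cdf_eq_cdf[OF assms] boot_root_cdf_eq_cdf_distr
    by (intro continuous_diff finite_borel_measure.cdf_is_right_cont
        real_distribution.finite_borel_measure_M r b)
qed

lemma SUP_root_cdf_measurable:
  assumes M: "prob_space M" and X [measurable]: "\<And>i. X i \<in> borel_measurable M"
  shows "(\<lambda>\<omega>. SUP x::real. \<bar>root_cdf M X n x - boot_root_cdf n b (sample_path X \<omega>) x\<bar>) \<in> borel_measurable M"
proof -
  have "(SUP x::real. \<bar>root_cdf M X n x - boot_root_cdf n b xs x\<bar>) = (SUP x\<in>\<rat>. \<bar>root_cdf M X n x -
      boot_root_cdf n b xs x\<bar>)" for xs
    by (intro SUP_abs_Rats_eq root_cdf_distance[OF assms] bdd_aboveI[of _ 1]) (use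
        root_cdf_distance(1)[OF assms] in auto)
  moreover have "(\<lambda>\<omega>. SUP x\<in>\<rat>. \<bar>root_cdf M X n x - boot_root_cdf n b (sample_path X \<omega>) x\<bar>) \<in> borel_measurable M"
  proof (rule borel_measurable_cSUP)
    show "countable (\<rat> :: real set)" by (rule countable_rat)
    show "(\<lambda>\<omega>. \<bar>root_cdf M X n x - boot_root_cdf n b (sample_path X \<omega>) x\<bar>) \<in> borel_measurable M" for x
      using boot_root_cdf_measurable[OF X] by measurable
    show "bdd_above ((\<lambda>x. \<bar>root_cdf M X n x - boot_root_cdf n b (sample_path X \<omega>) x\<bar>) ` \<rat>)" for \<omega>
      by (intro bdd_aboveI[of _ 1]) (use root_cdf_distance(1)[OF assms] in auto)
  qed
  ultimately show ?thesis by simp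
qed

text \<open>If no threshold worked, the thresholds \<open>1 / (m + 1)\<close> would provide paths
  with defect tending to \<open>0\<close> whose bootstrap distribution stays \<epsilon> away from
  the normal one, against \<open>boot_root_cdf_uniform_limit\<close>. Uniformity in the path is what
  Markov's inequality needs.\<close>

lemma boot_root_cdf_uniform:
  fixes b :: "nat \<Rightarrow> nat"
  assumes b0: "\<And>n. b n > 0" and small: "(\<lambda>n. b n / n) \<longlonglongrightarrow> 0" and s: "s > 0" and \<epsilon>: "\<epsilon> > 0"
  shows "\<exists>\<eta>>0. \<forall>\<^sub>F n in sequentially. \<forall>x y. boot_defect s n (b n) x \<le> \<eta> \<longrightarrow>
    \<bar>boot_root_cdf n (b n) x y - cdf std_normal_distribution (y / s)\<bar> < \<epsilon>"
proof (rule ccontr)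
  assume "\<not> ?thesis"
  then have neg: "\<And>\<eta>. \<eta> > 0 \<Longrightarrow> \<exists>\<^sub>F n in sequentially. \<exists>x y. boot_defect s n (b n) x \<le> \<eta> \<and>
    \<not> \<bar>boot_root_cdf n (b n) x y - cdf std_normal_distribution (y / s)\<bar> < \<epsilon>"
    by (auto simp: frequently_def)
  have "\<exists>n x y. n \<ge> m \<and> boot_defect s n (b n) x \<le> 1 / real (Suc m) \<and>
    \<not> \<bar>boot_root_cdf n (b n) x y - cdf std_normal_distribution (y / s)\<bar> < \<epsilon>" for m
    using neg[of "1 / real (Suc m)"] unfolding frequently_sequentially by (metis divide_pos_pos
        of_nat_0_less_iff zero_less_Suc zero_less_one)
  then obtain n x y where n: "\<And>m. n m \<ge> m" and d: "\<And>m. boot_defect s (n m) (b (n m)) (x m) \<le> 1 / real (Suc m)"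
    and far: "\<And>m. \<not> \<bar>boot_root_cdf (n m) (b (n m)) (x m) (y m) - cdf std_normal_distribution (y m / s)\<bar> < \<epsilon>"
    by metis
  have n_lim: "filterlim n at_top sequentially"
    by (rule filterlim_at_top_mono[OF filterlim_ident]) (use n in auto)
  have "(\<lambda>m. boot_defect s (n m) (b (n m)) (x m)) \<longlonglongrightarrow> 0"
    by (rule Lim_null_comparison[OF _ LIMSEQ_Suc[OF lim_1_over_n]]) (use d boot_defect_nonneg in auto)
  then have "uniform_limit UNIV (\<lambda>m y. boot_root_cdf (n m) (b (n m)) (x m) y)
     (\<lambda>y. cdf std_normal_distribution (y / s)) sequentially"
    using filterlim_compose[OF small n_lim] by (intro boot_root_cdf_uniform_limit b0 n_lim s) auto
  from uniform_limitD[OF this \<epsilon>] obtain m where "\<forall>y. dist (boot_root_cdf (n m) (b (n m)) (x m) y) (cdf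
      std_normal_distribution (y / s)) < \<epsilon>"
    using eventually_happens'[OF sequentially_bot] by blast
  with far[of m] show False by (simp add: dist_real_def)
qed

section \<open>Transfer of the process to the path space with its shift\<close>

lemma sample_path_measurable:
  assumes "\<And>i. X i \<in> borel_measurable M" shows "sample_path X \<in> measurable M seq_space"
  unfolding sample_path_def[abs_def] by (rule measurable_abs_UNIV) fact

lemma coordinate_measurable [measurable]: "(\<lambda>x. x i) \<in> borel_measurable seq_space"
  by (rule measurable_component_singleton) simp

lemma shift_measurable: "shift \<in> measurable seq_space seq_space"
  unfolding shift_def[abs_def] by (rule measurable_abs_UNIV) simp

lemma shift_funpow: "(shift ^^ n) x = (\<lambda>i. x (i + int n))"
  by (induction n arbitrary: x) (auto simp: shift_def algebra_simps)

lemma space_seq_space [simp]: "space seq_space = UNIV"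
  by (simp add: space_PiM)

lemma past_sigma_sets:
  "sets (past_sigma M X) = sigma_sets (space M) {X i -` B \<inter> space M | i B. i \<le> 0 \<and> B \<in> sets borel}"
  unfolding past_sigma_def by (rule sets_measure_of) auto

lemma space_past_sigma [simp]: "space (past_sigma M X) = space M"
  unfolding past_sigma_def by (rule space_measure_of) auto

lemma subalgebra_past_sigma:
  assumes [measurable]: "\<And>i. X i \<in> borel_measurable M" shows "subalgebra M (past_sigma M X)"
  unfolding subalgebra_def past_sigma_sets by (auto intro!: sets.sigma_sets_subset)

lemma measurable_past_sigma: "i \<le> 0 \<Longrightarrow> X i \<in> borel_measurable (past_sigma M X)"
  by (rule measurableI) (auto simp: past_sigma_sets)

text \<open>Generating a sigma-algebra commutes with taking preimages. Only the space of
  \<open>N\<close> matters, so \<open>N\<close> is left general.\<close>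

lemma past_sigma_sample_path:
  fixes N :: "(int \<Rightarrow> real) measure"
  assumes N: "space N = UNIV"
  shows "sets (past_sigma M X) = {sample_path X -` A \<inter> space M | A. A \<in> sets (past_sigma N (\<lambda>i x. x i))}"
proof -
  let ?G = "{(\<lambda>x. x i) -` B \<inter> UNIV | i B. i \<le> (0::int) \<and> B \<in> sets (borel :: real measure)} :: (int \<Rightarrow>
      real) set set"
  have "{sample_path X -` A \<inter> space M | A. A \<in> sigma_sets UNIV ?G}
     = sigma_sets (space M) {sample_path X -` A \<inter> space M | A. A \<in> ?G}"
    by (rule sigma_sets_vimage_commute) simp
  also have "{sample_path X -` A \<inter> space M | A. A \<in> ?G} = {X i -` B \<inter> space M | i B. i \<le> 0 \<and> B \<in> sets borel}"
  proof -
    have G: "?G = (\<lambda>(i, B). (\<lambda>x. x i) -` B) ` ({..0} \<times> sets borel)" by auto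
    have "{sample_path X -` A \<inter> space M | A. A \<in> ?G} = (\<lambda>A. sample_path X -` A \<inter> space M) ` ?G"
      by (rule Setcompr_eq_image)
    also have "\<dots> = (\<lambda>(i, B). X i -` B \<inter> space M) ` ({..0} \<times> sets borel)"
      unfolding G image_image by (intro image_cong) (auto simp: sample_path_def)
    also have "\<dots> = {X i -` B \<inter> space M | i B. i \<le> 0 \<and> B \<in> sets borel}" by auto
    finally show ?thesis .
  qed
  finally show ?thesis by (simp add: past_sigma_sets N)
qed

abbreviation path_measure :: "'a measure \<Rightarrow> (int \<Rightarrow> 'a \<Rightarrow> real) \<Rightarrow> (int \<Rightarrow> real) measure" where
  "path_measure M X \<equiv> distr M seq_space (sample_path X)"

abbreviation path_past :: "'a measure \<Rightarrow> (int \<Rightarrow> 'a \<Rightarrow> real) \<Rightarrow> (int \<Rightarrow> real) measure" where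
  "path_past M X \<equiv> past_sigma (path_measure M X) (\<lambda>i x. x i)"

lemma coordinate_measurable_path [measurable]: "(\<lambda>x. x i) \<in> borel_measurable (path_measure M X)"
  by simp

text \<open>Coordinate \<open>i\<close> of a path is coordinate \<open>i - 1\<close> of the shifted
  path, and \<open>i - 1\<close> is nonpositive when \<open>i\<close> is. This supplies
  \<open>F_shift\<close> for the past of the path space.\<close>

lemma shift_image_past:
  fixes N :: "(int \<Rightarrow> real) measure"
  assumes N: "space N = UNIV" and A: "A \<in> sets (past_sigma N (\<lambda>i x. x i))"
  shows "\<exists>B\<in>sets (past_sigma N (\<lambda>i x. x i)). A = shift -` B \<inter> space N"
proof -
  let ?F = "past_sigma N (\<lambda>i x. x i)"
  let ?V = "vimage_algebra UNIV shift ?F"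
  have sp: "shift \<in> UNIV \<rightarrow> space ?F" by (simp add: N)
  have "(\<lambda>x. x i) -` B \<in> sets ?V" if "i \<le> 0" "B \<in> sets borel" for i :: int and B :: "real set"
  proof -
    have "(\<lambda>x. x (i - 1)) -` B \<inter> space N \<in> sets ?F"
      using that measurable_sets[OF measurable_past_sigma[of "i - 1" "\<lambda>i x. x i" N], of B] by simp
    then have "shift -` ((\<lambda>x. x (i - 1)) -` B \<inter> space N) \<inter> UNIV \<in> sets ?V" by (rule in_vimage_algebra)
    moreover have "shift -` ((\<lambda>x. x (i - 1)) -` B \<inter> space N) \<inter> UNIV = (\<lambda>x. x i) -` B"
      by (auto simp: N shift_def)
    ultimately show ?thesis by simp
  qed
  then have "{(\<lambda>x. x i) -` B \<inter> space N | i B. i \<le> (0::int) \<and> B \<in> sets borel} \<subseteq> sets ?V"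
    by (auto simp: N)
  then have "sigma_sets (space N) {(\<lambda>x. x i) -` B \<inter> space N | i B. i \<le> (0::int) \<and> B \<in> sets borel} \<subseteq> sets ?V"
    using sets.sigma_sets_subset[of _ ?V] by (simp add: N)
  then have "A \<in> sets ?V" using A by (auto simp: past_sigma_sets)
  then show ?thesis unfolding sets_vimage_algebra2[OF sp] by (auto simp: N)
qed

lemma path_ergodic_system:
  assumes M: "prob_space M" and X: "\<And>i. X i \<in> borel_measurable M"
    and st: "stationary M X" and er: "ergodic M X"
  shows "ergodic_system (path_measure M X) shift (path_past M X)"
proof -
  note sp [measurable] = sample_path_measurable[OF X]
  interpret P: prob_space "path_measure M X" by (rule prob_space.prob_space_distr[OF M sp])
  note [measurable] = shift_measurable
  show ?thesis
  proof unfold_locales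
    show "shift \<in> measurable (path_measure M X) (path_measure M X)" by simp
    have "distr (path_measure M X) (path_measure M X) shift = distr (path_measure M X) seq_space shift"
      by (rule distr_cong) auto
    also have "\<dots> = distr M seq_space (shift \<circ> sample_path X)" by (rule distr_distr) measurable
    also have "shift \<circ> sample_path X = sample_path (\<lambda>i. X (i + 1))"
      by (auto simp: fun_eq_iff shift_def sample_path_def)
    also have "distr M seq_space \<dots> = path_measure M X" using st by (simp add: stationary_def)
    finally show "distr (path_measure M X) (path_measure M X) shift = path_measure M X" .
    show "subalgebra (path_measure M X) (path_past M X)"
      by (rule subalgebra_past_sigma) simp
    show "\<exists>B\<in>sets (path_past M X). A = shift -` B \<inter> space (path_measure M X)" if "A \<in> sets (path_past M
        X)" for A
      by (rule shift_image_past[OF _ that]) simp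
    fix A assume A: "A \<in> sets (path_measure M X)" "shift -` A \<inter> space (path_measure M X) = A"
    then have "measure M {\<omega> \<in> space M. sample_path X \<omega> \<in> A} \<in> {0, 1}"
      using er unfolding ergodic_def by simp
    moreover have "measure (path_measure M X) A = measure M {\<omega> \<in> space M. sample_path X \<omega> \<in> A}"
      using A by (subst measure_distr) (auto intro!: arg_cong[where f = "measure M"])
    ultimately show "measure (path_measure M X) A = 0 \<or> measure (path_measure M X) A = 1" by simp
  qed
qed

text \<open>\<open>filtration 0\<close> and \<open>F\<close> are only known to have the same sets;
  conditional expectations do not see any other difference.\<close>

lemma real_cond_exp_cong_sets:
  assumes "sets F = sets G" shows "real_cond_exp M F = real_cond_exp M G"
  unfolding fun_eq_iff real_cond_exp_def nn_cond_exp_def restr_to_subalg_def subalgebra_def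
  using assms sets_eq_imp_space_eq[OF assms] by simp

text \<open>Every past event of \<open>X\<close> is the preimage of a past event of the path space,
  so the version computed there, composed with the path map, satisfies the characterization on
  \<open>M\<close>.\<close>

lemma real_cond_exp_path:
  assumes M: "prob_space M" and X: "\<And>i. X i \<in> borel_measurable M"
    and int: "integrable M (X j)"
  shows "AE \<omega> in M. real_cond_exp M (past_sigma M X) (X j) \<omega>
    = real_cond_exp (path_measure M X) (path_past M X) (\<lambda>x. x j) (sample_path X \<omega>)"
proof -
  note sp [measurable] = sample_path_measurable[OF X]
  interpret M: prob_space M by (rule M)
  interpret P: prob_space "path_measure M X" by (rule prob_space.prob_space_distr[OF M sp])
  have subM: "subalgebra M (past_sigma M X)" by (rule subalgebra_past_sigma[OF X])
  have subP: "subalgebra (path_measure M X) (path_past M X)" by (rule subalgebra_past_sigma) simp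
  interpret FM: finite_measure_subalgebra M "past_sigma M X" by unfold_locales (rule subM)
  interpret FP: finite_measure_subalgebra "path_measure M X" "path_past M X" by unfold_locales (rule subP)
  let ?c = "real_cond_exp (path_measure M X) (path_past M X) (\<lambda>x. x j)"
  have intP: "integrable (path_measure M X) (\<lambda>x. x j)"
    using int by (subst integrable_distr_eq[OF sp]) (auto simp: sample_path_def)
  have spF: "sample_path X \<in> measurable (past_sigma M X) (path_past M X)"
    by (rule measurableI) (auto simp: past_sigma_sample_path[where N = "path_measure M X" and X = X])
  have c: "?c \<in> borel_measurable (path_past M X)" by simp
  have cP [measurable]: "?c \<in> borel_measurable seq_space"
    using measurable_from_subalg[OF subP c] by simp
  show ?thesis
  proof (rule FM.real_cond_exp_charact)
    fix A assume A: "A \<in> sets (past_sigma M X)"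
    then obtain B where B: "B \<in> sets (path_past M X)" "A = sample_path X -` B \<inter> space M"
      by (auto simp: past_sigma_sample_path[where N = "path_measure M X" and X = X])
    have [measurable]: "B \<in> sets seq_space" using B(1) subP by (auto simp: subalgebra_def)
    have tr: "(\<integral>\<omega>\<in>A. h (sample_path X \<omega>) \<partial>M) = (\<integral>x\<in>B. h x \<partial>path_measure M X)"
      if [measurable]: "h \<in> borel_measurable seq_space" for h :: "_ \<Rightarrow> real"
      unfolding set_lebesgue_integral_def
      by (subst integral_distr[OF sp]) (auto intro!: Bochner_Integration.integral_cong simp: B(2) indicator_def)
    have "(\<integral>\<omega>\<in>A. X j \<omega> \<partial>M) = (\<integral>x\<in>B. x j \<partial>path_measure M X)"
      using tr[of "\<lambda>x. x j"] by (simp add: sample_path_def)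
    also have "\<dots> = (\<integral>x\<in>B. ?c x \<partial>path_measure M X)" by (rule FP.real_cond_exp_intA[OF intP B(1)])
    also have "\<dots> = (\<integral>\<omega>\<in>A. ?c (sample_path X \<omega>) \<partial>M)" by (rule tr[symmetric]) simp
    finally show "(\<integral>\<omega>\<in>A. X j \<omega> \<partial>M) = (\<integral>\<omega>\<in>A. ?c (sample_path X \<omega>) \<partial>M)" .
  next
    show "integrable M (\<lambda>\<omega>. ?c (sample_path X \<omega>))"
      using FP.real_cond_exp_int(1)[OF intP] by (subst (asm) integrable_distr_eq[OF sp]) auto
    show "(\<lambda>\<omega>. ?c (sample_path X \<omega>)) \<in> borel_measurable (past_sigma M X)"
      by (rule measurable_compose[OF spF c])
  qed (rule int)
qed

text \<open>Gordin's theorem for the coordinate at time \<open>0\<close>, which is measurable for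
  the past. Its sums start one step later, at \<open>shift x 0\<close>, and thus run over the
  coordinates \<open>1\<close> to \<open>n\<close>.\<close>

lemma path_martingale_approx:
  assumes M: "prob_space M" and X: "\<And>i. X i \<in> borel_measurable M"
    and st: "stationary M X" and er: "ergodic M X"
    and X2: "integrable M (\<lambda>\<omega>. (X 0 \<omega>)\<^sup>2)" and mean: "(\<integral>\<omega>. X 0 \<omega> \<partial>M) = 0"
    and sum: "summable (\<lambda>j::nat. L2norm M
           (real_cond_exp M (past_sigma M X) (\<lambda>\<omega>. X (int (Suc j)) \<omega> - (\<integral>\<omega>'. X 0 \<omega>' \<partial>M))))"
  shows "filtered_system.martingale_approx (path_measure M X) shift (path_past M X)
    (\<lambda>n. filtered_system.birkhoff_sum shift n (\<lambda>x. shift x 0)) (long_run_variance M X)"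
proof -
  note sp [measurable] = sample_path_measurable[OF X]
  define P where "P = path_measure M X"
  interpret E: ergodic_system P shift "path_past M X" unfolding P_def by (rule path_ergodic_system[OF M
      X st er])
  interpret F0: sigma_finite_subalgebra P "E.filtration 0" by (rule E.sigma_finite_filtration)
  have sets_P: "sets P = sets seq_space" by (simp add: P_def)
  define f where "f = (\<lambda>x :: int \<Rightarrow> real. x 0)"
  have fT: "f ((shift ^^ n) x) = x (int n)" for n x by (simp add: f_def shift_funpow)
  have f: "f \<in> borel_measurable (path_past M X)"
    unfolding f_def by (rule measurable_past_sigma[of 0 "\<lambda>i x. x i"]) simp
  have trans: "(\<integral>x. h x \<partial>P) = (\<integral>\<omega>. h (sample_path X \<omega>) \<partial>M)" if "h \<in> borel_measurable seq_space" for h ::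
      "_ \<Rightarrow> real"
    unfolding P_def using that by (rule integral_distr[OF sp])
  have f2: "integrable P (\<lambda>x. (f x)\<^sup>2)"
    unfolding P_def f_def using X2 by (subst integrable_distr_eq[OF sp]) (auto simp: sample_path_def)
  have fM: "f \<in> borel_measurable P" unfolding P_def f_def by simp
  have fj2: "integrable P (\<lambda>x. (f ((shift ^^ j) x))\<^sup>2)" for j by (rule E.integrable_shift[OF f2])
  have fj1: "integrable P (\<lambda>x. f ((shift ^^ j) x))" for j
    using fM by (intro E.abs_expectation_le_sqrt(1)[OF _ fj2]) simp
  \<comment> \<open>Conditional Jensen for the square.\<close>
  have cond2: "integrable P (\<lambda>x. (real_cond_exp P (E.filtration 0) (\<lambda>x. f ((shift ^^ Suc j) x)) x)\<^sup>2)" for j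
    by (rule F0.integrable_convex_cond_exp[where I = UNIV and q = power2, OF fj1 _ _ fj2])
       (auto intro: convex_power2)
  have L2: "L2norm M (real_cond_exp M (past_sigma M X) (\<lambda>\<omega>. X (int (Suc j)) \<omega> - (\<integral>\<omega>'. X 0 \<omega>' \<partial>M)))
     = sqrt (\<integral>x. (real_cond_exp P (E.filtration 0) (\<lambda>x. f ((shift ^^ Suc j) x)) x)\<^sup>2 \<partial>P)" for j
  proof -
    define c where "c = real_cond_exp P (path_past M X) (\<lambda>x. x (int (Suc j)))"
    have intX: "integrable M (X (int (Suc j)))"
    proof -
      have "integrable P (\<lambda>x. x (int (Suc j)))" using fj1[of "Suc j"] unfolding fT .
      then show ?thesis unfolding P_def by (subst (asm) integrable_distr_eq[OF sp]) (auto simp: sample_path_def)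
    qed
    have "c \<in> borel_measurable P" unfolding c_def by simp
    then have cm [measurable]: "c \<in> borel_measurable seq_space" by (simp add: P_def)
    have "AE \<omega> in M. real_cond_exp M (past_sigma M X) (X (int (Suc j))) \<omega> = c (sample_path X \<omega>)"
      unfolding c_def P_def by (rule real_cond_exp_path[where X = X, OF M X intX])
    then have AE: "AE \<omega> in M. (real_cond_exp M (past_sigma M X) (X (int (Suc j))) \<omega>)\<^sup>2 = (c (sample_path
        X \<omega>))\<^sup>2"
      by eventually_elim simp
    have "(\<integral>\<omega>. (real_cond_exp M (past_sigma M X) (X (int (Suc j))) \<omega>)\<^sup>2 \<partial>M) = (\<integral>\<omega>. (c (sample_path X \<omega>))\<^sup>2 \<partial>M)"
      by (rule integral_cong_AE[OF _ _ AE]) simp_all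
    also have "\<dots> = (\<integral>x. (c x)\<^sup>2 \<partial>P)" by (rule trans[of "\<lambda>x. (c x)\<^sup>2", symmetric]) simp
    also have "c = real_cond_exp P (E.filtration 0) (\<lambda>x. f ((shift ^^ Suc j) x))"
      unfolding c_def fT using real_cond_exp_cong_sets[OF E.sets_filtration_0] by simp
    finally show ?thesis unfolding L2norm_def mean by simp
  qed
  have cov: "(\<integral>x. f x * f ((shift ^^ j) x) \<partial>P) = (\<integral>\<omega>. X 0 \<omega> * X (int j) \<omega> \<partial>M)" for j
    using trans[of "\<lambda>x. x 0 * x (int j)"] unfolding fT by (simp add: f_def sample_path_def)
  have "E.martingale_approx (\<lambda>n. E.birkhoff_sum n (\<lambda>x. f (shift x)))
    ((\<integral>x. (f x)\<^sup>2 \<partial>P) + 2 * (\<Sum>j. \<integral>x. f x * f ((shift ^^ Suc j) x) \<partial>P))"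
    using sum unfolding L2 by (intro E.Gordin_approximation f f2 cond2)
  moreover have "(\<integral>x. (f x)\<^sup>2 \<partial>P) = (\<integral>\<omega>. X 0 \<omega> * X (int 0) \<omega> \<partial>M)"
    using cov[of 0] by (simp add: power2_eq_square)
  moreover have "(\<lambda>j. \<integral>x. f x * f ((shift ^^ Suc j) x) \<partial>P) = (\<lambda>j. \<integral>\<omega>. X 0 \<omega> * X (int (Suc j)) \<omega> \<partial>M)"
    by (rule ext) (rule cov)
  ultimately show ?thesis by (simp only: f_def P_def long_run_variance_def Let_def mean diff_zero)
qed

section \<open>Consistency of the bootstrap\<close>

lemma smallo_block_length:
  fixes b :: "nat \<Rightarrow> nat"
  assumes b: "(\<lambda>n. real (b n)) \<in> o(\<lambda>n. real n powr \<alpha>)" and "\<alpha> < 1"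
  shows "(\<lambda>n. b n / n) \<longlonglongrightarrow> 0"
proof -
  have "(\<lambda>n. real n powr \<alpha>) \<in> O(\<lambda>n. real n)"
  proof (rule bigoI[of _ 1], rule eventually_sequentiallyI[of 1])
    fix n :: nat assume "1 \<le> n"
    then show "norm (real n powr \<alpha>) \<le> 1 * norm (real n)"
      using powr_mono[of \<alpha> 1 "real n"] assms(2) by simp
  qed
  from landau_o.small_big_trans[OF b this] have "(\<lambda>n. real (b n)) \<in> o(\<lambda>n. real n)" .
  then show ?thesis by (rule smalloD_tendsto)
qed

text \<open>Eventually \<open>2 * b n < n\<close>, which leaves at least \<open>n / 2\<close>
  positions.\<close>

lemma num_positions_asymp:
  fixes b :: "nat \<Rightarrow> nat"
  assumes small: "(\<lambda>n. b n / n) \<longlonglongrightarrow> 0"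
  shows "filterlim (\<lambda>n. n - b n + 1) at_top sequentially"
    and "(\<lambda>n. real (b n) / real (n - b n + 1)) \<longlonglongrightarrow> 0"
proof -
  have ev: "\<forall>\<^sub>F n in sequentially. real n / 2 \<le> real (n - b n + 1) \<and> n > 0"
  proof (intro eventually_conj eventually_gt_at_top)
    have "\<forall>\<^sub>F n in sequentially. b n / n < 1 / 2" by (rule order_tendstoD(2)[OF small]) simp
    with eventually_gt_at_top[of 0] show "\<forall>\<^sub>F n in sequentially. real n / 2 \<le> real (n - b n + 1)"
    proof eventually_elim
      case (elim n)
      then have "2 * b n < n" by (simp add: field_simps)
      then show ?case by (simp add: of_nat_diff)
    qed
  qed
  have "filterlim (\<lambda>n. real n / 2) at_top sequentially"
    using filterlim_tendsto_pos_mult_at_top[OF tendsto_const[of "1/2::real"] _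
        filterlim_real_sequentially] by simp
  then have "filterlim (\<lambda>n. real (n - b n + 1)) at_top sequentially"
    by (rule filterlim_at_top_mono) (use ev in \<open>auto elim: eventually_mono\<close>)
  then show "filterlim (\<lambda>n. n - b n + 1) at_top sequentially"
    unfolding filterlim_sequentially_iff_filterlim_real .
  have lim: "(\<lambda>n. 2 * (b n / n)) \<longlonglongrightarrow> 0" using tendsto_mult_left[OF small, of 2] by simp
  show "(\<lambda>n. real (b n) / real (n - b n + 1)) \<longlonglongrightarrow> 0"
  proof (rule Lim_null_comparison[OF _ lim])
    show "\<forall>\<^sub>F n in sequentially. norm (real (b n) / real (n - b n + 1)) \<le> 2 * (b n / n)"
      using ev
    proof eventually_elim
      case (elim n)
      then have "real (b n) / real (n - b n + 1) \<le> real (b n) / (real n / 2)"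
        by (intro divide_left_mono) auto
      then show ?case by (simp add: mult.commute)
    qed
  qed
qed

context
  fixes M :: "'a measure" and X :: "int \<Rightarrow> 'a \<Rightarrow> real" and s :: real
  assumes M: "prob_space M" and X: "\<And>i. X i \<in> borel_measurable M"
    and st: "stationary M X" and er: "ergodic M X"
    and X2: "integrable M (\<lambda>\<omega>. (X 0 \<omega>)\<^sup>2)" and mean: "(\<integral>\<omega>. X 0 \<omega> \<partial>M) = 0"
    and sum: "summable (\<lambda>j::nat. L2norm M
           (real_cond_exp M (past_sigma M X) (\<lambda>\<omega>. X (int (Suc j)) \<omega> - (\<integral>\<omega>'. X 0 \<omega>' \<partial>M))))"
    and s: "s > 0" "s\<^sup>2 = long_run_variance M X"
begin

interpretation E: ergodic_system "path_measure M X" shift "path_past M X"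
  by (rule path_ergodic_system[OF M X st er])

lemma path_sums_martingale_approx: "E.martingale_approx (\<lambda>n. E.birkhoff_sum n (\<lambda>x. shift x 0)) (s\<^sup>2)"
  unfolding s(2) by (rule path_martingale_approx[OF M X st er X2 mean sum])

lemma birkhoff_sum_path: "E.birkhoff_sum n (\<lambda>x. shift x 0) x = (\<Sum>i = 1..n. x (int i))"
  by (simp add: E.birkhoff_sum_def shift_funpow shift_def sum.atLeast1_atMost_eq add.commute)

lemma root_cdf_uniform_limit:
  "uniform_limit UNIV (root_cdf M X) (\<lambda>y. cdf std_normal_distribution (y / s)) sequentially"
proof -
  note [measurable] = sample_path_measurable[of X M, OF X]
  define h where "h n x = (\<Sum>i = 1..n. x (int i)) / sqrt n / s" for n and x :: "int \<Rightarrow> real"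
  have [measurable]: "h n \<in> borel_measurable seq_space" for n unfolding h_def by measurable
  define \<mu> where "\<mu> n = distr (path_measure M X) borel (h n)" for n
  have \<mu>: "real_distribution (\<mu> n)" for n
    unfolding \<mu>_def by (rule E.real_distribution_distr) simp
  have "weak_conv_m \<mu> std_normal_distribution"
  proof (rule levy_continuity[OF \<mu> real_dist_normal_dist])
    fix t :: real
    have "char (\<mu> n) t = (\<integral>x. iexp (t / s * (E.birkhoff_sum n (\<lambda>x. shift x 0) x / sqrt n)) \<partial>path_measure
        M X)" for n
    proof -
      have "char (\<mu> n) t = (\<integral>x. iexp (t * h n x) \<partial>path_measure M X)"
        unfolding char_def \<mu>_def by (subst integral_distr) simp_all
      also have "\<dots> = (\<integral>x. iexp (t / s * (E.birkhoff_sum n (\<lambda>x. shift x 0) x / sqrt n)) \<partial>path_measure M X)"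
        unfolding birkhoff_sum_path h_def by (intro Bochner_Integration.integral_cong) (simp_all add:
            mult.commute)
      finally show ?thesis .
    qed
    moreover have "(\<lambda>n. \<integral>x. iexp (t / s * (E.birkhoff_sum n (\<lambda>x. shift x 0) x / sqrt n)) \<partial>path_measure M X)
       \<longlonglongrightarrow> complex_of_real (exp (- ((t / s)\<^sup>2 * s\<^sup>2 / 2)))"
      by (rule E.martingale_approx_clt[OF path_sums_martingale_approx])
    moreover have "(t / s)\<^sup>2 * s\<^sup>2 = t\<^sup>2" using s(1) by (simp add: power_divide)
    ultimately show "(\<lambda>n. char (\<mu> n) t) \<longlonglongrightarrow> char std_normal_distribution t"
      by (simp add: char_std_normal_distribution)
  qed
  then have ul: "uniform_limit UNIV (\<lambda>n. cdf (\<mu> n)) (cdf std_normal_distribution) sequentially"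
    by (rule uniform_limit_cdf[OF \<mu> real_dist_normal_dist _ isCont_cdf_std_normal])
  have eq: "root_cdf M X n y = cdf (\<mu> n) (y / s)" if "n > 0" for n y
  proof -
    have iff: "h n (sample_path X \<omega>) \<le> y / s \<longleftrightarrow> sqrt (real n) * (1 / real n * (\<Sum>i = 1..n. X (int i) \<omega>)) \<le>
        y" for \<omega>
    proof -
      have "sqrt (real n) * (1 / real n * S) = S / sqrt n" for S
        using that by (simp add: field_simps)
      moreover have "(S / s \<le> y / s) = (S \<le> y)" for S using s(1) by (simp add: divide_le_cancel)
      ultimately show ?thesis by (simp only: h_def sample_path_def)
    qed
    have "cdf (\<mu> n) (y / s) = measure M {\<omega> \<in> space M. h n (sample_path X \<omega>) \<le> y / s}"
    proof -
      have "\<mu> n = distr M borel (\<lambda>\<omega>. h n (sample_path X \<omega>))"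
        unfolding \<mu>_def by (subst distr_distr) (auto simp: comp_def)
      then show ?thesis
        unfolding cdf_def2 by (simp add: measure_distr vimage_def Int_def conj_commute)
    qed
    then show ?thesis unfolding root_cdf_def iff by simp
  qed
  show ?thesis
  proof (rule uniform_limitI)
    fix e :: real assume "e > 0"
    from uniform_limitD[OF ul this] eventually_gt_at_top[of 0]
    show "\<forall>\<^sub>F n in sequentially. \<forall>y\<in>UNIV. dist (root_cdf M X n y) (cdf std_normal_distribution (y / s)) < e"
      by eventually_elim (simp add: eq)
  qed
qed

lemma expected_boot_defect_tendsto:
  fixes b :: "nat \<Rightarrow> nat"
  assumes b0: "\<And>n. b n > 0" and b: "filterlim b at_top sequentially" and small: "(\<lambda>n. b n / n) \<longlonglongrightarrow> 0"
  shows "(\<lambda>n. \<integral>x. boot_defect s n (b n) x \<partial>path_measure M X) \<longlonglongrightarrow> 0"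
    and "integrable (path_measure M X) (boot_defect s n (b n))"
proof -
  define P where "P = path_measure M X"
  define Y where "Y n = E.birkhoff_sum n (\<lambda>x. shift x 0)" for n
  define N where "N n = n - b n + 1" for n
  define c where "c n = sqrt (num_blocks n (b n))" for n
  define D1 where "D1 n x = \<bar>E.birkhoff_sum (N n) (\<lambda>x. (Y (b n) x)\<^sup>2 / b n) x / N n - s\<^sup>2\<bar>" for n x
  define D2 where "D2 n x = (E.birkhoff_sum (N n) (\<lambda>x. Y (b n) x / sqrt (b n)) x / N n)\<^sup>2" for n x
  define D3 where "D3 n x = E.birkhoff_sum (N n) (\<lambda>x. tail_weight (c n) (Y (b n) x / sqrt (b n))) x / N
      n" for n x
  note Y = path_sums_martingale_approx[folded Y_def]
  note YD = E.martingale_approxD[OF Y]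
  note [measurable] = YD(1)
  have N0: "N n > 0" for n by (simp add: N_def)
  have c0: "c n \<ge> 0" for n by (simp add: c_def)
  have block: "block_sum (b n) x j = Y (b n) ((shift ^^ j) x) / sqrt (b n)" for n x j
    by (simp add: block_sum_def Y_def birkhoff_sum_path shift_funpow add.commute)
  \<comment> \<open>Block positions start at \<open>1\<close>, so the average is an orbit average
    started at \<open>shift x\<close>. Invariance removes this extra shift in
    \<open>shiftD\<close>.\<close>
  have avg: "block_avg n (b n) (\<lambda>j. h ((shift ^^ j) x)) = E.birkhoff_sum (N n) h (shift x) / N n" for n
      x and h :: "_ \<Rightarrow> real"
    unfolding block_avg_def N_def E.birkhoff_sum_def
    by (simp only: sum.atLeast1_atMost_eq One_nat_def funpow_Suc_right comp_apply)
  have eq: "boot_defect s n (b n) x = D1 n (shift x) + D2 n (shift x) + D3 n (shift x)" for n x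
    unfolding boot_defect_def block
    using avg[of n "\<lambda>x. (Y (b n) x / sqrt (b n))\<^sup>2" x] avg[of n "\<lambda>x. Y (b n) x / sqrt (b n)" x]
      avg[of n "\<lambda>x. tail_weight (c n) (Y (b n) x / sqrt (b n))" x]
    by (simp add: D1_def D2_def D3_def c_def power_divide)
  have f2: "integrable P (\<lambda>x. (shift x 0)\<^sup>2)"
    using YD(2)[of 1] by (simp add: Y_def E.birkhoff_sum_def P_def)
  have fm: "(\<lambda>x. shift x 0) \<in> borel_measurable P"
    using YD(1)[of 1] by (simp add: Y_def E.birkhoff_sum_def P_def)
  have Yb2: "integrable P (\<lambda>x. (Y (b n) x / sqrt (b n))\<^sup>2)" for n
    using YD(2)[of "b n"] by (simp add: power_divide P_def)
  have tw: "integrable P (\<lambda>x. tail_weight (c n) (Y (b n) x / sqrt (b n)))" for n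
    by (rule Bochner_Integration.integrable_bound[OF Yb2[of n]])
       (use tail_weight_le_square tail_weight_nonneg[OF c0] in \<open>auto simp: P_def\<close>)
  have i1: "integrable P (D1 n)" for n
    unfolding D1_def P_def using YD(2)
    by (intro integrable_abs Bochner_Integration.integrable_diff integrable_divide_zero
        E.birkhoff_sum_integral(1)) auto
  have i2: "integrable P (D2 n)" for n
    unfolding D2_def power_divide P_def
    using E.birkhoff_sum_square_integrable[OF _ Yb2[of n, unfolded P_def], of "N n"] by simp
  have i3: "integrable P (D3 n)" for n
    unfolding D3_def P_def using E.birkhoff_sum_integral(1)[OF tw[unfolded P_def]] by simp
  have iD: "integrable P (\<lambda>x. D1 n x + D2 n x + D3 n x)" for n using i1 i2 i3 by simp
  have shiftD: "integrable P (\<lambda>x. D1 n (shift x) + D2 n (shift x) + D3 n (shift x))"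
    "(\<integral>x. D1 n (shift x) + D2 n (shift x) + D3 n (shift x) \<partial>P) = (\<integral>x. D1 n x + D2 n x + D3 n x \<partial>P)" for n
    using E.integrable_shift[OF iD[unfolded P_def], of n 1]
      E.integral_shift[OF borel_measurable_integrable[OF iD[unfolded P_def]], of n 1] by (simp_all add: P_def)
  show "integrable (path_measure M X) (boot_defect s n (b n))"
    unfolding eq using shiftD(1) by (simp add: P_def)
  have N_lim: "filterlim N at_top sequentially" and bN: "(\<lambda>n. real (b n) / real (N n)) \<longlonglongrightarrow> 0"
    using num_positions_asymp[OF small] by (simp_all add: N_def[abs_def])
  have c_lim: "filterlim c at_top sequentially"
    unfolding c_def
    using num_blocks_asymp(1)[OF b0 filterlim_ident small]
    by (intro filterlim_compose[OF sqrt_at_top] filterlim_compose[OF filterlim_real_sequentially])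
  have "(\<lambda>n. \<integral>x. D1 n x \<partial>P) \<longlonglongrightarrow> 0"
    unfolding D1_def P_def by (rule E.block_second_moment_tendsto[OF Y b N_lim bN])
  moreover have "(\<lambda>n. \<integral>x. D2 n x \<partial>P) \<longlonglongrightarrow> 0"
    unfolding D2_def P_def Y_def
    by (rule E.block_mean_tendsto[OF path_sums_martingale_approx fm[unfolded P_def] f2[unfolded P_def]
        N_lim bN])
  moreover have "(\<lambda>n. \<integral>x. D3 n x \<partial>P) \<longlonglongrightarrow> 0"
  proof -
    \<comment> \<open>All positions contribute the same expectation, so the Lindeberg part concerns
      a single block.\<close>
    have "(\<integral>x. D3 n x \<partial>P) = (\<integral>x. tail_weight (c n) (Y (b n) x / sqrt (b n)) \<partial>P)" for n
      unfolding D3_def P_def using E.birkhoff_sum_integral(2)[OF tw[unfolded P_def], of "N n"] N0[of n] by simp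
    then show ?thesis using E.block_tail_tendsto[OF Y b c_lim] by (simp add: P_def)
  qed
  ultimately have "(\<lambda>n. (\<integral>x. D1 n x \<partial>P) + (\<integral>x. D2 n x \<partial>P) + (\<integral>x. D3 n x \<partial>P)) \<longlonglongrightarrow> 0 + 0 + 0"
    by (intro tendsto_add)
  moreover have "(\<integral>x. boot_defect s n (b n) x \<partial>P) = (\<integral>x. D1 n x \<partial>P) + (\<integral>x. D2 n x \<partial>P) + (\<integral>x. D3 n x \<partial>P)" for n
    unfolding eq shiftD(2) using i1 i2 i3 by simp
  ultimately show "(\<lambda>n. \<integral>x. boot_defect s n (b n) x \<partial>path_measure M X) \<longlonglongrightarrow> 0" by (simp add: P_def)
qed

lemma bootstrap_consistent:
  fixes b :: "nat \<Rightarrow> nat"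
  assumes b0: "\<And>n. b n > 0" and b: "filterlim b at_top sequentially" and small: "(\<lambda>n. b n / n) \<longlonglongrightarrow> 0"
  shows "tendsto_in_prob M
           (\<lambda>n \<omega>. SUP x::real. \<bar>root_cdf M X n x - boot_root_cdf n (b n) (sample_path X \<omega>) x\<bar>)
           (\<lambda>_. 0)"
  unfolding tendsto_in_prob_def
proof (intro conjI allI impI)
  interpret M: prob_space M by (rule M)
  note sp [measurable] = sample_path_measurable[of X M, OF X]
  show "(\<lambda>\<omega>. SUP x::real. \<bar>root_cdf M X n x - boot_root_cdf n (b n) (sample_path X \<omega>) x\<bar>) \<in>
      borel_measurable M" for n
    by (rule SUP_root_cdf_measurable[OF M X])
  show "(\<lambda>_. 0 :: real) \<in> borel_measurable M" by simp
  fix \<epsilon> :: real assume \<epsilon>: "\<epsilon> > 0"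
  note int = expected_boot_defect_tendsto(2)[OF b0 b small]
  note [measurable] = borel_measurable_integrable[OF int]
  obtain \<eta> where \<eta>: "\<eta> > 0" and boot: "\<forall>\<^sub>F n in sequentially. \<forall>x y. boot_defect s n (b n) x \<le> \<eta> \<longrightarrow>
    \<bar>boot_root_cdf n (b n) x y - cdf std_normal_distribution (y / s)\<bar> < \<epsilon> / 2"
    using boot_root_cdf_uniform[OF b0 small s(1), of "\<epsilon> / 2"] \<epsilon> by auto
  have root: "\<forall>\<^sub>F n in sequentially. \<forall>y\<in>UNIV. dist (root_cdf M X n y) (cdf std_normal_distribution (y /
      s)) < \<epsilon> / 2"
    using \<epsilon> by (intro uniform_limitD[OF root_cdf_uniform_limit]) simp
  define p where "p n = measure M {\<omega> \<in> space M.
    \<bar>(SUP x::real. \<bar>root_cdf M X n x - boot_root_cdf n (b n) (sample_path X \<omega>) x\<bar>) - 0\<bar> > \<epsilon>}" for n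
  have lim: "(\<lambda>n. (\<integral>x. boot_defect s n (b n) x \<partial>path_measure M X) / \<eta>) \<longlonglongrightarrow> 0"
    using tendsto_divide[OF expected_boot_defect_tendsto(1)[OF b0 b small] tendsto_const[of \<eta>]] \<eta> by simp
  have "p \<longlonglongrightarrow> 0"
  proof (rule Lim_null_comparison[OF _ lim])
    show "\<forall>\<^sub>F n in sequentially. norm (p n) \<le> (\<integral>x. boot_defect s n (b n) x \<partial>path_measure M X) / \<eta>"
      using boot root
    proof eventually_elim
      case (elim n)
      \<comment> \<open>Below the threshold \<eta> both distribution functions are within
        \<open>\<epsilon> / 2\<close> of the same normal one, hence within \<epsilon> of each
        other.\<close>
      have sub: "{\<omega> \<in> space M. \<bar>(SUP x::real. \<bar>root_cdf M X n x - boot_root_cdf n (b n) (sample_path X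
          \<omega>) x\<bar>) - 0\<bar> > \<epsilon>}
         \<subseteq> {\<omega> \<in> space M. boot_defect s n (b n) (sample_path X \<omega>) \<ge> \<eta>}"
      proof (intro Collect_mono impI conjI; elim conjE)
        fix \<omega> assume big: "\<bar>(SUP x::real. \<bar>root_cdf M X n x - boot_root_cdf n (b n) (sample_path X \<omega>)
            x\<bar>) - 0\<bar> > \<epsilon>"
        show "boot_defect s n (b n) (sample_path X \<omega>) \<ge> \<eta>"
        proof (rule ccontr)
          assume "\<not> ?thesis"
          then have bd: "\<bar>boot_root_cdf n (b n) (sample_path X \<omega>) y - cdf std_normal_distribution (y /
              s)\<bar> < \<epsilon> / 2" for y
            using elim(1) by simp
          have le: "\<bar>root_cdf M X n y - boot_root_cdf n (b n) (sample_path X \<omega>) y\<bar> \<le> \<epsilon>" for y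
          proof -
            have "\<bar>root_cdf M X n y - cdf std_normal_distribution (y / s)\<bar> < \<epsilon> / 2"
              using elim(2) by (simp add: dist_real_def)
            then show ?thesis using bd[of y] by linarith
          qed
          have "(SUP x::real. \<bar>root_cdf M X n x - boot_root_cdf n (b n) (sample_path X \<omega>) x\<bar>) \<le> \<epsilon>"
            by (rule cSUP_least) (use le in auto)
          moreover have "0 \<le> (SUP x::real. \<bar>root_cdf M X n x - boot_root_cdf n (b n) (sample_path X \<omega>) x\<bar>)"
          proof (rule cSUP_upper2[where x = 0])
            show "bdd_above (range (\<lambda>x. \<bar>root_cdf M X n x - boot_root_cdf n (b n) (sample_path X \<omega>) x\<bar>))"
              by (rule bdd_aboveI[of _ \<epsilon>]) (use le in auto)
          qed simp_all
          ultimately show False using big by simp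
        qed
      qed simp_all
      have "p n \<le> measure M {\<omega> \<in> space M. boot_defect s n (b n) (sample_path X \<omega>) \<ge> \<eta>}"
        unfolding p_def by (rule M.finite_measure_mono[OF sub]) simp
      also have "\<dots> = measure (path_measure M X) {x \<in> space (path_measure M X). boot_defect s n (b n) x \<ge> \<eta>}"
      proof -
        have "boot_defect s n (b n) \<in> borel_measurable seq_space"
          using borel_measurable_integrable[OF int[of n]] by simp
        then have "{x \<in> space seq_space. boot_defect s n (b n) x \<ge> \<eta>} \<in> sets seq_space" by measurable
        then show ?thesis by (subst measure_distr[OF sp]) (auto intro!: arg_cong[where f = "measure M"])
      qed
      also have "\<dots> \<le> (\<integral>x. boot_defect s n (b n) x \<partial>path_measure M X) / \<eta>"
        by (rule integral_Markov_inequality_measure[OF int, where A = "{}"]) (use \<eta> boot_defect_nonneg in auto)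
      finally show ?case by (simp add: p_def)
    qed
  qed
  then show "(\<lambda>n. measure M {\<omega> \<in> space M. \<bar>(SUP x::real. \<bar>root_cdf M X n x - boot_root_cdf n (b n)
      (sample_path X \<omega>) x\<bar>) - 0\<bar> > \<epsilon>}) \<longlonglongrightarrow> 0"
    unfolding p_def .
qed

end

theorem theorem5p1:
  fixes M :: "'a measure" and X :: "int \<Rightarrow> 'a \<Rightarrow> real"
    and b :: "nat \<Rightarrow> nat" and \<alpha> :: real
  assumes "prob_space M"
    and "\<And>i. X i \<in> borel_measurable M"
    and "stationary M X"
    and "ergodic M X"
    and "integrable M (\<lambda>\<omega>. X 0 \<omega> ^ 4)"
    and "(\<integral>\<omega>. X 0 \<omega> \<partial>M) = 0"
    and "summable (\<lambda>j::nat. L2norm M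
           (real_cond_exp M (past_sigma M X)
              (\<lambda>\<omega>. X (int (Suc j)) \<omega> - (\<integral>\<omega>'. X 0 \<omega>' \<partial>M))))"
    and "long_run_variance M X > 0"
    and "0 < \<alpha>" and "\<alpha> < 2 / 5"
    and "\<And>n. b n > 0"
    and "filterlim b at_top sequentially"
    and "(\<lambda>n. real (b n)) \<in> o(\<lambda>n. real n powr \<alpha>)"
  shows "tendsto_in_prob M
           (\<lambda>n \<omega>. SUP x::real. \<bar>root_cdf M X n x - boot_root_cdf n (b n) (sample_path X \<omega>) x\<bar>)
           (\<lambda>_. 0)"
proof -
  interpret prob_space M by fact
  note [measurable] = assms(2)
  \<comment> \<open>The fourth power is the square of the square, and on a probability space a
    function with integrable square is integrable.\<close>
  have "integrable M (\<lambda>\<omega>. (X 0 \<omega>)\<^sup>2)"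
    using assms(5) by (intro square_integrable_imp_integrable[of "\<lambda>\<omega>. (X 0 \<omega>)\<^sup>2"]) simp_all
  moreover have "sqrt (long_run_variance M X) > 0" "(sqrt (long_run_variance M X))\<^sup>2 = long_run_variance M X"
    using assms(8) by simp_all
  moreover have "(\<lambda>n. b n / n) \<longlonglongrightarrow> 0"
    using assms(10) by (intro smallo_block_length[OF assms(13)]) simp
  ultimately show ?thesis
    using assms by (intro bootstrap_consistent[where s = "sqrt (long_run_variance M X)"]) auto
qed

end
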